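(* Let $P$ and $Q$ be two latent variable models on $\mathcal{X}$ with conditional scores $\mathbf{s}_p(x|z)$ and $\mathbf{s}_q(x|w)$, let $R$ be a fixed probability distribution on $\mathcal{X}$, and let $m\ge 1$. For each $t\ge1$ let $\mathbf{y}^{(t)}=(x,\mathbf{z}^{(t)},\mathbf{w}^{(t)})$ be a random variable in which $x\sim R$ and, conditionally on $x$, $\mathbf{z}^{(t)}\in\mathcal{Z}^m$ and $\mathbf{w}^{(t)}\in\mathcal{W}^m$ are draws of size $m$ from the Markov chains of $P$ and $Q$ respectively (targeting $P_Z(\cdot|x)$ and $Q_W(\cdot|x)$) after $t$ burn-in steps. Let $\mathbf{y}_1^{(t)},\dots,\mathbf{y}_n^{(t)}$ be i.i.d. copies of $\mathbf{y}^{(t)}$, let $\bar H_{p,q}$ be the difference kernel defined in the context, and put $$U_n^{(t)}(P,Q)=\frac{1}{n(n-1)}\sum_{i\ne j}\bar H_{p,q}[\mathbf{y}_i^{(t)},\mathbf{y}_j^{(t)}],\qquad v_{n,t}=(n-1)\sum_{i=1}^n\bigl(U_{n,-i}^{(t)}(P,Q)-U_n^{(t)}(P,Q)\bigr)^2,\qquad T_{n,t}=\sqrt{n}\,\frac{U_n^{(t)}(P,Q)}{\sqrt{v_{n,t}}},$$ where $U_{n,-i}^{(t)}(P,Q)$ is the same U-statistic computed on the sample with the $i$-th point removed. Let $\mu_{P,Q}=\mathrm{KSD}^2(P\Vert R)-\mathrm{KSD}^2(Q\Vert R)$ and $\theta_t=\mathbb{E}\bigl[\bar H_{p,q}[\mathbf{y}_1^{(t)},\mathbf{y}_2^{(t)}]\bigr]$.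 Assume: (a) $\limsup_{t\to\infty}\mathbb{E}\bigl[\bar H_{p,q}[\mathbf{y}_1^{(t)},\mathbf{y}_2^{(t)}]^4\bigr]<\infty$; (b) $\limsup_{t\to\infty}\mathbb{E}\bigl[|\bar H_{p,q}[\mathbf{y}_1^{(t)},\mathbf{y}_2^{(t)}]-\theta_t|^3\bigr]^{1/3}<\infty$; (c) $\sigma_t^2=4\,\mathrm{Var}\bigl[\mathbb{E}\bigl[\bar H_{p,q}[\mathbf{y}_1^{(t)},\mathbf{y}_2^{(t)}]\,\big|\,\mathbf{y}_2^{(t)}\bigr]\bigr]$ converges as $t\to\infty$ to a constant $\sigma_{P,Q}^2>0$; (d) $\theta_t\to\mu_{P,Q}$ as $t\to\infty$. Let $\alpha\in(0,1)$ and let $\tau_{1-\alpha}$ be the $(1-\alpha)$-quantile of $\mathcal{N}(0,1)$; the test rejects the null hypothesis $H_0:\mathrm{KSD}(P\Vert R)\le\mathrm{KSD}(Q\Vert R)$ in favour of $H_1:\mathrm{KSD}(P\Vert R)>\mathrm{KSD}(Q\Vert R)$ when $T_{n,t}>\tau_{1-\alpha}$. Then, in the limit $n\to\infty$ with $t=t(n)\to\infty$ growing as a function of $n$ such that $\sqrt{n}\,(\theta_{t(n)}-\mu_{P,Q})\to0$: (i) if $R$ satisfies $H_0$ (i.e. $\mu_{P,Q}\le0$), then $\lim\Pr(T_{n,t}>\tau_{1-\alpha})\le\alpha$; (ii) if $R$ satisfies $H_1$ (i.e. $\mu_{P,Q}>0$), then $\lim\Pr(T_{n,t}>\tau_{1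-\alpha})=1$.
   Context: **Observation space.** $\mathcal{X}$ is either $\mathbb{R}^D$ (densities with respect to Lebesgue measure, strictly positive and continuously differentiable) or $\{0,\dots,L-1\}^D$ with $L>1$ (densities are strictly positive probability mass functions). **Difference operators (discrete case).** $\Delta_d f(x)=f(x^1,\dots,x^d+1 \bmod L,\dots,x^D)-f(x)$, $\Delta_d^{-1}f(x)=f(x)-f(x^1,\dots,x^d-1\bmod L,\dots,x^D)$, $\Delta=(\Delta_1,\dots,\Delta_D)$, $\Delta^{-1}=(\Delta_1^{-1},\dots,\Delta_D^{-1})$. **Latent variable models.** $\mathcal{Z},\mathcal{W}$ are Polish spaces. $P$ is given by a family of densities $\{p(\cdot|z):z\in\mathcal{Z}\}$ on $\mathcal{X}$ and a prior probability measure $P_Z$ on $\mathcal{Z}$; its marginal density is $p(x)=\int p(x|z)\,dP_Z(z)$ and its posterior is $P_Z(dz|x)=\{p(x|z)/p(x)\}P_Z(dz)$. $Q$ is given in the same way by $\{q(\cdot|w):w\in\mathcal{W}\}$ and a prior $Q_W$. The conditional score is $\mathbf{s}_p(x|z)=p(x|z)^{-1}\nabla_x p(x|z)$ (continuous case) or $p(x|z)^{-1}\Delta_x p(x|z)$ (discrete case), and the marginal score is $\mathbf{s}_p(x)=p(x)^{-1}\nabla p(x)$ or $p(x)^{-1}\Delta p(x)$; similarly for $q$. **Kernel.** $k:\mathcal{X}\times\mathcal{X}\to\mathbb{R}$ is a positive definite kernel, continuously differentiable in each argument with continuous mixed derivatives in the continuous case. In the continuous case $k_1(a,b)=\nabla_x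 k(x,x')|_{x=a,x'=b}\in\mathbb{R}^D$ and $k_{12}(a,b)=\nabla_x^\top\nabla_{x'}k(x,x')|_{x=a,x'=b}\in\mathbb{R}$; in the discrete case $\nabla$ is replaced by $\Delta^{-1}$ in these two definitions. **KSD.** $\mathcal{F}$ is the space of $f=(f_1,\dots,f_D)$ with each $f_d$ in the RKHS of $k$, with $\langle f,g\rangle_{\mathcal F}=\sum_d\langle f_d,g_d\rangle$. The Stein operator is $\mathcal{A}_Pf(x)=\langle\mathbf{s}_p(x),f(x)\rangle+\langle\nabla,f(x)\rangle$ (continuous) or $\mathcal{A}_Pf(x)=\mathrm{tr}[f(x)\mathbf{s}_p(x)^\top+\Delta^{-1}f(x)]$ (discrete), and $\mathrm{KSD}(P\Vert R)=\sup_{\|f\|_{\mathcal F}\le1}|\mathbb{E}_{x\sim R}\mathcal{A}_Pf(x)-\mathbb{E}_{y\sim P}\mathcal{A}_Pf(y)|$, where it is a standing assumption that $\mathbb{E}_{y\sim P}\mathcal{A}_Pf(y)=0$ for all $f\in\mathcal F$ (and likewise for $Q$), and that $\mathrm{KSD}(P\Vert R)$ and $\mathrm{KSD}(Q\Vert R)$ are finite. **Difference kernel.** For $\mathbf{z}=(z_1,\dots,z_m)$ let $\bar{\mathbf{s}}_p(x|\mathbf{z})=\frac1m\sum_{j=1}^m\mathbf{s}_p(x|z_j)$, and $$\bar H_p[(x,\mathbf{z}),(x',\mathbf{z}')]=\bar{\mathbf{s}}_p(x|\mathbf{z})^\top\bar{\mathbf{s}}_p(x'|\mathbf{z}')k(x,x')+\bar{\mathbf{s}}_p(x|\mathbf{z})^\top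 k_1(x',x)+k_1(x,x')^\top\bar{\mathbf{s}}_p(x'|\mathbf{z}')+k_{12}(x,x').$$ $\bar H_q$ is defined analogously from $\mathbf{s}_q(x|w)$, and $\bar H_{p,q}[(x,\mathbf{z},\mathbf{w}),(x',\mathbf{z}',\mathbf{w}')]=\bar H_p[(x,\mathbf{z}),(x',\mathbf{z}')]-\bar H_q[(x,\mathbf{w}),(x',\mathbf{w}')]$. **Convention.** The event $T_{n,t}>\tau_{1-\alpha}$ is understood as $U_n^{(t)}(P,Q)>(\sqrt{v_{n,t}}/\sqrt{n})\,\tau_{1-\alpha}$, which is how the test is implemented. *)

theory Defs
  imports "HOL-Probability.Probability"
begin

section \<open>Observation spaces and difference operators\<close>

text \<open>
  The two observation spaces are both realised inside the type \<^typ>\<open>real ^ 'd\<close>, where \<open>D\<close> is the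
  cardinality of \<open>'d\<close>: \<open>Euclid\<close> is the whole of it and \<open>Grid L\<close> is the subset \<open>{0, ..., L - 1}^D\<close>.
  For \<open>Grid L\<close>, values of functions outside the carrier are irrelevant throughout.
\<close>

datatype obs_space = Euclid | Grid nat

fun admissible :: "obs_space \<Rightarrow> bool" where
  "admissible Euclid = True"
| "admissible (Grid L) = (L > 1)"

fun obs :: "obs_space \<Rightarrow> (real ^ 'd::finite) set" where
  "obs Euclid = UNIV"
| "obs (Grid L) = {x. \<forall>i. x $ i \<in> real ` {0..<L}}"

text \<open>The reference measure of densities; its \<open>\<sigma>\<close>-algebra is the one put on the observation space.\<close>

fun base :: "obs_space \<Rightarrow> (real ^ 'd::finite) measure" where
  "base Euclid = lborel"
| "base (Grid L) = count_space (obs (Grid L))"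

definition grad :: "(real ^ 'd::finite \<Rightarrow> real) \<Rightarrow> real ^ 'd \<Rightarrow> real ^ 'd" where
  "grad f x = (THE g. GDERIV f x :> g)"

definition C1 :: "(real ^ 'd::finite \<Rightarrow> real) \<Rightarrow> bool" where
  "C1 f \<longleftrightarrow> (\<forall>x. \<exists>g. GDERIV f x :> g) \<and> continuous_on UNIV (grad f)"

definition cyc_shift :: "nat \<Rightarrow> int \<Rightarrow> 'd \<Rightarrow> real ^ 'd::finite \<Rightarrow> real ^ 'd" where
  "cyc_shift L s d x = (\<chi> i. if i = d then real_of_int ((\<lfloor>x $ i\<rfloor> + s) mod int L) else x $ i)"

text \<open>
  \<open>fwd\<close> is \<open>\<nabla>\<close> or \<open>\<Delta>\<close> and is used for scores; \<open>bwd\<close> is \<open>\<nabla>\<close> or \<open>\<Delta>\<^sup>-\<^sup>1\<close> and is used for the kernel and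
  in the divergence part of the Stein operator.
\<close>

fun fwd :: "obs_space \<Rightarrow> (real ^ 'd::finite \<Rightarrow> real) \<Rightarrow> real ^ 'd \<Rightarrow> real ^ 'd" where
  "fwd Euclid f x = grad f x"
| "fwd (Grid L) f x = (\<chi> d. f (cyc_shift L 1 d x) - f x)"

fun bwd :: "obs_space \<Rightarrow> (real ^ 'd::finite \<Rightarrow> real) \<Rightarrow> real ^ 'd \<Rightarrow> real ^ 'd" where
  "bwd Euclid f x = grad f x"
| "bwd (Grid L) f x = (\<chi> d. f x - f (cyc_shift L (- 1) d x))"

section \<open>Latent variable models\<close>

definition is_density :: "obs_space \<Rightarrow> (real ^ 'd::finite \<Rightarrow> real) \<Rightarrow> bool" where
  "is_density X f \<longleftrightarrow>
     (\<forall>x\<in>obs X. 0 < f x) \<and> (\<integral>\<^sup>+ x. ennreal (f x) \<partial>base X) = 1 \<and> (X = Euclid \<longrightarrow> C1 f)"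

record ('x, 'z) lvm =
  cond_dens :: "'x \<Rightarrow> 'z \<Rightarrow> real"
  prior :: "'z measure"

definition marginal :: "('x, 'z) lvm \<Rightarrow> 'x \<Rightarrow> real" where
  "marginal P x = (\<integral>z. cond_dens P x z \<partial>prior P)"

definition posterior :: "('x, 'z) lvm \<Rightarrow> 'x \<Rightarrow> 'z measure" where
  "posterior P x = density (prior P) (\<lambda>z. ennreal (cond_dens P x z / marginal P x))"

definition is_lvm :: "obs_space \<Rightarrow> (real ^ 'd::finite, 'z::polish_space) lvm \<Rightarrow> bool" where
  "is_lvm X P \<longleftrightarrow>
     prob_space (prior P) \<and> sets (prior P) = sets borel \<and>
     (\<lambda>(x, z). cond_dens P x z) \<in> borel_measurable (base X \<Otimes>\<^sub>M borel) \<and>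
     (\<forall>z. is_density X (\<lambda>x. cond_dens P x z)) \<and>
     (\<forall>x\<in>obs X. integrable (prior P) (cond_dens P x)) \<and>
     is_density X (marginal P)"

definition obs_law :: "obs_space \<Rightarrow> (real ^ 'd::finite, 'z) lvm \<Rightarrow> (real ^ 'd) measure" where
  "obs_law X P = density (base X) (\<lambda>x. ennreal (marginal P x))"

definition cond_score ::
    "obs_space \<Rightarrow> (real ^ 'd::finite, 'z) lvm \<Rightarrow> real ^ 'd \<Rightarrow> 'z \<Rightarrow> real ^ 'd" where
  "cond_score X P x z = inverse (cond_dens P x z) *\<^sub>R fwd X (\<lambda>y. cond_dens P y z) x"

definition score :: "obs_space \<Rightarrow> (real ^ 'd::finite, 'z) lvm \<Rightarrow> real ^ 'd \<Rightarrow> real ^ 'd" where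
  "score X P x = inverse (marginal P x) *\<^sub>R fwd X (marginal P) x"

section \<open>Kernel, RKHS and KSD\<close>

definition pd_kernel :: "'x set \<Rightarrow> ('x \<Rightarrow> 'x \<Rightarrow> real) \<Rightarrow> bool" where
  "pd_kernel S k \<longleftrightarrow> (\<forall>x\<in>S. \<forall>y\<in>S. k x y = k y x) \<and>
     (\<forall>A c. finite A \<and> A \<subseteq> S \<longrightarrow> 0 \<le> (\<Sum>x\<in>A. \<Sum>y\<in>A. c x * c y * k x y))"

text \<open>
  In \<open>smooth_kernel\<close>, \<open>\<lambda>a. grad (k a) b $ e\<close> is the partial derivative of \<open>k\<close> at \<open>(a, b)\<close> in the
  \<open>e\<close>-th coordinate of the second argument, as a function of the first argument.
\<close>

definition smooth_kernel :: "(real ^ 'd::finite \<Rightarrow> real ^ 'd \<Rightarrow> real) \<Rightarrow> bool" where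
  "smooth_kernel k \<longleftrightarrow>
     (\<forall>b. C1 (\<lambda>a. k a b)) \<and> (\<forall>a. C1 (k a)) \<and>
     (\<forall>e b. C1 (\<lambda>a. grad (k a) b $ e)) \<and>
     (\<forall>e. continuous_on UNIV (\<lambda>(a, b). grad (\<lambda>a'. grad (k a') b $ e) a))"

definition is_kernel :: "obs_space \<Rightarrow> (real ^ 'd::finite \<Rightarrow> real ^ 'd \<Rightarrow> real) \<Rightarrow> bool" where
  "is_kernel X k \<longleftrightarrow> pd_kernel (obs X) k \<and> (X = Euclid \<longrightarrow> smooth_kernel k)"

definition k1 ::
    "obs_space \<Rightarrow> (real ^ 'd::finite \<Rightarrow> real ^ 'd \<Rightarrow> real) \<Rightarrow> real ^ 'd \<Rightarrow> real ^ 'd \<Rightarrow> real ^ 'd" where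
  "k1 X k a b = bwd X (\<lambda>x. k x b) a"

definition k12 ::
    "obs_space \<Rightarrow> (real ^ 'd::finite \<Rightarrow> real ^ 'd \<Rightarrow> real) \<Rightarrow> real ^ 'd \<Rightarrow> real ^ 'd \<Rightarrow> real" where
  "k12 X k a b = (\<Sum>d\<in>UNIV. bwd X (\<lambda>x. bwd X (k x) b $ d) a $ d)"

text \<open>
  The RKHS of \<open>k\<close> is a Hilbert space \<open>'h\<close> whose elements are identified with functions on \<open>S\<close> by the
  linear injection \<open>fn\<close>, which contains each \<open>k(\<cdot>, x)\<close>, and in which these have the reproducing
  property.
\<close>

definition is_rkhs ::
    "'x set \<Rightarrow> ('x \<Rightarrow> 'x \<Rightarrow> real) \<Rightarrow> ('h::{real_inner, complete_space} \<Rightarrow> 'x \<Rightarrow> real) \<Rightarrow> bool" where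
  "is_rkhs S k fn \<longleftrightarrow>
     (\<forall>x\<in>S. linear (\<lambda>h. fn h x)) \<and>
     (\<forall>g h. (\<forall>x\<in>S. fn g x = fn h x) \<longrightarrow> g = h) \<and>
     (\<forall>x\<in>S. \<exists>kx. (\<forall>y\<in>S. fn kx y = k y x) \<and> (\<forall>h. h \<bullet> kx = fn h x))"

text \<open>
  The space \<open>\<F>\<close> is \<open>'h ^ 'd\<close>, whose library inner product is the sum of the coordinatewise ones;
  \<open>vfun\<close> is the vector field represented by an element of it.
\<close>

definition vfun :: "('h \<Rightarrow> 'x \<Rightarrow> real) \<Rightarrow> 'h ^ 'd::finite \<Rightarrow> 'x \<Rightarrow> real ^ 'd" where
  "vfun fn f x = (\<chi> d. fn (f $ d) x)"

definition stein ::
    "obs_space \<Rightarrow> (real ^ 'd::finite, 'z) lvm \<Rightarrow> (real ^ 'd \<Rightarrow> real ^ 'd) \<Rightarrow> real ^ 'd \<Rightarrow> real" where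
  "stein X P f x = score X P x \<bullet> f x + (\<Sum>d\<in>UNIV. bwd X (\<lambda>y. f y $ d) x $ d)"

definition KSD ::
    "obs_space \<Rightarrow> ('h::{real_inner, complete_space} \<Rightarrow> real ^ 'd::finite \<Rightarrow> real) \<Rightarrow>
     (real ^ 'd, 'z) lvm \<Rightarrow> (real ^ 'd) measure \<Rightarrow> ereal" where
  "KSD X fn P R =
     (SUP f\<in>{f :: 'h ^ 'd. norm f \<le> 1}.
        ereal \<bar>(\<integral>x. stein X P (vfun fn f) x \<partial>R) - (\<integral>y. stein X P (vfun fn f) y \<partial>obs_law X P)\<bar>)"

text \<open>
  The Bochner integral of a non-integrable function is \<open>0\<close>, so the existence of the expectations in
  the standing assumptions has to be stated separately.
\<close>

definition stein_regular ::
    "obs_space \<Rightarrow> ('h::{real_inner, complete_space} \<Rightarrow> real ^ 'd::finite \<Rightarrow> real) \<Rightarrow>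
     (real ^ 'd, 'z) lvm \<Rightarrow> (real ^ 'd) measure \<Rightarrow> bool" where
  "stein_regular X fn P R \<longleftrightarrow>
     (\<forall>f :: 'h ^ 'd. integrable (obs_law X P) (stein X P (vfun fn f)) \<and>
        (\<integral>y. stein X P (vfun fn f) y \<partial>obs_law X P) = 0) \<and>
     (\<forall>f :: 'h ^ 'd. integrable R (stein X P (vfun fn f))) \<and>
     KSD X fn P R < \<infinity>"

section \<open>Markov chain draws of the latent variables\<close>

record ('x, 'z) mcmc =
  init_law :: "'x \<Rightarrow> 'z measure"
  step :: "'x \<Rightarrow> 'z \<Rightarrow> 'z measure"

text \<open>For every \<open>x\<close>, the chain has the posterior given \<open>x\<close> as an invariant distribution.\<close>

definition targets_posterior ::
    "obs_space \<Rightarrow> (real ^ 'd::finite, 'z::polish_space) lvm \<Rightarrow> (real ^ 'd, 'z) mcmc \<Rightarrow> bool" where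
  "targets_posterior X P C \<longleftrightarrow>
     init_law C \<in> measurable (base X) (prob_algebra borel) \<and>
     (\<lambda>(x, z). step C x z) \<in> measurable (base X \<Otimes>\<^sub>M borel) (prob_algebra borel) \<and>
     (\<forall>x\<in>obs X. posterior P x \<bind> step C x = posterior P x)"

text \<open>The joint law of the states \<open>0, ..., n\<close> of a chain.\<close>

primrec chain_law ::
    "'z measure \<Rightarrow> ('z \<Rightarrow> 'z measure) \<Rightarrow> nat \<Rightarrow> (nat \<Rightarrow> 'z::topological_space) measure" where
  "chain_law \<nu> K 0 = distr \<nu> (\<Pi>\<^sub>M i\<in>{..0}. borel) (\<lambda>z. \<lambda>i\<in>{..0}. z)"
| "chain_law \<nu> K (Suc n) =
     chain_law \<nu> K n \<bind> (\<lambda>\<omega>. distr (K (\<omega> n)) (\<Pi>\<^sub>M i\<in>{..Suc n}. borel) (\<lambda>z. fun_upd \<omega> (Suc n) z))"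

abbreviation latent :: "nat \<Rightarrow> (nat \<Rightarrow> 'z::topological_space) measure" where
  "latent m \<equiv> \<Pi>\<^sub>M j\<in>{..<m}. borel"

text \<open>A draw of size \<open>m\<close> after \<open>t\<close> burn-in steps consists of the states \<open>t, ..., t + m - 1\<close>.\<close>

definition draw :: "(real ^ 'd::finite, 'z::polish_space) mcmc \<Rightarrow> nat \<Rightarrow> nat \<Rightarrow> real ^ 'd \<Rightarrow>
    (nat \<Rightarrow> 'z) measure" where
  "draw C m t x =
     distr (chain_law (init_law C x) (step C x) (t + m)) (latent m) (\<lambda>\<omega>. \<lambda>j\<in>{..<m}. \<omega> (t + j))"

definition joint_draw :: "obs_space \<Rightarrow> (real ^ 'd::finite) measure \<Rightarrow>
    (real ^ 'd, 'z::polish_space) mcmc \<Rightarrow> nat \<Rightarrow> nat \<Rightarrow> ((real ^ 'd) \<times> (nat \<Rightarrow> 'z)) measure" where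
  "joint_draw X R C m t =
     R \<bind> (\<lambda>x. distr (draw C m t x) (base X \<Otimes>\<^sub>M latent m) (\<lambda>z. (x, z)))"

section \<open>Difference kernel and test statistic\<close>

definition mean_score :: "obs_space \<Rightarrow> (real ^ 'd::finite, 'z) lvm \<Rightarrow> nat \<Rightarrow>
    real ^ 'd \<Rightarrow> (nat \<Rightarrow> 'z) \<Rightarrow> real ^ 'd" where
  "mean_score X P m x z = (1 / real m) *\<^sub>R (\<Sum>j<m. cond_score X P x (z j))"

definition Hbar :: "obs_space \<Rightarrow> (real ^ 'd::finite \<Rightarrow> real ^ 'd \<Rightarrow> real) \<Rightarrow> nat \<Rightarrow>
    (real ^ 'd, 'z) lvm \<Rightarrow> (real ^ 'd) \<times> (nat \<Rightarrow> 'z) \<Rightarrow> (real ^ 'd) \<times> (nat \<Rightarrow> 'z) \<Rightarrow> real" where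
  "Hbar X k m P = (\<lambda>(x, z) (x', z').
     (mean_score X P m x z \<bullet> mean_score X P m x' z') * k x x'
     + mean_score X P m x z \<bullet> k1 X k x' x
     + k1 X k x x' \<bullet> mean_score X P m x' z'
     + k12 X k x x')"

definition Hdiff :: "obs_space \<Rightarrow> (real ^ 'd::finite \<Rightarrow> real ^ 'd \<Rightarrow> real) \<Rightarrow> nat \<Rightarrow>
    (real ^ 'd, 'z) lvm \<Rightarrow> (real ^ 'd, 'w) lvm \<Rightarrow>
    (real ^ 'd) \<times> (nat \<Rightarrow> 'z) \<times> (nat \<Rightarrow> 'w) \<Rightarrow> (real ^ 'd) \<times> (nat \<Rightarrow> 'z) \<times> (nat \<Rightarrow> 'w) \<Rightarrow> real" where
  "Hdiff X k m P Q = (\<lambda>(x, z, w) (x', z', w').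
     Hbar X k m P (x, z) (x', z') - Hbar X k m Q (x, w) (x', w'))"

text \<open>The U-statistic of the points with indices in \<open>I\<close>.\<close>

definition ustat :: "('y \<Rightarrow> 'y \<Rightarrow> real) \<Rightarrow> (nat \<Rightarrow> 'y) \<Rightarrow> nat set \<Rightarrow> real" where
  "ustat h y I =
     (\<Sum>i\<in>I. \<Sum>j\<in>I - {i}. h (y i) (y j)) / (real (card I) * (real (card I) - 1))"

definition jackknife_var :: "('y \<Rightarrow> 'y \<Rightarrow> real) \<Rightarrow> (nat \<Rightarrow> 'y) \<Rightarrow> nat \<Rightarrow> real" where
  "jackknife_var h y n =
     (real n - 1) * (\<Sum>i\<in>{1..n}. (ustat h y ({1..n} - {i}) - ustat h y {1..n})\<^sup>2)"

text \<open>
  The event \<open>T > \<tau>\<close> for \<open>T = \<surd>n U / \<surd>v\<close>, in the form that is also meaningful when \<open>v = 0\<close>.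
\<close>

definition rejects :: "('y \<Rightarrow> 'y \<Rightarrow> real) \<Rightarrow> (nat \<Rightarrow> 'y) \<Rightarrow> nat \<Rightarrow> real \<Rightarrow> bool" where
  "rejects h y n \<tau> \<longleftrightarrow>
     ustat h y {1..n} > sqrt (jackknife_var h y n) / sqrt (real n) * \<tau>"

definition quantile :: "real measure \<Rightarrow> real \<Rightarrow> real" where
  "quantile N u = Inf {x. u \<le> cdf N x}"

text \<open>\<open>(E |f|\<^sup>r)\<^sup>1\<^sup>/\<^sup>r\<close> with value \<open>\<infinity>\<close> if \<open>E |f|\<^sup>r\<close> is infinite.\<close>

definition Lr_norm :: "'a measure \<Rightarrow> nat \<Rightarrow> ('a \<Rightarrow> real) \<Rightarrow> ennreal" where
  "Lr_norm M r f =
     (let I = \<integral>\<^sup>+ \<omega>. ennreal (\<bar>f \<omega>\<bar> ^ r) \<partial>M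
      in if I = \<infinity> then \<infinity> else ennreal (enn2real I powr (1 / real r)))"

end

theory Submission
  imports Defs "HOL-Real_Asymp.Real_Asymp"
begin

text \<open>
  For fixed \<open>t\<close> let \<open>g\<close> be the centred projection of the kernel \<open>h\<close> on one argument. The remainder of
  the Hajek projection \<open>(2/n) \<Sum> g(y\<^sub>i)\<close> of \<open>U - \<theta>\<close> is a degenerate U-statistic, so its second moment is
  \<open>O(1/n\<^sup>2)\<close>. The jackknife variance equals, up to a factor tending to \<open>1\<close>, four times the empirical
  variance of the row means \<open>(n - 1)\<^sup>-\<^sup>1 \<Sum>\<^sub>j h(y\<^sub>i, y\<^sub>j)\<close>, which are \<open>O(n\<^sup>-\<^sup>1\<^sup>/\<^sup>2)\<close> away from \<open>\<theta> + g(y\<^sub>i)\<close> in mean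
  square; hence it is consistent for \<open>\<sigma>\<^sup>2\<close>. All constants depend only on a bound for the fourth moment of
  \<open>h\<close>, so they are uniform in \<open>t\<close>, and Levy's continuity theorem gives the central limit theorem for the
  triangular array with \<open>t = t(n)\<close>. For \<open>\<mu> = 0\<close> Slutsky's theorem yields the limit \<open>\<alpha>\<close>; for \<open>\<mu> \<noteq> 0\<close> the
  difference of the two sides of the rejection inequality converges to \<open>\<mu>\<close> in probability.
\<close>

section \<open>Measurability and symmetry of the difference kernel\<close>

text \<open>The law of a row changes with \<open>n\<close>, so limit theorems for one fixed law do
  not apply: laws of large numbers are replaced by explicit second-moment bounds and Chebyshev's
  inequality, the central limit theorem by a quantitative estimate of characteristic functions. A
  fourth moment serves both, since it controls the third moment of \<open>g\<close> (Taylor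
  remainder) and the variance of the square of \<open>g\<close> (empirical variance). Assumption (a)
  concerns a limsup, so the bounds hold only for large \<open>t\<close>; this is why so many
  statements are eventual ones. The jackknife is handled through its root: up to scaling,
  \<open>sqrt (jackknife_var h y n)\<close> is a Euclidean norm over the index \<open>i\<close>, and
  the triangle inequality compares it with the norm of the values of \<open>g\<close> without
  expanding squares. Only for a limit variance that is positive does closeness of the squares give
  closeness of the roots at the same rate. The statistics need two facts about the concrete kernel.
  Joint measurability must be extracted from differentiability, and symmetry amounts, in the
  Euclidean case, to exchanging the order of two partial derivatives.\<close>

lemma GDERIV_unique:
  fixes f :: "'a::euclidean_space \<Rightarrow> real"
  assumes "GDERIV f x :> g" "GDERIV f x :> g'" shows "g = g'"
proof -
  have "(\<lambda>h. inner h g) = (\<lambda>h. inner h g')"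
    using assms unfolding gderiv_def by (rule has_derivative_unique)
  then have "inner (g - g') g = inner (g - g') g'" by metis
  then have "inner (g - g') (g - g') = 0" by (simp add: inner_diff_right)
  then show ?thesis by simp
qed

lemma C1_GDERIV: "C1 f \<Longrightarrow> GDERIV f x :> grad f x"
  unfolding C1_def grad_def by (metis (mono_tags, lifting) GDERIV_unique theI)

lemma C1_continuous: "C1 f \<Longrightarrow> continuous_on S f"
  using C1_GDERIV[of f] unfolding gderiv_def
  by (meson continuous_at_imp_continuous_on has_derivative_continuous)

text \<open>Restriction to a coordinate line makes one-variable calculus available: difference
  quotients for measurability, the mean value theorem for mixed derivatives.\<close>

lemma C1_DERIV_axis:
  fixes f :: "real ^ 'd::finite \<Rightarrow> real"
  assumes "C1 f"
  shows "((\<lambda>s. f (x + s *\<^sub>R axis i 1)) has_real_derivative grad f (x + s *\<^sub>R axis i 1) $ i) (at s)"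
proof -
  have *: "((\<lambda>s. x + s *\<^sub>R axis i 1) has_derivative (\<lambda>s. s *\<^sub>R axis i 1)) (at s)"
    by (auto intro!: derivative_eq_intros)
  have "((\<lambda>s. f (x + s *\<^sub>R axis i 1)) has_derivative
      (\<lambda>h. inner (h *\<^sub>R axis i 1) (grad f (x + s *\<^sub>R axis i 1)))) (at s)"
    using has_derivative_compose[OF * C1_GDERIV[OF assms, unfolded gderiv_def]] .
  then show ?thesis
    by (simp add: has_field_derivative_def inner_axis' mult.commute[of _ "grad _ _ $ _"])
qed

text \<open>A countable sequence of increments is chosen because pointwise limits of sequences
  preserve measurability.\<close>

lemma C1_difference_quotient:
  fixes f :: "real ^ 'd::finite \<Rightarrow> real"
  assumes "C1 f"
  shows "(\<lambda>n. (f (x + (1 / real (Suc n)) *\<^sub>R axis i 1) - f x) / (1 / real (Suc n))) \<longlonglongrightarrow> grad f x $ i"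
proof -
  have "((\<lambda>h. (f (x + h *\<^sub>R axis i 1) - f x) / h) \<longlongrightarrow> grad f x $ i) (at 0)"
    using C1_DERIV_axis[OF assms, of x i 0] by (simp add: DERIV_def)
  moreover have "filterlim (\<lambda>n. 1 / real (Suc n)) (at 0) sequentially"
    unfolding filterlim_at using LIMSEQ_Suc[OF lim_1_over_n] by auto
  ultimately show ?thesis by (rule filterlim_compose)
qed

lemma borel_measurable_vec_nth_iff:
  fixes f :: "'a \<Rightarrow> real ^ 'd::finite"
  shows "f \<in> borel_measurable M \<longleftrightarrow> (\<forall>i. (\<lambda>x. f x $ i) \<in> borel_measurable M)"
proof -
  have "(\<lambda>x. f x $ i) \<in> borel_measurable M" if "f \<in> borel_measurable M" for i
    using borel_measurable_inner[OF that borel_measurable_const[of "axis i 1"]]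
    by (simp add: inner_axis)
  moreover have "f \<in> borel_measurable M" if "\<forall>i. (\<lambda>x. f x $ i) \<in> borel_measurable M"
    unfolding borel_measurable_euclidean_space[of f] using that
    by (auto simp: Basis_vec_def inner_axis)
  ultimately show ?thesis by blast
qed

text \<open>Each component of the gradient is a pointwise limit of difference quotients, and these
  are jointly measurable because translating the first argument is.\<close>

lemma borel_measurable_grad:
  fixes f :: "real ^ 'd::finite \<Rightarrow> 'z \<Rightarrow> real"
  assumes f: "(\<lambda>(x, z). f x z) \<in> borel_measurable (borel \<Otimes>\<^sub>M Z)"
    and C1: "\<And>z. z \<in> space Z \<Longrightarrow> C1 (\<lambda>x. f x z)"
  shows "(\<lambda>(x, z). grad (\<lambda>x. f x z) x) \<in> borel_measurable (borel \<Otimes>\<^sub>M Z)"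
  unfolding borel_measurable_vec_nth_iff split_beta
proof (intro allI)
  fix i
  have shift: "(\<lambda>p. f (fst p + c) (snd p)) \<in> borel_measurable (borel \<Otimes>\<^sub>M Z)" for c
  proof -
    have "(\<lambda>p. (fst p + c, snd p)) \<in> borel \<Otimes>\<^sub>M Z \<rightarrow>\<^sub>M borel \<Otimes>\<^sub>M Z" by measurable
    from measurable_compose[OF this f] show ?thesis by simp
  qed
  show "(\<lambda>p. grad (\<lambda>x. f x (snd p)) (fst p) $ i) \<in> borel_measurable (borel \<Otimes>\<^sub>M Z)"
  proof (rule borel_measurable_LIMSEQ_real)
    show "(\<lambda>p. (f (fst p + (1 / real (Suc n)) *\<^sub>R axis i 1) (snd p) - f (fst p) (snd p)) / (1 / real (Suc n)))
        \<in> borel_measurable (borel \<Otimes>\<^sub>M Z)" for n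
      using shift[of 0] by (intro borel_measurable_divide borel_measurable_diff shift borel_measurable_const) simp
    show "(\<lambda>n. (f (fst p + (1 / real (Suc n)) *\<^sub>R axis i 1) (snd p) - f (fst p) (snd p)) / (1 / real (Suc n)))
        \<longlonglongrightarrow> grad (\<lambda>x. f x (snd p)) (fst p) $ i" if "p \<in> space (borel \<Otimes>\<^sub>M Z)" for p
      using that by (intro C1_difference_quotient[of "\<lambda>x. f x (snd p)"] C1) (auto simp: space_pair_measure)
  qed
qed

text \<open>Rounding the second argument to a lattice leaves countably many values, for each of
  which measurability in the first argument suffices; continuity removes the rounding in the limit.
  It serves for \<open>k\<close>, for which continuity in each argument separately is what is
  directly at hand.\<close>

lemma borel_measurable_Caratheodory:
  fixes f :: "'a \<Rightarrow> real ^ 'd::finite \<Rightarrow> real"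
  assumes meas: "\<And>y. (\<lambda>x. f x y) \<in> borel_measurable N"
    and cont: "\<And>x. x \<in> space N \<Longrightarrow> continuous_on UNIV (f x)"
  shows "(\<lambda>(x, y). f x y) \<in> borel_measurable (N \<Otimes>\<^sub>M borel)"
  unfolding split_beta
proof (rule borel_measurable_LIMSEQ_real)
  \<comment> \<open>\<open>q n\<close> rounds down to the lattice of mesh \<open>1 / Suc n\<close>.
    The result is coded as an integer vector, since \<open>measurable_compose_countable\<close>
    needs an index of countable type; \<open>r n\<close> decodes it.\<close>
  define q :: "nat \<Rightarrow> real ^ 'd \<Rightarrow> int ^ 'd" where "q n y = (\<chi> i. \<lfloor>real (Suc n) * y $ i\<rfloor>)" for n y
  define r :: "nat \<Rightarrow> int ^ 'd \<Rightarrow> real ^ 'd" where "r n c = (\<chi> i. of_int (c $ i) / real (Suc n))" for n c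
  have nth: "(\<lambda>y::real ^ 'd. y $ i) \<in> borel_measurable borel" for i
    using borel_measurable_vec_nth_iff[of "\<lambda>y. y" borel] by simp
  have q [measurable]: "q n \<in> measurable borel (count_space UNIV)" for n
    unfolding measurable_count_space_eq2_countable
  proof safe
    fix c
    have "q n -` {c} \<inter> space borel = {y \<in> space borel. \<forall>i. \<lfloor>real (Suc n) * y $ i\<rfloor> = c $ i}"
      by (auto simp: q_def vec_eq_iff)
    also have "\<dots> \<in> sets borel"
    proof (intro sets.sets_Collect_countable_All)
      fix i
      have "(\<lambda>y::real ^ 'd. \<lfloor>real (Suc n) * y $ i\<rfloor>) \<in> measurable borel (count_space UNIV)"
        by (rule measurable_compose[OF borel_measurable_times[OF borel_measurable_const nth] measurable_real_floor])
      then have "(\<lambda>y::real ^ 'd. \<lfloor>real (Suc n) * y $ i\<rfloor>) -` {c $ i} \<inter> space borel \<in> sets borel"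
        by (rule measurable_sets) simp
      then show "{y \<in> space borel. \<lfloor>real (Suc n) * (y :: real ^ 'd) $ i\<rfloor> = c $ i} \<in> sets borel"
        by (simp add: vimage_def Int_def conj_commute)
    qed
    finally show "q n -` {c} \<inter> space borel \<in> sets borel" .
  qed auto
  show "(\<lambda>p. f (fst p) (r n (q n (snd p)))) \<in> borel_measurable (N \<Otimes>\<^sub>M borel)" for n
    by (rule measurable_compose_countable[where g="\<lambda>p. q n (snd p)" and f="\<lambda>c p. f (fst p) (r n c)"])
       (auto intro: measurable_compose[OF measurable_fst meas])
  fix p :: "'a \<times> (real ^ 'd)" assume p: "p \<in> space (N \<Otimes>\<^sub>M borel)"
  have "(\<lambda>n. r n (q n (snd p)) $ i) \<longlonglongrightarrow> snd p $ i" for i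
  proof (rule LIMSEQ_I)
    fix e :: real assume "0 < e"
    then obtain n0 where n0: "1 / real (Suc n0) < e" using nat_approx_posE by blast
    have "norm (r n (q n (snd p)) $ i - snd p $ i) < e" if "n \<ge> n0" for n
    proof -
      have "\<bar>of_int \<lfloor>real (Suc n) * snd p $ i\<rfloor> - real (Suc n) * snd p $ i\<bar> \<le> 1" by linarith
      then have "\<bar>of_int \<lfloor>real (Suc n) * snd p $ i\<rfloor> - real (Suc n) * snd p $ i\<bar> / real (Suc n) \<le> 1 / real (Suc n)"
        by (rule divide_right_mono) simp
      also have "\<bar>of_int \<lfloor>real (Suc n) * snd p $ i\<rfloor> - real (Suc n) * snd p $ i\<bar> / real (Suc n)
          = \<bar>(of_int \<lfloor>real (Suc n) * snd p $ i\<rfloor> - real (Suc n) * snd p $ i) / real (Suc n)\<bar>"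
        by (simp add: abs_divide del: of_nat_Suc)
      also have "(of_int \<lfloor>real (Suc n) * snd p $ i\<rfloor> - real (Suc n) * snd p $ i) / real (Suc n)
          = of_int \<lfloor>real (Suc n) * snd p $ i\<rfloor> / real (Suc n) - snd p $ i"
        by (simp add: diff_divide_distrib del: of_nat_Suc)
      finally have "\<bar>of_int \<lfloor>real (Suc n) * snd p $ i\<rfloor> / real (Suc n) - snd p $ i\<bar> \<le> 1 / real (Suc n)" .
      also have "1 / real (Suc n) \<le> 1 / real (Suc n0)" using that by (simp add: field_simps)
      finally show ?thesis using n0 by (simp add: r_def q_def del: of_nat_Suc)
    qed
    then show "\<exists>n0. \<forall>n\<ge>n0. norm (r n (q n (snd p)) $ i - snd p $ i) < e" by blast
  qed
  then have "(\<lambda>n. r n (q n (snd p))) \<longlonglongrightarrow> snd p" by (rule vec_tendstoI)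
  then show "(\<lambda>n. f (fst p) (r n (q n (snd p)))) \<longlonglongrightarrow> f (fst p) (snd p)"
    using p by (intro continuous_on_tendsto_compose[OF cont]) (auto simp: space_pair_measure)
qed

section \<open>Measurability on the two observation spaces\<close>

lemma countable_obs_Grid: "countable (obs (Grid L) :: (real ^ 'd::finite) set)"
proof -
  have "obs (Grid L) \<subseteq> range (\<lambda>c::int ^ 'd. (\<chi> i. of_int (c $ i)))"
  proof
    fix x :: "real ^ 'd" assume "x \<in> obs (Grid L)"
    then have "x = (\<chi> i. of_int ((\<chi> j. \<lfloor>x $ j\<rfloor>) $ i))"
      by (auto simp: vec_eq_iff) (metis atLeastLessThan_iff floor_of_nat imageE of_int_of_nat_eq)
    then show "x \<in> range (\<lambda>c::int ^ 'd. (\<chi> i. of_int (c $ i)))" by blast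
  qed
  then show ?thesis by (rule countable_subset) simp
qed

text \<open>Measurability and symmetry are known only on the grid itself, so the differences must
  not leave it.\<close>

lemma cyc_shift_obs:
  assumes "x \<in> obs (Grid L)" "L > 1" shows "cyc_shift L s d x \<in> obs (Grid L)"
proof -
  have "real_of_int ((\<lfloor>x $ d\<rfloor> + s) mod int L) \<in> real ` {0..<L}"
    using assms(2) by (intro image_eqI[where x="nat ((\<lfloor>x $ d\<rfloor> + s) mod int L)"]) (auto simp: nat_less_iff)
  then show ?thesis using assms(1) by (auto simp: cyc_shift_def)
qed

lemma space_base: "space (base X) = obs X"
  by (cases X) auto

lemma cond_score_measurable:
  assumes P: "is_lvm X P" and X: "admissible X"
  shows "(\<lambda>(x, z). cond_score X P x z) \<in> borel_measurable (base X \<Otimes>\<^sub>M borel)"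
proof -
  have d: "(\<lambda>(x, z). cond_dens P x z) \<in> borel_measurable (base X \<Otimes>\<^sub>M borel)"
    and dd: "\<And>z. is_density X (\<lambda>x. cond_dens P x z)"
    using P by (auto simp: is_lvm_def)
  note d [measurable]
  show ?thesis
  proof (cases X)
    case Euclid
    \<comment> \<open>The base measure is \<open>lborel\<close>, and only its sigma-algebra matters
      here; this trades it for \<open>borel\<close>.\<close>
    have eq: "measurable (base X \<Otimes>\<^sub>M borel) borel = measurable (borel \<Otimes>\<^sub>M borel) borel"
      unfolding Euclid base.simps
      by (rule measurable_cong_sets[OF sets_pair_measure_cong[OF sets_lborel refl] refl])
    have d': "(\<lambda>(x, z). cond_dens P x z) \<in> borel_measurable (borel \<Otimes>\<^sub>M borel)"
      using d unfolding eq .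
    have "(\<lambda>(x, z). grad (\<lambda>x. cond_dens P x z) x) \<in> borel_measurable (borel \<Otimes>\<^sub>M borel)"
      using dd Euclid by (intro borel_measurable_grad d') (auto simp: is_density_def)
    with d' have "(\<lambda>(x, z). cond_score X P x z) \<in> borel_measurable (borel \<Otimes>\<^sub>M borel)"
      unfolding cond_score_def split_beta Euclid fwd.simps
      by (intro borel_measurable_scaleR borel_measurable_inverse)
    then show ?thesis
      unfolding eq .
  next
    case (Grid L)
    have cd: "cond_dens P x \<in> borel_measurable borel" if "x \<in> obs X" for x
      using measurable_compose[OF measurable_Pair1' d, of x] that by (simp add: space_base)
    show ?thesis
      unfolding Grid base.simps
    \<comment> \<open>With a countable discrete first factor, joint measurability reduces to
      sections at fixed \<open>x\<close>. Such a section involves the densities at \<open>x\<close>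
      and at finitely many shifts of \<open>x\<close>.\<close>
    proof (rule measurable_pair_measure_countable1[OF countable_obs_Grid])
      fix x :: "real ^ 'a" assume x: "x \<in> obs (Grid L)"
      have [measurable]: "cond_dens P x \<in> borel_measurable borel"
        "cond_dens P (cyc_shift L 1 e x) \<in> borel_measurable borel" for e
        using cd[of x] cd[OF cyc_shift_obs[OF x, folded Grid]] x X Grid by (simp_all del: obs.simps)
      show "(\<lambda>z. case (x, z) of (x, z) \<Rightarrow> cond_score (Grid L) P x z) \<in> borel_measurable borel"
        unfolding borel_measurable_vec_nth_iff cond_score_def by simp
    qed
  qed
qed

lemma mean_score_measurable:
  assumes P: "is_lvm X P" and X: "admissible X"
  shows "(\<lambda>(x, z). mean_score X P m x z) \<in> borel_measurable (base X \<Otimes>\<^sub>M latent m)"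
proof -
  have "(\<lambda>p. cond_score X P (fst p) (snd p j)) \<in> borel_measurable (base X \<Otimes>\<^sub>M latent m)" if "j < m" for j
    using that measurable_compose[OF _ cond_score_measurable[OF assms], of "\<lambda>p. (fst p, snd p j)" "base X \<Otimes>\<^sub>M latent m"]
    by (simp add: split_beta measurable_compose[OF measurable_snd measurable_component_singleton])
  then show ?thesis
    unfolding mean_score_def split_beta
    by (intro borel_measurable_scaleR borel_measurable_const borel_measurable_sum) auto
qed

text \<open>The product of two countable discrete spaces is discrete, so on the grid every function
  is measurable and only the Euclidean case carries a condition.\<close>

lemma measurable_base_base:
  fixes f :: "real ^ 'd::finite \<Rightarrow> real ^ 'd \<Rightarrow> 'b::topological_space"
  assumes "X = Euclid \<Longrightarrow> (\<lambda>(x, y). f x y) \<in> borel_measurable (borel \<Otimes>\<^sub>M borel)"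
  shows "(\<lambda>(x, y). f x y) \<in> borel_measurable (base X \<Otimes>\<^sub>M base X)"
proof (cases X)
  case Euclid
  then show ?thesis
    using assms measurable_cong_sets[OF sets_pair_measure_cong[OF sets_lborel sets_lborel] refl] by simp
next
  case (Grid L)
  show ?thesis unfolding Grid base.simps
    by (subst pair_measure_countable[OF countable_obs_Grid countable_obs_Grid]) simp
qed

text \<open>Each function has its own reason in the Euclidean case: \<open>k\<close> is separately
  continuous, \<open>k1\<close> is a gradient of a jointly measurable function, and
  \<open>k12\<close> is jointly continuous by the assumption on mixed derivatives.\<close>

lemma kernel_measurable:
  fixes k :: "real ^ 'd::finite \<Rightarrow> real ^ 'd \<Rightarrow> real"
  assumes k: "is_kernel X k"
  shows "(\<lambda>(x, y). k x y) \<in> borel_measurable (base X \<Otimes>\<^sub>M base X)" (is ?k)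
    and "(\<lambda>(x, y). k1 X k x y) \<in> borel_measurable (base X \<Otimes>\<^sub>M base X)" (is ?k1)
    and "(\<lambda>(x, y). k12 X k x y) \<in> borel_measurable (base X \<Otimes>\<^sub>M base X)" (is ?k12)
proof -
  have k': "(\<lambda>(x, y). k x y) \<in> borel_measurable (borel \<Otimes>\<^sub>M borel)" if "X = Euclid"
    using k that by (intro borel_measurable_Caratheodory borel_measurable_continuous_onI C1_continuous)
      (auto simp: is_kernel_def smooth_kernel_def)
  then show ?k by (rule measurable_base_base)
  show ?k1
    unfolding k1_def
  proof (rule measurable_base_base)
    assume X: "X = Euclid"
    show "(\<lambda>(x, y). bwd X (\<lambda>x. k x y) x) \<in> borel_measurable (borel \<Otimes>\<^sub>M borel)"
      unfolding X bwd.simps using k X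
      by (intro borel_measurable_grad k') (auto simp: is_kernel_def smooth_kernel_def)
  qed
  show ?k12
    unfolding k12_def
  proof (rule measurable_base_base)
    assume X: "X = Euclid"
    have "continuous_on UNIV (\<lambda>p. grad (\<lambda>a'. grad (k a') (snd p) $ d) (fst p))" for d
      using k X by (auto simp: is_kernel_def smooth_kernel_def split_beta)
    then have "continuous_on UNIV (\<lambda>p. \<Sum>d\<in>UNIV. grad (\<lambda>a'. grad (k a') (snd p) $ d) (fst p) $ d)"
      by (intro continuous_intros)
    then show "(\<lambda>(x, y). \<Sum>d\<in>UNIV. bwd X (\<lambda>x. bwd X (k x) y $ d) x $ d) \<in> borel_measurable (borel \<Otimes>\<^sub>M borel)"
      unfolding X bwd.simps borel_prod split_beta by (rule borel_measurable_continuous_onI)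
  qed
qed

lemma Hbar_measurable:
  assumes P: "is_lvm X P" and X: "admissible X" and k: "is_kernel X k"
  shows "(\<lambda>(p, p'). Hbar X k m P p p') \<in>
    borel_measurable ((base X \<Otimes>\<^sub>M latent m) \<Otimes>\<^sub>M (base X \<Otimes>\<^sub>M latent m))"
proof -
  let ?B = "(base X \<Otimes>\<^sub>M latent m) \<Otimes>\<^sub>M (base X \<Otimes>\<^sub>M latent m)"
  note ms = mean_score_measurable[OF P X, of m, unfolded split_beta]
  have [measurable]: "(\<lambda>p. mean_score X P m (fst (fst p)) (snd (fst p))) \<in> borel_measurable ?B"
    "(\<lambda>p. mean_score X P m (fst (snd p)) (snd (snd p))) \<in> borel_measurable ?B"
    by (rule measurable_compose[OF measurable_fst ms] measurable_compose[OF measurable_snd ms])+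
  have a: "(\<lambda>p. (fst (fst p), fst (snd p))) \<in> ?B \<rightarrow>\<^sub>M (base X \<Otimes>\<^sub>M base X)"
    and b: "(\<lambda>p. (fst (snd p), fst (fst p))) \<in> ?B \<rightarrow>\<^sub>M (base X \<Otimes>\<^sub>M base X)" by measurable
  have [measurable]: "(\<lambda>p. k (fst (fst p)) (fst (snd p))) \<in> borel_measurable ?B"
     "(\<lambda>p. k1 X k (fst (fst p)) (fst (snd p))) \<in> borel_measurable ?B"
     "(\<lambda>p. k1 X k (fst (snd p)) (fst (fst p))) \<in> borel_measurable ?B"
     "(\<lambda>p. k12 X k (fst (fst p)) (fst (snd p))) \<in> borel_measurable ?B"
    using kernel_measurable[OF k, unfolded split_beta, THEN measurable_compose[OF a]]
      kernel_measurable[OF k, unfolded split_beta, THEN measurable_compose[OF b]]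
    by simp_all
  show ?thesis
    unfolding Hbar_def split_beta by measurable
qed

lemma Hdiff_measurable:
  fixes m :: nat
  assumes P: "is_lvm X P" and Q: "is_lvm X Q" and X: "admissible X" and k: "is_kernel X k"
  defines "N \<equiv> base X \<Otimes>\<^sub>M (latent m \<Otimes>\<^sub>M latent m)"
  shows "(\<lambda>(p, p'). Hdiff X k m P Q p p') \<in> borel_measurable (N \<Otimes>\<^sub>M N)"
proof -
  let ?B = "(base X \<Otimes>\<^sub>M latent m) \<Otimes>\<^sub>M (base X \<Otimes>\<^sub>M latent m)"
  have a: "(\<lambda>p. ((fst (fst p), fst (snd (fst p))), (fst (snd p), fst (snd (snd p))))) \<in> N \<Otimes>\<^sub>M N \<rightarrow>\<^sub>M ?B"
    and b: "(\<lambda>p. ((fst (fst p), snd (snd (fst p))), (fst (snd p), snd (snd (snd p))))) \<in> N \<Otimes>\<^sub>M N \<rightarrow>\<^sub>M ?B"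
    unfolding N_def by measurable
  show ?thesis
    using measurable_compose[OF a Hbar_measurable[OF P X k, unfolded split_beta]]
      measurable_compose[OF b Hbar_measurable[OF Q X k, unfolded split_beta]]
    unfolding Hdiff_def split_beta by simp
qed

section \<open>Symmetry of the difference kernel\<close>

lemma is_kernel_sym: "is_kernel X k \<Longrightarrow> x \<in> obs X \<Longrightarrow> y \<in> obs X \<Longrightarrow> k x y = k y x"
  by (simp add: is_kernel_def pd_kernel_def)

text \<open>The mean value theorem is applied twice to the second difference, first in the second
  argument and then in the first, which is the order of differentiation provided by
  \<open>smooth_kernel\<close>.\<close>

lemma mixed_difference_mvt:
  fixes k :: "real ^ 'd::finite \<Rightarrow> real ^ 'd \<Rightarrow> real"
  assumes "smooth_kernel k" "s > 0"
  obtains \<xi> \<eta> where "0 < \<xi>" "\<xi> < s" "0 < \<eta>" "\<eta> < s"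
    "k (a + s *\<^sub>R axis d 1) (b + s *\<^sub>R axis d 1) - k (a + s *\<^sub>R axis d 1) b - k a (b + s *\<^sub>R axis d 1) + k a b
     = s * s * (grad (\<lambda>a'. grad (k a') (b + \<eta> *\<^sub>R axis d 1) $ d) (a + \<xi> *\<^sub>R axis d 1) $ d)"
proof -
  let ?e = "axis d 1 :: real ^ 'd"
  let ?\<phi> = "\<lambda>t. k (a + s *\<^sub>R ?e) (b + t *\<^sub>R ?e) - k a (b + t *\<^sub>R ?e)"
  have C: "C1 (k a)" "C1 (\<lambda>a. grad (k a) b $ e)" for a b e
    using assms(1) by (auto simp: smooth_kernel_def)
  have "\<exists>\<eta>. 0 < \<eta> \<and> \<eta> < s \<and> ?\<phi> s - ?\<phi> 0 =
      (s - 0) * (grad (k (a + s *\<^sub>R ?e)) (b + \<eta> *\<^sub>R ?e) $ d - grad (k a) (b + \<eta> *\<^sub>R ?e) $ d)"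
    by (intro MVT2 assms(2) DERIV_diff C1_DERIV_axis C)
  then obtain \<eta> where \<eta>: "0 < \<eta>" "\<eta> < s" "?\<phi> s - ?\<phi> 0 =
      s * (grad (k (a + s *\<^sub>R ?e)) (b + \<eta> *\<^sub>R ?e) $ d - grad (k a) (b + \<eta> *\<^sub>R ?e) $ d)" by auto
  let ?\<psi> = "\<lambda>a'. grad (k a') (b + \<eta> *\<^sub>R ?e) $ d"
  have "\<exists>\<xi>. 0 < \<xi> \<and> \<xi> < s \<and> ?\<psi> (a + s *\<^sub>R ?e) - ?\<psi> (a + 0 *\<^sub>R ?e) = (s - 0) * (grad ?\<psi> (a + \<xi> *\<^sub>R ?e) $ d)"
    by (intro MVT2 assms(2) C1_DERIV_axis C)
  then obtain \<xi> where "0 < \<xi>" "\<xi> < s" "?\<psi> (a + s *\<^sub>R ?e) - ?\<psi> a = s * (grad ?\<psi> (a + \<xi> *\<^sub>R ?e) $ d)" by auto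
  with \<eta> show ?thesis by (intro that[of \<xi> \<eta>]) (auto simp: algebra_simps)
qed

text \<open>The intermediate points shrink to \<open>(a, b)\<close>, where the mixed derivative is
  continuous. The gain is a description of that derivative by values of \<open>k\<close> alone, on
  which the symmetry of \<open>k\<close> can act.\<close>

lemma mixed_difference_quotient:
  fixes k :: "real ^ 'd::finite \<Rightarrow> real ^ 'd \<Rightarrow> real"
  assumes k: "smooth_kernel k"
  shows "(\<lambda>n. (k (a + (1 / real (Suc n)) *\<^sub>R axis d 1) (b + (1 / real (Suc n)) *\<^sub>R axis d 1)
      - k (a + (1 / real (Suc n)) *\<^sub>R axis d 1) b - k a (b + (1 / real (Suc n)) *\<^sub>R axis d 1) + k a b)
      / (1 / real (Suc n) * (1 / real (Suc n)))) \<longlonglongrightarrow> grad (\<lambda>a'. grad (k a') b $ d) a $ d"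
    (is "?q \<longlonglongrightarrow> ?F (a, b)")
proof -
  define F where "F = (\<lambda>p. grad (\<lambda>a'. grad (k a') (snd p) $ d) (fst p) $ d)"
  have "continuous_on UNIV (\<lambda>p. grad (\<lambda>a'. grad (k a') (snd p) $ d) (fst p))"
    using k by (auto simp: smooth_kernel_def split_beta)
  then have F: "continuous_on UNIV F" unfolding F_def by (intro continuous_intros)
  have "\<exists>\<xi> \<eta>. 0 < \<xi> \<and> \<xi> < 1 / real (Suc n) \<and> 0 < \<eta> \<and> \<eta> < 1 / real (Suc n) \<and>
      ?q n = F (a + \<xi> *\<^sub>R axis d 1, b + \<eta> *\<^sub>R axis d 1)" for n
  proof -
    define s where "s = 1 / real (Suc n)"
    have "s > 0" by (simp add: s_def)
    then obtain \<xi> \<eta> where "0 < \<xi>" "\<xi> < s" "0 < \<eta>" "\<eta> < s" and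
      "k (a + s *\<^sub>R axis d 1) (b + s *\<^sub>R axis d 1) - k (a + s *\<^sub>R axis d 1) b - k a (b + s *\<^sub>R axis d 1) + k a b
       = s * s * F (a + \<xi> *\<^sub>R axis d 1, b + \<eta> *\<^sub>R axis d 1)"
      unfolding F_def fst_conv snd_conv by (rule mixed_difference_mvt[OF k])
    with \<open>s > 0\<close> show ?thesis
      unfolding s_def[symmetric] by (intro exI[of _ \<xi>] exI[of _ \<eta>]) simp
  qed
  then obtain \<xi> \<eta> where *: "\<And>n. 0 < \<xi> n \<and> \<xi> n < 1 / real (Suc n) \<and> 0 < \<eta> n \<and> \<eta> n < 1 / real (Suc n) \<and>
      ?q n = F (a + \<xi> n *\<^sub>R axis d 1, b + \<eta> n *\<^sub>R axis d 1)" by metis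
  have "\<xi> \<longlonglongrightarrow> 0" "\<eta> \<longlonglongrightarrow> 0"
    using * by (auto intro!: tendsto_sandwich[OF _ _ tendsto_const LIMSEQ_Suc[OF lim_1_over_n]]
        eventuallyI less_imp_le simp del: of_nat_Suc)
  then have "(\<lambda>n. (a + \<xi> n *\<^sub>R axis d 1, b + \<eta> n *\<^sub>R axis d 1)) \<longlonglongrightarrow> (a + 0 *\<^sub>R axis d 1, b + 0 *\<^sub>R axis d 1)"
    by (intro tendsto_intros)
  then have "(\<lambda>n. F (a + \<xi> n *\<^sub>R axis d 1, b + \<eta> n *\<^sub>R axis d 1)) \<longlonglongrightarrow> F (a, b)"
    by (intro continuous_on_tendsto_compose[OF F]) auto
  then show ?thesis using * by (simp add: F_def)
qed

lemma k12_sym: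
  fixes k :: "real ^ 'd::finite \<Rightarrow> real ^ 'd \<Rightarrow> real"
  assumes X: "admissible X" and k: "is_kernel X k" and ab: "a \<in> obs X" "b \<in> obs X"
  shows "k12 X k a b = k12 X k b a"
proof (cases X)
  case Euclid
  then have s: "smooth_kernel k" and sym: "k x y = k y x" for x y
    using k is_kernel_sym[OF k] by (auto simp: is_kernel_def)
  have "grad (\<lambda>a'. grad (k a') b $ d) a $ d = grad (\<lambda>a'. grad (k a') a $ d) b $ d" for d
  \<comment> \<open>As in the proof of Schwarz's theorem, both sides are limits of one sequence:
    symmetry of \<open>k\<close> turns the second differences at \<open>(b, a)\<close> into those at
    \<open>(a, b)\<close>.\<close>
  proof (rule LIMSEQ_unique[OF mixed_difference_quotient[OF s]])
    show "(\<lambda>n. (k (a + (1 / real (Suc n)) *\<^sub>R axis d 1) (b + (1 / real (Suc n)) *\<^sub>R axis d 1)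
      - k (a + (1 / real (Suc n)) *\<^sub>R axis d 1) b - k a (b + (1 / real (Suc n)) *\<^sub>R axis d 1) + k a b)
      / (1 / real (Suc n) * (1 / real (Suc n)))) \<longlonglongrightarrow> grad (\<lambda>a'. grad (k a') a $ d) b $ d"
      using mixed_difference_quotient[OF s, of b d a]
      unfolding sym[of "b + _"] sym[of b] by (simp add: algebra_simps del: of_nat_Suc)
  qed
  then show ?thesis by (simp add: k12_def Euclid)
next
  case (Grid L)
  \<comment> \<open>On the grid \<open>k12\<close> is itself a second difference, so symmetry of
    \<open>k\<close> at the four shifted points is enough.\<close>
  have "cyc_shift L (-1) e x \<in> obs X" if "x \<in> obs X" for x :: "real ^ 'd" and e
    using cyc_shift_obs that X Grid by (simp del: obs.simps)
  then show ?thesis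
    using ab unfolding k12_def Grid bwd.simps vec_lambda_beta
    by (intro sum.cong refl) (simp add: is_kernel_sym[OF k] Grid)
qed

text \<open>Exchanging the arguments swaps the two cross terms of \<open>Hbar\<close> with each
  other, so only \<open>k\<close> and \<open>k12\<close> have to be symmetric. The points must lie
  in the space because nothing is known about \<open>k\<close> off the grid.\<close>

lemma Hdiff_sym:
  assumes X: "admissible X" and k: "is_kernel X k"
    and p: "p \<in> space (base X \<Otimes>\<^sub>M N)" "p' \<in> space (base X \<Otimes>\<^sub>M N)"
  shows "Hdiff X k m P Q p p' = Hdiff X k m P Q p' p"
proof -
  have "fst p \<in> obs X" "fst p' \<in> obs X" using p by (auto simp: space_pair_measure space_base)
  then show ?thesis
    using k12_sym[OF X k, of "fst p" "fst p'"] is_kernel_sym[OF k, of "fst p" "fst p'"]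
    unfolding Hdiff_def Hbar_def split_beta by (simp add: inner_commute)
qed

section \<open>Moments of U-statistics of i.i.d. samples\<close>

lemma le_one_plus_fourth: "x ^ 2 \<le> 1 + x ^ 4" "\<bar>x\<bar> ^ 3 \<le> 1 + x ^ 4" "\<bar>x\<bar> \<le> 1 + x ^ 4" for x :: real
proof -
  have *: "\<bar>x\<bar> ^ k \<le> 1 + \<bar>x\<bar> ^ 4" if "k \<le> 4" for k :: nat
  proof (cases "\<bar>x\<bar> \<le> 1")
    case True
    then have "\<bar>x\<bar> ^ k \<le> 1" by (simp add: power_le_one)
    then show ?thesis using zero_le_power[of "\<bar>x\<bar>" 4] by linarith
  next
    case False
    then have "\<bar>x\<bar> ^ k \<le> \<bar>x\<bar> ^ 4" using that by (intro power_increasing) auto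
    then show ?thesis by linarith
  qed
  show "x ^ 2 \<le> 1 + x ^ 4" "\<bar>x\<bar> ^ 3 \<le> 1 + x ^ 4" "\<bar>x\<bar> \<le> 1 + x ^ 4"
    using *[of 2] *[of 3] *[of 1] by simp_all
qed

lemma power4_diff_le: "(a - b) ^ 4 \<le> 8 * (a ^ 4 + b ^ 4)" for a b :: real
proof -
  have sq: "(x + y)\<^sup>2 \<le> 2 * (x\<^sup>2 + y\<^sup>2)" for x y :: real
    using sum_squares_bound[of x y] by (simp add: power2_sum)
  have "(a - b) ^ 4 = ((a + - b)\<^sup>2)\<^sup>2" by simp
  also have "\<dots> \<le> (2 * (a\<^sup>2 + b\<^sup>2))\<^sup>2" using sq[of a "- b"] by (intro power_mono) auto
  also have "\<dots> = 4 * (a\<^sup>2 + b\<^sup>2)\<^sup>2" by algebra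
  also have "\<dots> \<le> 4 * (2 * ((a\<^sup>2)\<^sup>2 + (b\<^sup>2)\<^sup>2))" by (intro mult_left_mono sq) auto
  finally show ?thesis by simp
qed

text \<open>Jensen's inequality for the fourth power: the tangent at the mean stays below the graph,
  the gap being a square times a sum of squares.\<close>

lemma (in prob_space) expectation_power4_le:
  fixes X :: "'a \<Rightarrow> real"
  assumes "integrable M X" "integrable M (\<lambda>x. X x ^ 4)"
  shows "expectation X ^ 4 \<le> expectation (\<lambda>x. X x ^ 4)"
proof -
  define a where "a = expectation X"
  have tangent: "4 * a ^ 3 * x - 3 * a ^ 4 \<le> x ^ 4" for x :: real
  proof -
    have "x ^ 4 - (4 * a ^ 3 * x - 3 * a ^ 4) = (x - a)\<^sup>2 * ((x + a)\<^sup>2 + 2 * a\<^sup>2)"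
      by algebra
    also have "\<dots> \<ge> 0" by simp
    finally show ?thesis by simp
  qed
  have "expectation (\<lambda>x. 4 * a ^ 3 * X x - 3 * a ^ 4) \<le> expectation (\<lambda>x. X x ^ 4)"
    using assms tangent by (intro integral_mono) auto
  moreover have "expectation (\<lambda>x. 4 * a ^ 3 * X x - 3 * a ^ 4) = 4 * a ^ 3 * a - 3 * a ^ 4"
    using assms by (simp add: a_def prob_space)
  ultimately show ?thesis by (simp add: a_def power4_eq_xxxx power3_eq_cube)
qed

lemma square_integrable_mult:
  fixes f g :: "'a \<Rightarrow> real"
  assumes [measurable]: "f \<in> borel_measurable M" "g \<in> borel_measurable M"
    and "integrable M (\<lambda>x. (f x)\<^sup>2)" "integrable M (\<lambda>x. (g x)\<^sup>2)"
  shows "integrable M (\<lambda>x. f x * g x)"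
proof (rule Bochner_Integration.integrable_bound)
  show "integrable M (\<lambda>x. (f x)\<^sup>2 + (g x)\<^sup>2)" using assms by simp
  have "\<bar>a * b\<bar> \<le> a\<^sup>2 + b\<^sup>2" for a b :: real
    using sum_squares_bound[of "\<bar>a\<bar>" "\<bar>b\<bar>"] mult_nonneg_nonneg[of "\<bar>a\<bar>" "\<bar>b\<bar>"]
    unfolding abs_mult power2_abs by linarith
  then show "AE x in M. norm (f x * g x) \<le> norm ((f x)\<^sup>2 + (g x)\<^sup>2)" by simp
qed simp

text \<open>Pythagoras' theorem; the second-moment computations for degenerate U-statistics, centred
  sums and row sums all reduce to it.\<close>

lemma orthogonal_sum:
  fixes f :: "'i \<Rightarrow> 'a \<Rightarrow> real"
  assumes A: "finite A" and [measurable]: "\<And>a. a \<in> A \<Longrightarrow> f a \<in> borel_measurable M"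
    and sq: "\<And>a. a \<in> A \<Longrightarrow> integrable M (\<lambda>x. (f a x)\<^sup>2)"
    and orth: "\<And>a b. a \<in> A \<Longrightarrow> b \<in> A \<Longrightarrow> a \<noteq> b \<Longrightarrow> (\<integral>x. f a x * f b x \<partial>M) = 0"
  shows "integrable M (\<lambda>x. (\<Sum>a\<in>A. f a x)\<^sup>2)"
    and "(\<integral>x. (\<Sum>a\<in>A. f a x)\<^sup>2 \<partial>M) = (\<Sum>a\<in>A. \<integral>x. (f a x)\<^sup>2 \<partial>M)"
proof -
  have eq: "(\<Sum>a\<in>A. f a x)\<^sup>2 = (\<Sum>a\<in>A. \<Sum>b\<in>A. f a x * f b x)" for x
    by (simp add: power2_eq_square sum_product)
  have int: "integrable M (\<lambda>x. f a x * f b x)" if "a \<in> A" "b \<in> A" for a b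
    using that by (intro square_integrable_mult sq) auto
  then show "integrable M (\<lambda>x. (\<Sum>a\<in>A. f a x)\<^sup>2)" unfolding eq by simp
  have "(\<integral>x. (\<Sum>a\<in>A. f a x)\<^sup>2 \<partial>M) = (\<Sum>a\<in>A. \<Sum>b\<in>A. \<integral>x. f a x * f b x \<partial>M)"
    unfolding eq using int by simp
  also have "\<dots> = (\<Sum>a\<in>A. \<Sum>b\<in>A. if a = b then \<integral>x. (f a x)\<^sup>2 \<partial>M else 0)"
    using orth by (intro sum.cong refl) (auto simp: power2_eq_square)
  also have "\<dots> = (\<Sum>a\<in>A. \<integral>x. (f a x)\<^sup>2 \<partial>M)" using A by simp
  finally show "(\<integral>x. (\<Sum>a\<in>A. f a x)\<^sup>2 \<partial>M) = (\<Sum>a\<in>A. \<integral>x. (f a x)\<^sup>2 \<partial>M)" .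
qed

text \<open>The summands for \<open>(i, j)\<close> and \<open>(j, i)\<close> coincide and are thus
  not orthogonal. Merging them into one summand per unordered pair is what makes
  \<open>orthogonal_sum\<close> applicable.\<close>

lemma sum_offdiag:
  fixes q :: "nat \<Rightarrow> nat \<Rightarrow> real"
  assumes "finite I" "\<And>i j. i \<in> I \<Longrightarrow> j \<in> I \<Longrightarrow> q i j = q j i"
  shows "(\<Sum>i\<in>I. \<Sum>j\<in>I - {i}. q i j) = 2 * (\<Sum>(i, j)\<in>{(i, j). i \<in> I \<and> j \<in> I \<and> i < j}. q i j)"
proof -
  let ?L = "{(i, j). i \<in> I \<and> j \<in> I \<and> i < j}" and ?U = "{(i, j). i \<in> I \<and> j \<in> I \<and> j < i}"
  have fin: "finite ?L" "finite ?U"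
    by (rule finite_subset[OF _ finite_cartesian_product[OF assms(1) assms(1)]]; auto)+
  have "(\<Sum>i\<in>I. \<Sum>j\<in>I - {i}. q i j) = (\<Sum>(i, j)\<in>(SIGMA i:I. I - {i}). q i j)"
    using assms(1) by (intro sum.Sigma) auto
  also have "(SIGMA i:I. I - {i}) = ?L \<union> ?U" by auto
  also have "(\<Sum>(i, j)\<in>?L \<union> ?U. q i j) = (\<Sum>(i, j)\<in>?L. q i j) + (\<Sum>(i, j)\<in>?U. q i j)"
    using fin by (intro sum.union_disjoint) auto
  also have "(\<Sum>(i, j)\<in>?U. q i j) = (\<Sum>(i, j)\<in>?L. q i j)"
    by (rule sum.reindex_bij_witness[of _ prod.swap prod.swap]) (auto simp: assms(2))
  finally show ?thesis by simp
qed

lemma card_offdiag: "2 * card {(i, j). i \<in> {1..n} \<and> j \<in> {1..n} \<and> i < j} = n * (n - 1)"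
proof -
  have "(\<Sum>i\<in>{1..n}. \<Sum>j\<in>{1..n} - {i}. 1 :: real) = 2 * real (card {(i, j). i \<in> {1..n} \<and> j \<in> {1..n} \<and> i < j})"
    by (subst sum_offdiag) (auto simp: split_beta)
  also have "(\<Sum>i\<in>{1..n}. \<Sum>j\<in>{1..n} - {i}. 1 :: real) = real (n * (n - 1))" by (cases n) (auto simp: algebra_simps)
  finally have "real (2 * card {(i, j). i \<in> {1..n} \<and> j \<in> {1..n} \<and> i < j}) = real (n * (n - 1))" by simp
  then show ?thesis by (simp only: of_nat_eq_iff)
qed

section \<open>Second moments for i.i.d. samples\<close>

definition kernel_mean :: "'y measure \<Rightarrow> ('y \<Rightarrow> 'y \<Rightarrow> real) \<Rightarrow> real" where
  "kernel_mean D h = (\<integral>p. h (fst p) (snd p) \<partial>(D \<Otimes>\<^sub>M D))"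

definition hajek :: "'y measure \<Rightarrow> ('y \<Rightarrow> 'y \<Rightarrow> real) \<Rightarrow> 'y \<Rightarrow> real" where
  "hajek D h x = (\<integral>y. h x y \<partial>D) - kernel_mean D h"

locale iid_sample = prob_space M for M :: "'a measure" +
  fixes N :: "'y measure" and Y :: "nat \<Rightarrow> 'a \<Rightarrow> 'y" and D :: "'y measure"
  assumes indep: "indep_vars (\<lambda>_. N) Y {1..}"
    and ident: "\<And>i. i \<ge> 1 \<Longrightarrow> distr M N (Y i) = D"
begin

lemma Y_meas [measurable]: "1 \<le> i \<Longrightarrow> Y i \<in> measurable M N"
  using indep by (simp add: indep_vars_def)

lemma sets_D [measurable_cong]: "sets D = sets N"
  using ident[of 1] sets_distr[of M N "Y 1"] by simp

lemma prob_D: "prob_space D"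
  using prob_space_distr[OF Y_meas, of 1] ident[of 1] by simp

sublocale D: prob_space D by (rule prob_D)

sublocale DD: pair_prob_space D D ..

lemma integrable_D_iff:
  fixes f :: "'y \<Rightarrow> real"
  assumes "i \<ge> 1" "f \<in> borel_measurable N"
  shows "integrable M (\<lambda>\<omega>. f (Y i \<omega>)) \<longleftrightarrow> integrable D f"
  using integrable_distr_eq[OF Y_meas assms(2)] ident assms(1) by simp

lemma integral_D:
  fixes f :: "'y \<Rightarrow> real"
  assumes "i \<ge> 1" "f \<in> borel_measurable N"
  shows "(\<integral>\<omega>. f (Y i \<omega>) \<partial>M) = (\<integral>x. f x \<partial>D)"
  using integral_distr[OF Y_meas assms(2)] ident assms(1) by simp

lemma indep_pair:
  assumes "i \<noteq> j" "i \<ge> 1" "j \<ge> 1"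
  shows "indep_var N (Y i) N (Y j)"
proof -
  have "indep_var N ((\<lambda>f. f i) \<circ> (\<lambda>\<omega>. restrict (\<lambda>i. Y i \<omega>) {i})) N ((\<lambda>f. f j) \<circ> (\<lambda>\<omega>. restrict (\<lambda>i. Y i \<omega>) {j}))"
    using assms by (intro indep_var_compose[OF indep_var_restrict[OF indep]]) auto
  then show ?thesis by (simp add: comp_def)
qed

lemma distr_pair:
  assumes "i \<noteq> j" "i \<ge> 1" "j \<ge> 1"
  shows "distr M (N \<Otimes>\<^sub>M N) (\<lambda>\<omega>. (Y i \<omega>, Y j \<omega>)) = D \<Otimes>\<^sub>M D"
  using indep_pair[OF assms] ident assms by (simp add: indep_var_distribution_eq)

lemma integrable_DD_iff:
  fixes f :: "'y \<Rightarrow> 'y \<Rightarrow> real"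
  assumes "i \<noteq> j" "i \<ge> 1" "j \<ge> 1" "(\<lambda>p. f (fst p) (snd p)) \<in> borel_measurable (N \<Otimes>\<^sub>M N)"
  shows "integrable M (\<lambda>\<omega>. f (Y i \<omega>) (Y j \<omega>)) \<longleftrightarrow> integrable (D \<Otimes>\<^sub>M D) (\<lambda>p. f (fst p) (snd p))"
proof -
  have "(\<lambda>\<omega>. (Y i \<omega>, Y j \<omega>)) \<in> M \<rightarrow>\<^sub>M N \<Otimes>\<^sub>M N" using assms by measurable
  from integrable_distr_eq[OF this assms(4)] show ?thesis by (simp add: distr_pair[OF assms(1-3)])
qed

lemma integral_DD:
  fixes f :: "'y \<Rightarrow> 'y \<Rightarrow> real"
  assumes "i \<noteq> j" "i \<ge> 1" "j \<ge> 1" "(\<lambda>p. f (fst p) (snd p)) \<in> borel_measurable (N \<Otimes>\<^sub>M N)"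
  shows "(\<integral>\<omega>. f (Y i \<omega>) (Y j \<omega>) \<partial>M) = (\<integral>p. f (fst p) (snd p) \<partial>(D \<Otimes>\<^sub>M D))"
proof -
  have "(\<lambda>\<omega>. (Y i \<omega>, Y j \<omega>)) \<in> M \<rightarrow>\<^sub>M N \<Otimes>\<^sub>M N" using assms by measurable
  from integral_distr[OF this assms(4)] show ?thesis by (simp add: distr_pair[OF assms(1-3)])
qed

lemma measurable_pair_Y:
  fixes f :: "'y \<Rightarrow> 'y \<Rightarrow> real"
  assumes "(\<lambda>p. f (fst p) (snd p)) \<in> borel_measurable (N \<Otimes>\<^sub>M N)" "i \<ge> 1" "j \<ge> 1"
  shows "(\<lambda>\<omega>. f (Y i \<omega>) (Y j \<omega>)) \<in> borel_measurable M"
  using measurable_compose[OF measurable_Pair[OF Y_meas Y_meas] assms(1), of i j] assms by simp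

text \<open>A degenerate kernel averages to zero over an index that occurs nowhere else.\<close>

lemma degenerate_orthogonal:
  fixes p q :: "'y \<Rightarrow> 'y \<Rightarrow> real"
  assumes p: "(\<lambda>p'. p (fst p') (snd p')) \<in> borel_measurable (N \<Otimes>\<^sub>M N)"
    and q: "(\<lambda>p'. q (fst p') (snd p')) \<in> borel_measurable (N \<Otimes>\<^sub>M N)"
    and p2: "integrable (D \<Otimes>\<^sub>M D) (\<lambda>p'. (p (fst p') (snd p'))\<^sup>2)"
    and q2: "integrable (D \<Otimes>\<^sub>M D) (\<lambda>p'. (q (fst p') (snd p'))\<^sup>2)"
    and deg: "\<And>x. x \<in> space N \<Longrightarrow> (\<integral>y. q x y \<partial>D) = 0"
    and ij: "i \<noteq> j" "i \<ge> 1" "j \<ge> 1" and kl: "k \<ge> 1" "l \<ge> 1" "l \<notin> {i, j, k}"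
  shows "(\<integral>\<omega>. p (Y i \<omega>) (Y j \<omega>) * q (Y k \<omega>) (Y l \<omega>) \<partial>M) = 0"
proof -
  \<comment> \<open>The indices other than \<open>l\<close> form one block, independent of
    \<open>Y l\<close>. Taking them as a set covers the cases where \<open>k\<close> equals
    \<open>i\<close> or \<open>j\<close>.\<close>
  let ?A = "{i, j, k}"
  let ?P = "PiM ?A (\<lambda>_. N)"
  let ?X = "\<lambda>\<omega>. restrict (\<lambda>i. Y i \<omega>) ?A"
  have X [measurable]: "?X \<in> M \<rightarrow>\<^sub>M ?P" using ij kl by (intro measurable_restrict) auto
  let ?Q = "PiM {l} (\<lambda>_. N)"
  let ?V = "\<lambda>\<omega>. restrict (\<lambda>i. Y i \<omega>) {l}"
  have V [measurable]: "?V \<in> M \<rightarrow>\<^sub>M ?Q" using kl by (intro measurable_restrict) auto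
  have "indep_var ?P ?X ?Q ?V"
    using ij kl by (intro indep_var_restrict[OF indep]) auto
  then have law: "distr M (?P \<Otimes>\<^sub>M ?Q) (\<lambda>\<omega>. (?X \<omega>, ?V \<omega>)) = distr M ?P ?X \<Otimes>\<^sub>M distr M ?Q ?V"
    by (simp add: indep_var_distribution_eq)
  interpret X: prob_space "distr M ?P ?X" by (rule prob_space_distr) fact
  interpret V: prob_space "distr M ?Q ?V" by (rule prob_space_distr) fact
  interpret XV: pair_prob_space "distr M ?P ?X" "distr M ?Q ?V" ..
  let ?F = "\<lambda>(u, v). p (u i) (u j) * q (u k) (v l)"
  have c: "(\<lambda>r. fst r s) \<in> ?P \<Otimes>\<^sub>M ?Q \<rightarrow>\<^sub>M N" if "s \<in> ?A" for s
    using measurable_compose[OF measurable_fst measurable_component_singleton[OF that]] .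
  have cl: "(\<lambda>v. v l) \<in> ?Q \<rightarrow>\<^sub>M N" by (rule measurable_component_singleton) simp
  have F: "?F \<in> borel_measurable (?P \<Otimes>\<^sub>M ?Q)"
    unfolding split_beta
    using measurable_compose[OF measurable_Pair[OF c c] p, of i j]
      measurable_compose[OF measurable_Pair[OF c measurable_compose[OF measurable_snd cl]] q, of k] by simp
  have XY: "(\<lambda>\<omega>. (?X \<omega>, ?V \<omega>)) \<in> M \<rightarrow>\<^sub>M ?P \<Otimes>\<^sub>M ?Q" by (rule measurable_Pair[OF X V])
  have kl': "k \<noteq> l" using kl by auto
  \<comment> \<open>Square integrability of both factors makes the product integrable, as Fubini's
    theorem requires.\<close>
  have pq: "integrable M (\<lambda>\<omega>. p (Y i \<omega>) (Y j \<omega>) * q (Y k \<omega>) (Y l \<omega>))"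
    using integrable_DD_iff[OF ij, of "\<lambda>x y. (p x y)\<^sup>2"] integrable_DD_iff[OF kl' kl(1,2), of "\<lambda>x y. (q x y)\<^sup>2"]
    by (intro square_integrable_mult measurable_pair_Y p q ij kl) (auto simp: p2 q2 borel_measurable_power[OF p] borel_measurable_power[OF q])
  have "integrable (distr M (?P \<Otimes>\<^sub>M ?Q) (\<lambda>\<omega>. (?X \<omega>, ?V \<omega>))) ?F"
    using pq by (subst integrable_distr_eq[OF XY F]) simp
  then have int: "integrable (distr M ?P ?X \<Otimes>\<^sub>M distr M ?Q ?V) ?F" unfolding law .
  have "(\<integral>\<omega>. p (Y i \<omega>) (Y j \<omega>) * q (Y k \<omega>) (Y l \<omega>) \<partial>M) = (\<integral>r. ?F r \<partial>(distr M (?P \<Otimes>\<^sub>M ?Q) (\<lambda>\<omega>. (?X \<omega>, ?V \<omega>))))"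
    by (subst integral_distr[OF XY F]) simp
  \<comment> \<open>The variable of \<open>Y l\<close> is integrated first, where degeneracy of
    \<open>q\<close> annihilates the inner integral.\<close>
  also have "\<dots> = (\<integral>u. (\<integral>v. ?F (u, v) \<partial>distr M ?Q ?V) \<partial>distr M ?P ?X)"
    unfolding law using XV.integral_fst[OF int] by simp
  also have "\<dots> = (\<integral>u. 0 \<partial>distr M ?P ?X)"
  proof (rule Bochner_Integration.integral_cong[OF refl])
    fix u assume "u \<in> space (distr M ?P ?X)"
    then have u: "u k \<in> space N" by (auto simp: space_PiM)
    then have qu: "q (u k) \<in> borel_measurable N"
      using measurable_compose[OF measurable_Pair1' q, of "u k"] by simp
    have "(\<integral>v. q (u k) (v l) \<partial>distr M ?Q ?V) = (\<integral>\<omega>. q (u k) (Y l \<omega>) \<partial>M)"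
      by (subst integral_distr[OF V measurable_compose[OF cl qu]]) simp
    also have "\<dots> = 0" using integral_D[OF kl(2) qu] deg[OF u] by simp
    finally show "(\<integral>v. ?F (u, v) \<partial>distr M ?Q ?V) = 0" by simp
  qed
  finally show ?thesis by simp
qed

text \<open>Two distinct increasing pairs always leave an index that occurs only once; symmetry of
  \<open>q\<close> and commutativity of the product bring it into the last position.\<close>

lemma degenerate_orthogonal_pairs:
  fixes q :: "'y \<Rightarrow> 'y \<Rightarrow> real"
  assumes q: "(\<lambda>p'. q (fst p') (snd p')) \<in> borel_measurable (N \<Otimes>\<^sub>M N)"
    and q2: "integrable (D \<Otimes>\<^sub>M D) (\<lambda>p'. (q (fst p') (snd p'))\<^sup>2)"
    and deg: "\<And>x. x \<in> space N \<Longrightarrow> (\<integral>y. q x y \<partial>D) = 0"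
    and sym: "\<And>x y. x \<in> space N \<Longrightarrow> y \<in> space N \<Longrightarrow> q x y = q y x"
    and ij: "1 \<le> i" "i < j" and kl: "1 \<le> k" "k < l" and ne: "(i, j) \<noteq> (k, l)"
  shows "(\<integral>\<omega>. q (Y i \<omega>) (Y j \<omega>) * q (Y k \<omega>) (Y l \<omega>) \<partial>M) = 0"
proof -
  note orth = degenerate_orthogonal[OF q q q2 q2 deg]
  have swap: "(\<integral>\<omega>. q (Y i \<omega>) (Y j \<omega>) * q (Y k \<omega>) (Y l \<omega>) \<partial>M)
     = (\<integral>\<omega>. q (Y k \<omega>) (Y l \<omega>) * q (Y j \<omega>) (Y i \<omega>) \<partial>M)"
    using ij kl by (intro Bochner_Integration.integral_cong refl) (simp add: sym measurable_space[OF Y_meas])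
  show ?thesis
  proof (cases "l \<in> {i, j}")
    case False
    then show ?thesis using ij kl by (intro orth) auto
  next
    case True
    show ?thesis
    proof (cases "l = j")
      case True
      \<comment> \<open>The pairs share their larger index, so their smaller ones differ and
        \<open>i\<close> is the lone index.\<close>
      then have "i \<notin> {k, l, j}" using ij ne by auto
      then show ?thesis unfolding swap using ij kl by (intro orth) auto
    next
      case False
      \<comment> \<open>Here \<open>l = i\<close>, hence \<open>k < i < j\<close> and
        \<open>j\<close> occurs only once.\<close>
      with True ij kl have "j \<notin> {k, l, i}" by auto
      then have "(\<integral>\<omega>. q (Y k \<omega>) (Y l \<omega>) * q (Y i \<omega>) (Y j \<omega>) \<partial>M) = 0"
        using ij kl by (intro orth) auto
      then show ?thesis by (simp add: mult.commute)
    qed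
  qed
qed

text \<open>The sum is twice the one over unordered pairs, which are orthogonal: the factor is 4
  times \<open>n * (n - 1) / 2\<close>. After normalisation this gives the order
  \<open>1 / n ^ 2\<close> of a degenerate U-statistic.\<close>

lemma degenerate_ustat_moment:
  fixes q :: "'y \<Rightarrow> 'y \<Rightarrow> real" and n :: nat
  assumes q: "(\<lambda>p'. q (fst p') (snd p')) \<in> borel_measurable (N \<Otimes>\<^sub>M N)"
    and q2: "integrable (D \<Otimes>\<^sub>M D) (\<lambda>p'. (q (fst p') (snd p'))\<^sup>2)"
    and deg: "\<And>x. x \<in> space N \<Longrightarrow> (\<integral>y. q x y \<partial>D) = 0"
    and sym: "\<And>x y. x \<in> space N \<Longrightarrow> y \<in> space N \<Longrightarrow> q x y = q y x"
  defines "S \<equiv> \<lambda>\<omega>. \<Sum>i\<in>{1..n}. \<Sum>j\<in>{1..n} - {i}. q (Y i \<omega>) (Y j \<omega>)"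
  shows "integrable M (\<lambda>\<omega>. (S \<omega>)\<^sup>2)"
    and "(\<integral>\<omega>. (S \<omega>)\<^sup>2 \<partial>M) = 2 * real (n * (n - 1)) * (\<integral>p'. (q (fst p') (snd p'))\<^sup>2 \<partial>(D \<Otimes>\<^sub>M D))"
proof -
  let ?I = "{(i, j). i \<in> {1..n} \<and> j \<in> {1..n} \<and> i < j}"
  let ?f = "\<lambda>a \<omega>. q (Y (fst a) \<omega>) (Y (snd a) \<omega>)"
  have fin: "finite ?I" by (rule finite_subset[of _ "{1..n} \<times> {1..n}"]) auto
  have S: "(S \<omega>)\<^sup>2 = 4 * (\<Sum>a\<in>?I. ?f a \<omega>)\<^sup>2" if "\<omega> \<in> space M" for \<omega>
    unfolding S_def using that
    by (subst sum_offdiag) (auto simp: sym measurable_space[OF Y_meas] split_beta power_mult_distrib)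
  have sq2: "(\<lambda>p'. (q (fst p') (snd p'))\<^sup>2) \<in> borel_measurable (N \<Otimes>\<^sub>M N)" using q by simp
  have m: "?f a \<in> borel_measurable M" if "a \<in> ?I" for a
    using that by (intro measurable_pair_Y q) auto
  have i: "integrable M (\<lambda>\<omega>. (?f a \<omega>)\<^sup>2)" 
     and e: "(\<integral>\<omega>. (?f a \<omega>)\<^sup>2 \<partial>M) = (\<integral>p'. (q (fst p') (snd p'))\<^sup>2 \<partial>(D \<Otimes>\<^sub>M D))" if "a \<in> ?I" for a
    using that integrable_DD_iff[of "fst a" "snd a" "\<lambda>x y. (q x y)\<^sup>2"] integral_DD[of "fst a" "snd a" "\<lambda>x y. (q x y)\<^sup>2"] q2 sq2
    by auto
  have o: "(\<integral>\<omega>. ?f a \<omega> * ?f b \<omega> \<partial>M) = 0" if "a \<in> ?I" "b \<in> ?I" "a \<noteq> b" for a b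
    using that by (intro degenerate_orthogonal_pairs q q2 deg sym) (auto simp: prod_eq_iff)
  note os = orthogonal_sum[OF fin m i o]
  have "integrable M (\<lambda>\<omega>. 4 * (\<Sum>a\<in>?I. ?f a \<omega>)\<^sup>2)" using os(1) by simp
  then show "integrable M (\<lambda>\<omega>. (S \<omega>)\<^sup>2)" using S by (simp cong: Bochner_Integration.integrable_cong)
  have "(\<integral>\<omega>. (S \<omega>)\<^sup>2 \<partial>M) = 4 * (\<integral>\<omega>. (\<Sum>a\<in>?I. ?f a \<omega>)\<^sup>2 \<partial>M)"
    using S by (simp cong: Bochner_Integration.integral_cong)
  also have "\<dots> = 4 * (\<Sum>a\<in>?I. \<integral>\<omega>. (?f a \<omega>)\<^sup>2 \<partial>M)" using os(2) by simp
  also have "\<dots> = 4 * (real (card ?I) * (\<integral>p'. (q (fst p') (snd p'))\<^sup>2 \<partial>(D \<Otimes>\<^sub>M D)))"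
    using e by simp
  also have "\<dots> = 2 * real (2 * card ?I) * (\<integral>p'. (q (fst p') (snd p'))\<^sup>2 \<partial>(D \<Otimes>\<^sub>M D))" by simp
  finally show "(\<integral>\<omega>. (S \<omega>)\<^sup>2 \<partial>M) = 2 * real (n * (n - 1)) * (\<integral>p'. (q (fst p') (snd p'))\<^sup>2 \<partial>(D \<Otimes>\<^sub>M D))"
    unfolding card_offdiag .
qed

lemma centered_sum_moment:
  fixes f :: "'y \<Rightarrow> real"
  assumes f: "f \<in> borel_measurable N" and f2: "integrable D (\<lambda>x. (f x)\<^sup>2)" and z: "(\<integral>x. f x \<partial>D) = 0"
  shows "integrable M (\<lambda>\<omega>. (\<Sum>i\<in>{1..n}. f (Y i \<omega>))\<^sup>2)"
    and "(\<integral>\<omega>. (\<Sum>i\<in>{1..n}. f (Y i \<omega>))\<^sup>2 \<partial>M) = real n * (\<integral>x. (f x)\<^sup>2 \<partial>D)"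
proof -
  note f [measurable]
  have f1: "integrable D f"
    by (rule D.square_integrable_imp_integrable[OF _ f2]) simp
  have m: "(\<lambda>\<omega>. f (Y i \<omega>)) \<in> borel_measurable M" if "i \<in> {1..n}" for i
    using that by (intro measurable_compose[OF Y_meas f]) auto
  have i: "integrable M (\<lambda>\<omega>. (f (Y i \<omega>))\<^sup>2)" if "i \<in> {1..n}" for i
    using that f2 integrable_D_iff[of i "\<lambda>x. (f x)\<^sup>2"] by auto
  have o: "(\<integral>\<omega>. f (Y i \<omega>) * f (Y j \<omega>) \<partial>M) = 0" if "i \<in> {1..n}" "j \<in> {1..n}" "i \<noteq> j" for i j
  proof -
    have "indep_var borel (f \<circ> Y i) borel (f \<circ> Y j)"
      using that by (intro indep_var_compose[OF indep_pair]) auto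
    then have "(\<integral>\<omega>. f (Y i \<omega>) * f (Y j \<omega>) \<partial>M) = (\<integral>\<omega>. f (Y i \<omega>) \<partial>M) * (\<integral>\<omega>. f (Y j \<omega>) \<partial>M)"
      using that f1 by (intro indep_var_lebesgue_integral) (auto simp: comp_def integrable_D_iff)
    then show ?thesis using that z by (simp add: integral_D)
  qed
  note os = orthogonal_sum[of "{1..n}" "\<lambda>i \<omega>. f (Y i \<omega>)" M, OF _ m i o]
  show "integrable M (\<lambda>\<omega>. (\<Sum>i\<in>{1..n}. f (Y i \<omega>))\<^sup>2)" using os(1) by simp
  have "(\<integral>\<omega>. (\<Sum>i\<in>{1..n}. f (Y i \<omega>))\<^sup>2 \<partial>M) = (\<Sum>i\<in>{1..n}. \<integral>\<omega>. (f (Y i \<omega>))\<^sup>2 \<partial>M)"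
    using os(2) by simp
  also have "\<dots> = (\<Sum>i\<in>{1..n}. \<integral>x. (f x)\<^sup>2 \<partial>D)"
    using integral_D[of _ "\<lambda>x. (f x)\<^sup>2"] by (intro sum.cong) auto
  finally show "(\<integral>\<omega>. (\<Sum>i\<in>{1..n}. f (Y i \<omega>))\<^sup>2 \<partial>M) = real n * (\<integral>x. (f x)\<^sup>2 \<partial>D)" by simp
qed

text \<open>The summands share \<open>Y i\<close>, yet for \<open>j \<noteq> l\<close> the point
  \<open>Y l\<close> occurs only in the second factor, so degeneracy in the second argument makes
  them orthogonal.\<close>

lemma row_sum_moment:
  fixes q :: "'y \<Rightarrow> 'y \<Rightarrow> real"
  assumes q: "(\<lambda>p'. q (fst p') (snd p')) \<in> borel_measurable (N \<Otimes>\<^sub>M N)"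
    and q2: "integrable (D \<Otimes>\<^sub>M D) (\<lambda>p'. (q (fst p') (snd p'))\<^sup>2)"
    and deg: "\<And>x. x \<in> space N \<Longrightarrow> (\<integral>y. q x y \<partial>D) = 0"
    and i: "i \<in> {1..n}"
  shows "integrable M (\<lambda>\<omega>. (\<Sum>j\<in>{1..n} - {i}. q (Y i \<omega>) (Y j \<omega>))\<^sup>2)"
    and "(\<integral>\<omega>. (\<Sum>j\<in>{1..n} - {i}. q (Y i \<omega>) (Y j \<omega>))\<^sup>2 \<partial>M)
      = real (n - 1) * (\<integral>p'. (q (fst p') (snd p'))\<^sup>2 \<partial>(D \<Otimes>\<^sub>M D))"
proof -
  let ?J = "{1..n} - {i}"
  have sq2: "(\<lambda>p'. (q (fst p') (snd p'))\<^sup>2) \<in> borel_measurable (N \<Otimes>\<^sub>M N)" using q by simp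
  have m: "(\<lambda>\<omega>. q (Y i \<omega>) (Y j \<omega>)) \<in> borel_measurable M" if "j \<in> ?J" for j
    using that i by (intro measurable_pair_Y q) auto
  have int: "integrable M (\<lambda>\<omega>. (q (Y i \<omega>) (Y j \<omega>))\<^sup>2)"
     and e: "(\<integral>\<omega>. (q (Y i \<omega>) (Y j \<omega>))\<^sup>2 \<partial>M) = (\<integral>p'. (q (fst p') (snd p'))\<^sup>2 \<partial>(D \<Otimes>\<^sub>M D))" if "j \<in> ?J" for j
    using that i integrable_DD_iff[of i j "\<lambda>x y. (q x y)\<^sup>2"] integral_DD[of i j "\<lambda>x y. (q x y)\<^sup>2"] q2 sq2
    by auto
  have o: "(\<integral>\<omega>. q (Y i \<omega>) (Y j \<omega>) * q (Y i \<omega>) (Y l \<omega>) \<partial>M) = 0" if "j \<in> ?J" "l \<in> ?J" "j \<noteq> l" for j l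
    using that i by (intro degenerate_orthogonal q q2 deg) auto
  note os = orthogonal_sum[of ?J "\<lambda>j \<omega>. q (Y i \<omega>) (Y j \<omega>)" M, OF _ m int o]
  show "integrable M (\<lambda>\<omega>. (\<Sum>j\<in>{1..n} - {i}. q (Y i \<omega>) (Y j \<omega>))\<^sup>2)" using os(1) by simp
  have "(\<integral>\<omega>. (\<Sum>j\<in>?J. q (Y i \<omega>) (Y j \<omega>))\<^sup>2 \<partial>M) = (\<Sum>j\<in>?J. \<integral>p'. (q (fst p') (snd p'))\<^sup>2 \<partial>(D \<Otimes>\<^sub>M D))"
    using os(2) e by simp
  then show "(\<integral>\<omega>. (\<Sum>j\<in>?J. q (Y i \<omega>) (Y j \<omega>))\<^sup>2 \<partial>M)
      = real (n - 1) * (\<integral>p'. (q (fst p') (snd p'))\<^sup>2 \<partial>(D \<Otimes>\<^sub>M D))"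
    using i by simp
qed

end

section \<open>Hajek projection and jackknife variance\<close>

text \<open>Measurability and integrability are bundled with the estimate so that bounds compose
  without being re-established. \<open>B\<close> bounds the second moment, not its root.\<close>

definition sq_bound :: "'a measure \<Rightarrow> ('a \<Rightarrow> real) \<Rightarrow> real \<Rightarrow> bool" where
  "sq_bound M f B \<longleftrightarrow>
     f \<in> borel_measurable M \<and> integrable M (\<lambda>x. (f x)\<^sup>2) \<and> (\<integral>x. (f x)\<^sup>2 \<partial>M) \<le> B"

lemma sq_bound_mono: "sq_bound M f A \<Longrightarrow> A \<le> B \<Longrightarrow> sq_bound M f B"
  by (auto simp: sq_bound_def)

lemma sq_bound_dominated:
  assumes "sq_bound M g B" "f \<in> borel_measurable M" "\<And>x. x \<in> space M \<Longrightarrow> \<bar>f x\<bar> \<le> \<bar>g x\<bar>"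
  shows "sq_bound M f B"
proof -
  have g: "integrable M (\<lambda>x. (g x)\<^sup>2)" "(\<integral>x. (g x)\<^sup>2 \<partial>M) \<le> B" using assms(1) by (auto simp: sq_bound_def)
  have le: "(f x)\<^sup>2 \<le> (g x)\<^sup>2" if "x \<in> space M" for x using assms(3)[OF that] by (simp add: abs_le_square_iff)
  have i: "integrable M (\<lambda>x. (f x)\<^sup>2)"
    using le assms(2) by (intro Bochner_Integration.integrable_bound[OF g(1)]) auto
  have "(\<integral>x. (f x)\<^sup>2 \<partial>M) \<le> (\<integral>x. (g x)\<^sup>2 \<partial>M)" by (intro integral_mono i g le)
  with i g(2) assms(2) show ?thesis by (simp add: sq_bound_def)
qed

text \<open>From \<open>(a + b)\<^sup>2 \<le> 2 * (a\<^sup>2 + b\<^sup>2)\<close>. The factor 2 is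
  the source of the numerical constants in the bounds below.\<close>

lemma sq_bound_add:
  assumes "sq_bound M f A" "sq_bound M g B"
  shows "sq_bound M (\<lambda>x. f x + g x) (2 * (A + B))"
proof -
  have f: "f \<in> borel_measurable M" "integrable M (\<lambda>x. (f x)\<^sup>2)" "(\<integral>x. (f x)\<^sup>2 \<partial>M) \<le> A"
    and g: "g \<in> borel_measurable M" "integrable M (\<lambda>x. (g x)\<^sup>2)" "(\<integral>x. (g x)\<^sup>2 \<partial>M) \<le> B"
    using assms by (auto simp: sq_bound_def)
  have le: "(f x + g x)\<^sup>2 \<le> 2 * ((f x)\<^sup>2 + (g x)\<^sup>2)" for x
    using sum_squares_bound[of "f x" "g x"] by (simp add: power2_sum)
  have i2: "integrable M (\<lambda>x. 2 * ((f x)\<^sup>2 + (g x)\<^sup>2))" using f g by simp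
  have i: "integrable M (\<lambda>x. (f x + g x)\<^sup>2)"
    using f(1) g(1) le by (intro Bochner_Integration.integrable_bound[OF i2]) auto
  have "(\<integral>x. (f x + g x)\<^sup>2 \<partial>M) \<le> (\<integral>x. 2 * ((f x)\<^sup>2 + (g x)\<^sup>2) \<partial>M)"
    by (intro integral_mono i i2 le)
  also have "\<dots> \<le> 2 * (A + B)" using f g by simp
  finally show ?thesis using i f(1) g(1) by (simp add: sq_bound_def)
qed

lemma sq_bound_cmult:
  assumes "sq_bound M f A" shows "sq_bound M (\<lambda>x. c * f x) (c\<^sup>2 * A)"
  using assms by (auto simp: sq_bound_def power_mult_distrib intro!: mult_left_mono)

lemma borel_measurable_L2_set:
  assumes "\<And>i. i \<in> I \<Longrightarrow> f i \<in> borel_measurable M"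
  shows "(\<lambda>x. L2_set (\<lambda>i. f i x) I) \<in> borel_measurable M"
  unfolding L2_set_def
  by (intro measurable_compose[OF _ borel_measurable_sqrt] borel_measurable_sum borel_measurable_power assms)

lemma sq_bound_L2_set:
  assumes "\<And>i. i \<in> I \<Longrightarrow> sq_bound M (f i) B" "finite I"
  shows "sq_bound M (\<lambda>x. L2_set (\<lambda>i. f i x) I) (real (card I) * B)"
proof -
  have sq: "(L2_set (\<lambda>i. f i x) I)\<^sup>2 = (\<Sum>i\<in>I. (f i x)\<^sup>2)" for x
    unfolding L2_set_def by (intro real_sqrt_pow2 sum_nonneg) auto
  have m: "(\<lambda>x. L2_set (\<lambda>i. f i x) I) \<in> borel_measurable M"
    by (rule borel_measurable_L2_set) (use assms(1) in \<open>auto simp: sq_bound_def\<close>)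
  have i: "integrable M (\<lambda>x. (f i x)\<^sup>2)" "(\<integral>x. (f i x)\<^sup>2 \<partial>M) \<le> B" if "i \<in> I" for i
    using assms(1)[OF that] by (auto simp: sq_bound_def)
  have "(\<integral>x. (\<Sum>i\<in>I. (f i x)\<^sup>2) \<partial>M) = (\<Sum>i\<in>I. \<integral>x. (f i x)\<^sup>2 \<partial>M)"
    using i by (intro Bochner_Integration.integral_sum) auto
  also have "\<dots> \<le> real (card I) * B" using i sum_bounded_above[of I _ B] by simp
  finally show ?thesis using m i by (simp add: sq_bound_def sq)
qed

lemma (in prob_space) sq_bound_const: "sq_bound M (\<lambda>_. c) (c\<^sup>2)"
  by (simp add: sq_bound_def prob_space)

lemma (in prob_space) sq_bound_prob:
  assumes "sq_bound M f B" "e > 0"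
  shows "prob {\<omega> \<in> space M. e \<le> \<bar>f \<omega>\<bar>} \<le> B / e\<^sup>2"
proof -
  have "prob {\<omega> \<in> space M. e \<le> \<bar>f \<omega>\<bar>} \<le> expectation (\<lambda>\<omega>. (f \<omega>)\<^sup>2) / e\<^sup>2"
    using assms by (intro second_moment_method) (auto simp: sq_bound_def)
  also have "\<dots> \<le> B / e\<^sup>2" using assms by (intro divide_right_mono) (auto simp: sq_bound_def)
  finally show ?thesis .
qed

section \<open>Algebra of the jackknife\<close>

definition row_mean :: "('y \<Rightarrow> 'y \<Rightarrow> real) \<Rightarrow> (nat \<Rightarrow> 'y) \<Rightarrow> nat \<Rightarrow> nat \<Rightarrow> real" where
  "row_mean h y n i = (\<Sum>j\<in>{1..n} - {i}. h (y i) (y j)) / (real n - 1)"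

text \<open>Removing a point deletes a row and a column of the matrix of kernel values; these agree
  by symmetry, so twice the row sum is lost. With \<open>3 \<le> n\<close> at least two points
  remain.\<close>

lemma ustat_leave_one_out:
  assumes n: "3 \<le> n" and i: "i \<in> {1..n}"
    and sym: "\<And>i j. i \<in> {1..n} \<Longrightarrow> j \<in> {1..n} \<Longrightarrow> h (y i) (y j) = h (y j) (y i)"
  shows "ustat h y ({1..n} - {i}) - ustat h y {1..n} = 2 / (real n - 2) * (ustat h y {1..n} - row_mean h y n i)"
proof -
  let ?J = "{1..n} - {i}"
  define S where "S = (\<Sum>j\<in>?J. h (y i) (y j))"
  define T where "T = (\<Sum>a\<in>?J. \<Sum>b\<in>?J - {a}. h (y a) (y b))"
  have "(\<Sum>b\<in>{1..n} - {a}. h (y a) (y b)) = h (y i) (y a) + (\<Sum>b\<in>?J - {a}. h (y a) (y b))" if "a \<in> ?J" for a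
  proof -
    have "{1..n} - {a} - {i} = ?J - {a}" by auto
    then show ?thesis using sum.remove[of "{1..n} - {a}" i "\<lambda>b. h (y a) (y b)"] that i sym[of a i] by simp
  qed
  then have "(\<Sum>a\<in>{1..n}. \<Sum>b\<in>{1..n} - {a}. h (y a) (y b)) = S + (\<Sum>a\<in>?J. h (y i) (y a) + (\<Sum>b\<in>?J - {a}. h (y a) (y b)))"
    using sum.remove[of "{1..n}" i "\<lambda>a. \<Sum>b\<in>{1..n} - {a}. h (y a) (y b)"] i by (simp add: S_def)
  also have "\<dots> = 2 * S + T" by (simp add: sum.distrib S_def T_def)
  finally have U: "ustat h y {1..n} = (2 * S + T) / (real n * (real n - 1))"
    by (simp add: ustat_def)
  have c: "real (card ?J) = real n - 1" using i n by simp
  have J: "ustat h y ?J = T / ((real n - 1) * (real n - 2))"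
    unfolding ustat_def c T_def by (simp add: algebra_simps)
  have "real n \<noteq> 0" "real n - 1 \<noteq> 0" "real n - 2 \<noteq> 0" using n by auto
  then show ?thesis
    unfolding U J row_mean_def S_def[symmetric] by (simp add: divide_simps) (simp add: algebra_simps)
qed

text \<open>The second factor is the empirical standard deviation of the row means, written as a
  norm so that triangle inequalities apply. The first factor tends to 2.\<close>

lemma sqrt_jackknife_var:
  assumes n: "3 \<le> n"
    and sym: "\<And>i j. i \<in> {1..n} \<Longrightarrow> j \<in> {1..n} \<Longrightarrow> h (y i) (y j) = h (y j) (y i)"
  shows "sqrt (jackknife_var h y n) =
    2 * sqrt (real n * (real n - 1)) / (real n - 2) *
      (L2_set (\<lambda>i. row_mean h y n i - ustat h y {1..n}) {1..n} / sqrt (real n))"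
proof -
  let ?U = "ustat h y {1..n}"
  have "jackknife_var h y n = (real n - 1) * (\<Sum>i\<in>{1..n}. (2 / (real n - 2))\<^sup>2 * (row_mean h y n i - ?U)\<^sup>2)"
    unfolding jackknife_var_def
  proof (intro arg_cong[where f="\<lambda>x. (real n - 1) * x"] sum.cong refl)
    fix i assume "i \<in> {1..n}"
    with n sym have *: "ustat h y ({1..n} - {i}) - ?U = 2 / (real n - 2) * (?U - row_mean h y n i)"
      by (intro ustat_leave_one_out) auto
    show "(ustat h y ({1..n} - {i}) - ?U)\<^sup>2 = (2 / (real n - 2))\<^sup>2 * (row_mean h y n i - ?U)\<^sup>2"
      unfolding * power_mult_distrib power2_commute[of ?U] ..
  qed
  also have "\<dots> = (real n - 1) * (2 / (real n - 2))\<^sup>2 * (\<Sum>i\<in>{1..n}. (row_mean h y n i - ?U)\<^sup>2)"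
    by (simp add: sum_distrib_left mult.assoc)
  finally have "sqrt (jackknife_var h y n) =
      sqrt (real n - 1) * \<bar>2 / (real n - 2)\<bar> * L2_set (\<lambda>i. row_mean h y n i - ?U) {1..n}"
    by (simp add: real_sqrt_mult L2_set_def)
  then show ?thesis using n by (simp add: real_sqrt_mult)
qed

section \<open>Moment bounds for a single row, depending on the law only through
  \<open>C\<close>\<close>

locale ustat_sample = iid_sample M N Y D
  for M :: "'a measure" and N :: "'y measure" and Y D +
  fixes h :: "'y \<Rightarrow> 'y \<Rightarrow> real" and C :: real
  assumes h_meas: "(\<lambda>p. h (fst p) (snd p)) \<in> borel_measurable (N \<Otimes>\<^sub>M N)"
    and h_sym: "\<And>x y. x \<in> space N \<Longrightarrow> y \<in> space N \<Longrightarrow> h x y = h y x"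
    and h4: "integrable (D \<Otimes>\<^sub>M D) (\<lambda>p. h (fst p) (snd p) ^ 4)"
    and h4_le: "(\<integral>p. h (fst p) (snd p) ^ 4 \<partial>(D \<Otimes>\<^sub>M D)) \<le> C"
begin

abbreviation "\<theta> \<equiv> kernel_mean D h"
abbreviation "g \<equiv> hajek D h"
text \<open>\<open>16 * C\<close> bounds the fourth moments of \<open>h - \<theta>\<close> and of
  \<open>g\<close>; the summand 1 pays for bounding second and third moments by the fourth.\<close>

definition "K = 1 + 16 * C"

lemma h_meas' [measurable]: "(\<lambda>p. h (fst p) (snd p)) \<in> borel_measurable (D \<Otimes>\<^sub>M D)"
  using h_meas sets_D by (simp cong: measurable_cong_sets sets_pair_measure_cong)

lemma h_int: "integrable (D \<Otimes>\<^sub>M D) (\<lambda>p. h (fst p) (snd p))"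
proof (rule Bochner_Integration.integrable_bound)
  show "integrable (D \<Otimes>\<^sub>M D) (\<lambda>p. 1 + h (fst p) (snd p) ^ 4)" using h4 by simp
  show "AE p in D \<Otimes>\<^sub>M D. norm (h (fst p) (snd p)) \<le> norm (1 + h (fst p) (snd p) ^ 4)"
    using le_one_plus_fourth(3) by (auto intro: order_trans[OF _ abs_ge_self])
qed simp

text \<open>Jensen's inequality gives \<open>\<theta> ^ 4 \<le> C\<close>, so
  \<open>power4_diff_le\<close> yields \<open>8 * (C + C)\<close>.\<close>

lemma hc4: "integrable (D \<Otimes>\<^sub>M D) (\<lambda>p. (h (fst p) (snd p) - \<theta>) ^ 4)"
    "(\<integral>p. (h (fst p) (snd p) - \<theta>) ^ 4 \<partial>(D \<Otimes>\<^sub>M D)) \<le> 16 * C"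
proof -
  have \<theta>: "\<theta> ^ 4 \<le> C"
    using DD.expectation_power4_le[OF h_int h4] h4_le by (simp add: kernel_mean_def)
  have i: "integrable (D \<Otimes>\<^sub>M D) (\<lambda>p. 8 * (h (fst p) (snd p) ^ 4 + \<theta> ^ 4))" using h4 by simp
  show i': "integrable (D \<Otimes>\<^sub>M D) (\<lambda>p. (h (fst p) (snd p) - \<theta>) ^ 4)"
  proof (rule Bochner_Integration.integrable_bound[OF i])
    have "norm ((a - \<theta>) ^ 4) \<le> norm (8 * (a ^ 4 + \<theta> ^ 4))" for a
    proof -
      have "0 \<le> (a - \<theta>) ^ 4" by simp
      then show ?thesis using power4_diff_le[of a \<theta>] unfolding real_norm_def by linarith
    qed
    then show "AE p in D \<Otimes>\<^sub>M D. norm ((h (fst p) (snd p) - \<theta>) ^ 4) \<le> norm (8 * (h (fst p) (snd p) ^ 4 + \<theta> ^ 4))"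
      by (intro AE_I2)
  qed simp
  have "(\<integral>p. (h (fst p) (snd p) - \<theta>) ^ 4 \<partial>(D \<Otimes>\<^sub>M D)) \<le> (\<integral>p. 8 * (h (fst p) (snd p) ^ 4 + \<theta> ^ 4) \<partial>(D \<Otimes>\<^sub>M D))"
    by (intro integral_mono i i' power4_diff_le)
  also have "\<dots> = 8 * ((\<integral>p. h (fst p) (snd p) ^ 4 \<partial>(D \<Otimes>\<^sub>M D)) + \<theta> ^ 4)"
    using h4 by (simp add: DD.prob_space)
  also have "\<dots> \<le> 16 * C" using \<theta> h4_le by simp
  finally show "(\<integral>p. (h (fst p) (snd p) - \<theta>) ^ 4 \<partial>(D \<Otimes>\<^sub>M D)) \<le> 16 * C" .
qed

lemma K_ge: "16 * C \<le> K" "0 \<le> K"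
proof -
  have "0 \<le> (\<integral>p. h (fst p) (snd p) ^ 4 \<partial>(D \<Otimes>\<^sub>M D))" by (intro Bochner_Integration.integral_nonneg) simp
  from order_trans[OF this h4_le] show "16 * C \<le> K" "0 \<le> K" by (auto simp: K_def)
qed

lemma hc2: "sq_bound (D \<Otimes>\<^sub>M D) (\<lambda>p. h (fst p) (snd p) - \<theta>) K"
proof -
  have i: "integrable (D \<Otimes>\<^sub>M D) (\<lambda>p. 1 + (h (fst p) (snd p) - \<theta>) ^ 4)" using hc4 by simp
  have i': "integrable (D \<Otimes>\<^sub>M D) (\<lambda>p. (h (fst p) (snd p) - \<theta>)\<^sup>2)"
    by (rule Bochner_Integration.integrable_bound[OF i]) (auto simp: le_one_plus_fourth)
  have "(\<integral>p. (h (fst p) (snd p) - \<theta>)\<^sup>2 \<partial>(D \<Otimes>\<^sub>M D)) \<le> (\<integral>p. 1 + (h (fst p) (snd p) - \<theta>) ^ 4 \<partial>(D \<Otimes>\<^sub>M D))"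
    by (intro integral_mono i i' le_one_plus_fourth)
  also have "\<dots> \<le> K" using hc4 by (simp add: DD.prob_space K_def)
  finally show ?thesis using i' by (simp add: sq_bound_def)
qed

lemma g_meas [measurable]: "g \<in> borel_measurable N"
proof -
  have "(\<lambda>(x, y). h x y) \<in> borel_measurable (N \<Otimes>\<^sub>M D)"
    using h_meas sets_D by (simp add: split_beta cong: measurable_cong_sets sets_pair_measure_cong)
  from D.borel_measurable_lebesgue_integral[OF this] show ?thesis unfolding hajek_def[abs_def] by simp
qed

lemma g_meas_D [measurable]: "g \<in> borel_measurable D"
  using g_meas sets_D by (simp cong: measurable_cong_sets)

text \<open>Jensen's inequality in the second argument only, since \<open>g x\<close> is the mean of
  \<open>h x - \<theta>\<close>. It holds for almost every \<open>x\<close>, because only then are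
  \<open>h x\<close> and its centred fourth power known to be integrable.\<close>

lemma g4: "integrable D (\<lambda>x. g x ^ 4)" "(\<integral>x. g x ^ 4 \<partial>D) \<le> 16 * C"
proof -
  let ?f = "\<lambda>p. (h (fst p) (snd p) - \<theta>) ^ 4"
  have AE: "AE x in D. g x ^ 4 \<le> (\<integral>y. ?f (x, y) \<partial>D)"
    using DD.AE_integrable_fst'[OF h_int] DD.AE_integrable_fst'[OF hc4(1)]
  proof eventually_elim
    case (elim x)
    have "g x = (\<integral>y. h x y - \<theta> \<partial>D)" using elim by (simp add: hajek_def D.prob_space)
    then show ?case using D.expectation_power4_le[of "\<lambda>y. h x y - \<theta>"] elim by simp
  qed
  have i: "integrable D (\<lambda>x. \<integral>y. ?f (x, y) \<partial>D)" by (rule DD.integrable_fst'[OF hc4(1)])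
  show i': "integrable D (\<lambda>x. g x ^ 4)"
  proof (rule Bochner_Integration.integrable_bound[OF i])
    show "AE x in D. norm (g x ^ 4) \<le> norm (\<integral>y. ?f (x, y) \<partial>D)"
      using AE by eventually_elim (auto intro: order_trans[OF _ abs_ge_self])
  qed simp
  have "(\<integral>x. g x ^ 4 \<partial>D) \<le> (\<integral>x. (\<integral>y. ?f (x, y) \<partial>D) \<partial>D)" by (rule integral_mono_AE[OF i' i AE])
  also have "\<dots> \<le> 16 * C" using DD.integral_fst'[OF hc4(1)] hc4(2) by simp
  finally show "(\<integral>x. g x ^ 4 \<partial>D) \<le> 16 * C" .
qed

lemma g2: "sq_bound D g K"
proof -
  have i: "integrable D (\<lambda>x. 1 + g x ^ 4)" using g4 by simp
  have i': "integrable D (\<lambda>x. (g x)\<^sup>2)"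
    by (rule Bochner_Integration.integrable_bound[OF i]) (auto simp: le_one_plus_fourth)
  have "(\<integral>x. (g x)\<^sup>2 \<partial>D) \<le> (\<integral>x. 1 + g x ^ 4 \<partial>D)" by (intro integral_mono i i' le_one_plus_fourth)
  also have "\<dots> \<le> K" using g4 by (simp add: D.prob_space K_def)
  finally show ?thesis using i' by (simp add: sq_bound_def)
qed

lemma g3: "integrable D (\<lambda>x. \<bar>g x\<bar> ^ 3)" "(\<integral>x. \<bar>g x\<bar> ^ 3 \<partial>D) \<le> K"
proof -
  have i: "integrable D (\<lambda>x. 1 + g x ^ 4)" using g4 by simp
  show i': "integrable D (\<lambda>x. \<bar>g x\<bar> ^ 3)"
  proof (rule Bochner_Integration.integrable_bound[OF i])
    show "AE x in D. norm (\<bar>g x\<bar> ^ 3) \<le> norm (1 + g x ^ 4)"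
      using order_trans[OF le_one_plus_fourth(2) abs_ge_self] by simp
  qed simp
  have "(\<integral>x. \<bar>g x\<bar> ^ 3 \<partial>D) \<le> (\<integral>x. 1 + g x ^ 4 \<partial>D)" by (intro integral_mono i i' le_one_plus_fourth)
  also have "\<dots> \<le> K" using g4 by (simp add: D.prob_space K_def)
  finally show "(\<integral>x. \<bar>g x\<bar> ^ 3 \<partial>D) \<le> K" .
qed

lemma g_int: "integrable D g"
  by (rule D.square_integrable_imp_integrable) (use g2 in \<open>auto simp: sq_bound_def\<close>)

lemma g_mean: "(\<integral>x. g x \<partial>D) = 0"
proof -
  have "integrable D (\<lambda>x. \<integral>y. h x y \<partial>D)" using DD.integrable_fst'[OF h_int] by simp
  then have "(\<integral>x. g x \<partial>D) = (\<integral>x. (\<integral>y. h x y \<partial>D) \<partial>D) - \<theta>"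
    by (simp add: hajek_def D.prob_space)
  also have "(\<integral>x. (\<integral>y. h x y \<partial>D) \<partial>D) = \<theta>"
    using DD.integral_fst'[OF h_int] by (simp add: kernel_mean_def)
  finally show ?thesis by simp
qed

text \<open>Moments on the product are transported to the sample, where \<open>(Y 1, Y 2)\<close>
  has the product law, and from there to \<open>D\<close>.\<close>

lemma sq_bound_fst: "sq_bound (D \<Otimes>\<^sub>M D) (\<lambda>p. g (fst p)) K"
  and sq_bound_snd: "sq_bound (D \<Otimes>\<^sub>M D) (\<lambda>p. g (snd p)) K"
proof -
  have *: "integrable M (\<lambda>\<omega>. (g (Y i \<omega>))\<^sup>2)" "(\<integral>\<omega>. (g (Y i \<omega>))\<^sup>2 \<partial>M) \<le> K" if "1 \<le> i" for i
    using g2 that integrable_D_iff[of i "\<lambda>x. (g x)\<^sup>2"] integral_D[of i "\<lambda>x. (g x)\<^sup>2"] by (auto simp: sq_bound_def)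
  show "sq_bound (D \<Otimes>\<^sub>M D) (\<lambda>p. g (fst p)) K"
    using *[of 1] integrable_DD_iff[of 1 2 "\<lambda>x y. (g x)\<^sup>2"] integral_DD[of 1 2 "\<lambda>x y. (g x)\<^sup>2"]
    by (simp add: sq_bound_def)
  show "sq_bound (D \<Otimes>\<^sub>M D) (\<lambda>p. g (snd p)) K"
    using *[of 2] integrable_DD_iff[of 1 2 "\<lambda>x y. (g y)\<^sup>2"] integral_DD[of 1 2 "\<lambda>x y. (g y)\<^sup>2"]
    by (simp add: sq_bound_def)
qed

text \<open>\<open>b\<close> subtracts the projection on the first argument and is degenerate in the
  second; it measures the error of a row mean. \<open>r\<close> is the completely degenerate
  remainder of the Hoeffding decomposition and measures the error of the whole U-statistic.\<close>

definition "b x y = h x y - \<theta> - g x"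
definition "r x y = h x y - \<theta> - g x - g y"

text \<open>These two identities hold for every \<open>x\<close>: if \<open>h x\<close> is not integrable, neither is the integrand,
  and both integrals are \<open>0\<close> by convention.\<close>

lemma b_degenerate: "(\<integral>y. b x y \<partial>D) = 0"
proof (cases "integrable D (h x)")
  case True
  then show ?thesis by (simp add: b_def hajek_def D.prob_space)
next
  case False
  have "\<not> integrable D (b x)"
  proof
    assume "integrable D (b x)"
    then have "integrable D (\<lambda>y. b x y + (\<theta> + g x))" by simp
    then show False using False by (simp add: b_def)
  qed
  then show ?thesis by (rule not_integrable_integral_eq)
qed

lemma r_degenerate: "(\<integral>y. r x y \<partial>D) = 0"
proof (cases "integrable D (b x)")
  case True
  then have "(\<integral>y. b x y - g y \<partial>D) = 0" using g_int g_mean b_degenerate by simp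
  then show ?thesis by (simp add: r_def b_def)
next
  case False
  have "\<not> integrable D (r x)"
  proof
    assume "integrable D (r x)"
    then have "integrable D (\<lambda>y. r x y + g y)" using g_int by simp
    then show False using False by (simp add: r_def b_def[abs_def])
  qed
  then show ?thesis by (rule not_integrable_integral_eq)
qed

lemma b_meas: "(\<lambda>p. b (fst p) (snd p)) \<in> borel_measurable (N \<Otimes>\<^sub>M N)"
  unfolding b_def using h_meas by measurable

lemma r_meas: "(\<lambda>p. r (fst p) (snd p)) \<in> borel_measurable (N \<Otimes>\<^sub>M N)"
  unfolding r_def using h_meas by measurable

lemma b2: "sq_bound (D \<Otimes>\<^sub>M D) (\<lambda>p. b (fst p) (snd p)) (4 * K)"
  using sq_bound_add[OF hc2 sq_bound_cmult[OF sq_bound_fst, of "-1"]]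
  by (simp add: b_def[abs_def])

lemma r2: "sq_bound (D \<Otimes>\<^sub>M D) (\<lambda>p. r (fst p) (snd p)) (10 * K)"
  using sq_bound_add[OF b2 sq_bound_cmult[OF sq_bound_snd, of "-1"]]
  by (simp add: b_def[abs_def] r_def[abs_def])

lemma r_sym: "x \<in> space N \<Longrightarrow> y \<in> space N \<Longrightarrow> r x y = r y x"
  using h_sym by (simp add: r_def)

text \<open>Every point occurs in \<open>2 * (n - 1)\<close> ordered pairs, which explains the
  coefficient \<open>2 / n\<close>; what is left is the normalised sum of \<open>r\<close>. The
  constant is twice the \<open>10 * K\<close> of \<open>r2\<close>.\<close>

lemma hajek_remainder:
  assumes n: "2 \<le> n"
  shows "sq_bound M (\<lambda>\<omega>. ustat h (\<lambda>i. Y i \<omega>) {1..n} - \<theta> - 2 / real n * (\<Sum>i\<in>{1..n}. g (Y i \<omega>)))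
    (20 * K / (real n * (real n - 1)))"
proof -
  define S where "S \<omega> = (\<Sum>i\<in>{1..n}. \<Sum>j\<in>{1..n} - {i}. r (Y i \<omega>) (Y j \<omega>))" for \<omega>
  have nn: "real n * (real n - 1) = real (n * (n - 1))" "0 < real n * (real n - 1)" using n by (auto simp: of_nat_diff)
  have eq: "ustat h (\<lambda>i. Y i \<omega>) {1..n} - \<theta> - 2 / real n * (\<Sum>i\<in>{1..n}. g (Y i \<omega>))
     = 1 / (real n * (real n - 1)) * S \<omega>" for \<omega>
  proof -
    let ?G = "\<Sum>i\<in>{1..n}. g (Y i \<omega>)"
    have "(\<Sum>j\<in>{1..n} - {i}. r (Y i \<omega>) (Y j \<omega>)) =
       (\<Sum>j\<in>{1..n} - {i}. h (Y i \<omega>) (Y j \<omega>)) - (real n - 1) * \<theta> - (real n - 1) * g (Y i \<omega>) - (?G - g (Y i \<omega>))"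
      if "i \<in> {1..n}" for i
      using that by (simp add: r_def sum_subtractf sum_diff1 of_nat_diff)
    then have "S \<omega> = (\<Sum>i\<in>{1..n}. (\<Sum>j\<in>{1..n} - {i}. h (Y i \<omega>) (Y j \<omega>)) - (real n - 1) * \<theta>
        - (real n - 1) * g (Y i \<omega>) - (?G - g (Y i \<omega>)))" unfolding S_def by (rule sum.cong[OF refl])
    also have "\<dots> = (\<Sum>i\<in>{1..n}. \<Sum>j\<in>{1..n} - {i}. h (Y i \<omega>) (Y j \<omega>)) - real n * ((real n - 1) * \<theta>)
        - (real n - 1) * ?G - (real n * ?G - ?G)"
      by (simp add: sum_subtractf sum_distrib_left)
    also have "\<dots> = (\<Sum>i\<in>{1..n}. \<Sum>j\<in>{1..n} - {i}. h (Y i \<omega>) (Y j \<omega>)) - real n * (real n - 1) * \<theta>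
        - 2 * (real n - 1) * ?G"
      by (simp add: algebra_simps)
    finally have S: "S \<omega> = (\<Sum>i\<in>{1..n}. \<Sum>j\<in>{1..n} - {i}. h (Y i \<omega>) (Y j \<omega>)) - real n * (real n - 1) * \<theta>
        - 2 * (real n - 1) * ?G" .
    have "real n \<noteq> 0" "real n - 1 \<noteq> 0" using n by auto
    then show ?thesis unfolding S ustat_def by (simp add: divide_simps)
  qed
  have m: "S \<in> borel_measurable M"
    unfolding S_def[abs_def] by (intro borel_measurable_sum measurable_pair_Y r_meas) auto
  have r: "integrable (D \<Otimes>\<^sub>M D) (\<lambda>p'. (r (fst p') (snd p'))\<^sup>2)" "(\<integral>p'. (r (fst p') (snd p'))\<^sup>2 \<partial>(D \<Otimes>\<^sub>M D)) \<le> 10 * K"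
    using r2 by (auto simp: sq_bound_def)
  have S2: "integrable M (\<lambda>\<omega>. (S \<omega>)\<^sup>2)"
    unfolding S_def by (rule degenerate_ustat_moment(1)[OF r_meas r(1) r_degenerate r_sym])
  have "(\<integral>\<omega>. (S \<omega>)\<^sup>2 \<partial>M) = 2 * real (n * (n - 1)) * (\<integral>p'. (r (fst p') (snd p'))\<^sup>2 \<partial>(D \<Otimes>\<^sub>M D))"
    unfolding S_def by (rule degenerate_ustat_moment(2)[OF r_meas r(1) r_degenerate r_sym])
  also have "\<dots> \<le> 2 * real (n * (n - 1)) * (10 * K)"
    using r(2) by (intro mult_left_mono) auto
  finally have S2_le: "(\<integral>\<omega>. (S \<omega>)\<^sup>2 \<partial>M) \<le> 2 * real (n * (n - 1)) * (10 * K)" .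
  have "sq_bound M S (2 * real (n * (n - 1)) * (10 * K))"
    unfolding sq_bound_def using S2 S2_le m by blast
  then have "sq_bound M S (2 * (real n * (real n - 1)) * (10 * K))" unfolding nn(1) .
  from sq_bound_cmult[OF this, of "1 / (real n * (real n - 1))"]
  have "sq_bound M (\<lambda>\<omega>. 1 / (real n * (real n - 1)) * S \<omega>)
     ((1 / (real n * (real n - 1)))\<^sup>2 * (2 * (real n * (real n - 1)) * (10 * K)))" .
  moreover have "(1 / x)\<^sup>2 * (2 * x * (10 * K)) = 20 * K / x" if "0 < x" for x :: real
    using that by (simp add: power2_eq_square)
  ultimately show ?thesis unfolding eq using nn(2) by metis
qed

lemma hajek_sum_bound:
  assumes "1 \<le> n"
  shows "sq_bound M (\<lambda>\<omega>. 2 / real n * (\<Sum>i\<in>{1..n}. g (Y i \<omega>))) (4 * K / real n)"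
proof -
  have g: "integrable D (\<lambda>x. (g x)\<^sup>2)" "(\<integral>x. (g x)\<^sup>2 \<partial>D) \<le> K" using g2 by (auto simp: sq_bound_def)
  note mom = centered_sum_moment[OF g_meas g(1) g_mean, of n]
  have "(\<lambda>\<omega>. \<Sum>i\<in>{1..n}. g (Y i \<omega>)) \<in> borel_measurable M"
    by (intro borel_measurable_sum measurable_compose[OF Y_meas g_meas]) auto
  with mom g(2) have "sq_bound M (\<lambda>\<omega>. \<Sum>i\<in>{1..n}. g (Y i \<omega>)) (real n * K)"
    by (auto simp: sq_bound_def intro!: mult_left_mono)
  from sq_bound_cmult[OF this, of "2 / real n"] assms show ?thesis
    by (simp add: power2_eq_square)
qed

text \<open>The projection dominates, so the order drops to \<open>1 / n\<close>; 48 is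
  \<open>2 * (20 + 4)\<close>.\<close>

lemma ustat_bound:
  assumes n: "2 \<le> n"
  shows "sq_bound M (\<lambda>\<omega>. ustat h (\<lambda>i. Y i \<omega>) {1..n} - \<theta>) (48 * K / (real n - 1))"
proof -
  have "20 * K / (real n * (real n - 1)) \<le> 20 * K / (1 * (real n - 1))"
    using n K_ge by (intro divide_left_mono mult_right_mono mult_pos_pos) auto
  moreover have "4 * K / real n \<le> 4 * K / (real n - 1)"
    using n K_ge by (intro divide_left_mono mult_pos_pos) auto
  ultimately have "2 * (20 * K / (real n * (real n - 1)) + 4 * K / real n) \<le> 48 * K / (real n - 1)"
    by (simp add: add_divide_distrib[symmetric])
  moreover have "sq_bound M (\<lambda>\<omega>. ustat h (\<lambda>i. Y i \<omega>) {1..n} - \<theta>) (2 * (20 * K / (real n * (real n - 1)) + 4 * K / real n))"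
    using sq_bound_add[OF hajek_remainder[OF n] hajek_sum_bound[of n]] n by simp
  ultimately show ?thesis by (blast intro: sq_bound_mono)
qed

text \<open>A weak law of large numbers with a rate: the variance of the square of \<open>g\<close>
  is at most its fourth moment.\<close>

lemma hajek_square_mean:
  assumes "1 \<le> n"
  shows "sq_bound M (\<lambda>\<omega>. (\<Sum>i\<in>{1..n}. (g (Y i \<omega>))\<^sup>2) / real n - (\<integral>x. (g x)\<^sup>2 \<partial>D)) (K / real n)"
proof -
  let ?z = "\<integral>x. (g x)\<^sup>2 \<partial>D"
  have g: "integrable D (\<lambda>x. (g x)\<^sup>2)" using g2 by (auto simp: sq_bound_def)
  have m: "(\<lambda>x. (g x)\<^sup>2 - ?z) \<in> borel_measurable N" by simp
  have eq: "((g x)\<^sup>2 - ?z)\<^sup>2 = g x ^ 4 - 2 * ?z * (g x)\<^sup>2 + ?z\<^sup>2" for x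
    by (simp add: power2_diff)
  have i: "integrable D (\<lambda>x. ((g x)\<^sup>2 - ?z)\<^sup>2)" unfolding eq using g g4(1) by simp
  have "(\<integral>x. ((g x)\<^sup>2 - ?z)\<^sup>2 \<partial>D) = (\<integral>x. g x ^ 4 \<partial>D) - ?z\<^sup>2"
    unfolding eq using g g4(1) by (simp add: D.prob_space power2_eq_square)
  also have "\<dots> \<le> 16 * C - 0" by (intro diff_mono g4) simp
  finally have le: "(\<integral>x. ((g x)\<^sup>2 - ?z)\<^sup>2 \<partial>D) \<le> K" using K_ge by simp
  have "(\<integral>x. (g x)\<^sup>2 - ?z \<partial>D) = 0" using g by (simp add: D.prob_space)
  note mom = centered_sum_moment[OF m i this, of n]
  have "(\<lambda>\<omega>. \<Sum>i\<in>{1..n}. (g (Y i \<omega>))\<^sup>2 - ?z) \<in> borel_measurable M"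
    by (intro borel_measurable_sum measurable_compose[OF Y_meas m]) auto
  with mom le have "sq_bound M (\<lambda>\<omega>. \<Sum>i\<in>{1..n}. (g (Y i \<omega>))\<^sup>2 - ?z) (real n * K)"
    by (auto simp: sq_bound_def intro!: mult_left_mono)
  from sq_bound_cmult[OF this, of "1 / real n"] assms show ?thesis
    by (simp add: power2_eq_square sum_subtractf diff_divide_distrib)
qed

text \<open>A centred row mean is \<open>g (Y i)\<close> plus a row error \<open>B i\<close> plus
  \<open>\<theta> - U\<close>. By the reverse triangle inequality the two norms differ by at most
  the norm of the errors, and the part constant in \<open>i\<close> contributes
  \<open>\<bar>U - \<theta>\<bar>\<close> after division by \<open>sqrt n\<close>. The constant 104
  is \<open>2 * (4 + 48)\<close>.\<close>

lemma row_mean_bound: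
  assumes n: "2 \<le> n"
  shows "sq_bound M (\<lambda>\<omega>.
      L2_set (\<lambda>i. row_mean h (\<lambda>i. Y i \<omega>) n i - ustat h (\<lambda>i. Y i \<omega>) {1..n}) {1..n} / sqrt (real n)
      - L2_set (\<lambda>i. g (Y i \<omega>)) {1..n} / sqrt (real n)) (104 * K / (real n - 1))"
proof -
  define B where "B i \<omega> = 1 / (real n - 1) * (\<Sum>j\<in>{1..n} - {i}. b (Y i \<omega>) (Y j \<omega>))" for i \<omega>
  define U where "U \<omega> = ustat h (\<lambda>i. Y i \<omega>) {1..n}" for \<omega>
  let ?A = "\<lambda>i \<omega>. row_mean h (\<lambda>i. Y i \<omega>) n i"
  have bb: "integrable (D \<Otimes>\<^sub>M D) (\<lambda>p'. (b (fst p') (snd p'))\<^sup>2)" "(\<integral>p'. (b (fst p') (snd p'))\<^sup>2 \<partial>(D \<Otimes>\<^sub>M D)) \<le> 4 * K"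
    using b2 by (auto simp: sq_bound_def)
  have B: "sq_bound M (B i) (4 * K / (real n - 1))" if i: "i \<in> {1..n}" for i
  proof -
    note mom = row_sum_moment[OF b_meas bb(1) b_degenerate i]
    have "(\<lambda>\<omega>. \<Sum>j\<in>{1..n} - {i}. b (Y i \<omega>) (Y j \<omega>)) \<in> borel_measurable M"
      using i by (intro borel_measurable_sum measurable_pair_Y b_meas) auto
    moreover have "(\<integral>\<omega>. (\<Sum>j\<in>{1..n} - {i}. b (Y i \<omega>) (Y j \<omega>))\<^sup>2 \<partial>M) \<le> real (n - 1) * (4 * K)"
      unfolding mom(2) using bb(2) by (intro mult_left_mono) auto
    ultimately have "sq_bound M (\<lambda>\<omega>. \<Sum>j\<in>{1..n} - {i}. b (Y i \<omega>) (Y j \<omega>)) ((real n - 1) * (4 * K))"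
      using mom(1) n by (simp add: sq_bound_def of_nat_diff)
    from sq_bound_cmult[OF this, of "1 / (real n - 1)"] n show ?thesis
      by (simp add: B_def[abs_def] power2_eq_square)
  qed
  have U: "sq_bound M (\<lambda>\<omega>. U \<omega> - \<theta>) (48 * K / (real n - 1))"
    using ustat_bound[OF n] by (simp add: U_def)
  have A: "?A i \<omega> - U \<omega> = g (Y i \<omega>) + (B i \<omega> + (\<theta> - U \<omega>))" if "i \<in> {1..n}" for i \<omega>
  proof -
    have "(\<Sum>j\<in>{1..n} - {i}. b (Y i \<omega>) (Y j \<omega>)) = (\<Sum>j\<in>{1..n} - {i}. h (Y i \<omega>) (Y j \<omega>)) - (real n - 1) * (\<theta> + g (Y i \<omega>))"
      using that n by (simp add: b_def sum_subtractf of_nat_diff algebra_simps)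
    then have "B i \<omega> = ?A i \<omega> - (\<theta> + g (Y i \<omega>))"
      using n by (simp add: B_def row_mean_def diff_divide_distrib)
    then show ?thesis by simp
  qed
  have "sq_bound M (\<lambda>\<omega>. L2_set (\<lambda>i. B i \<omega>) {1..n}) (real (card {1..n}) * (4 * K / (real n - 1)))"
    by (intro sq_bound_L2_set B) auto
  from sq_bound_cmult[OF this, of "1 / sqrt (real n)"] n
  have "sq_bound M (\<lambda>\<omega>. L2_set (\<lambda>i. B i \<omega>) {1..n} / sqrt (real n)) (4 * K / (real n - 1))"
    by (simp add: power_divide)
  moreover have "sq_bound M (\<lambda>\<omega>. \<bar>U \<omega> - \<theta>\<bar>) (48 * K / (real n - 1))"
    using U by (rule sq_bound_dominated) (use U in \<open>auto simp: sq_bound_def\<close>)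
  ultimately have dom: "sq_bound M (\<lambda>\<omega>. L2_set (\<lambda>i. B i \<omega>) {1..n} / sqrt (real n) + \<bar>U \<omega> - \<theta>\<bar>) (104 * K / (real n - 1))"
    by (rule sq_bound_mono[OF sq_bound_add]) (simp add: add_divide_distrib[symmetric])
  show ?thesis
  proof (rule sq_bound_dominated[OF dom])
    have "(\<lambda>\<omega>. (U \<omega> - \<theta>) + \<theta>) \<in> borel_measurable M"
      using U by (intro borel_measurable_add) (auto simp: sq_bound_def)
    then have [measurable]: "U \<in> borel_measurable M" by simp
    have mA: "?A i \<in> borel_measurable M" if "i \<in> {1..n}" for i
      unfolding row_mean_def using that
      by (intro borel_measurable_divide borel_measurable_sum measurable_pair_Y h_meas) auto
    have mg: "(\<lambda>\<omega>. g (Y i \<omega>)) \<in> borel_measurable M" if "i \<in> {1..n}" for i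
      using that by (intro measurable_compose[OF Y_meas g_meas]) auto
    show "(\<lambda>\<omega>. L2_set (\<lambda>i. ?A i \<omega> - ustat h (\<lambda>i. Y i \<omega>) {1..n}) {1..n} / sqrt (real n)
      - L2_set (\<lambda>i. g (Y i \<omega>)) {1..n} / sqrt (real n)) \<in> borel_measurable M"
      unfolding U_def[symmetric]
      by (intro borel_measurable_diff borel_measurable_divide borel_measurable_L2_set borel_measurable_const mA mg) auto
  next
    fix \<omega> assume "\<omega> \<in> space M"
    let ?L = "\<lambda>f. L2_set f {1..n}"
    have s: "0 < sqrt (real n)" using n by simp
    have AU: "?L (\<lambda>i. ?A i \<omega> - U \<omega>) = ?L (\<lambda>i. g (Y i \<omega>) + (B i \<omega> + (\<theta> - U \<omega>)))"
      using A by (intro L2_set_cong) auto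
    have BU: "?L (\<lambda>i. B i \<omega> + (\<theta> - U \<omega>)) \<le> ?L (\<lambda>i. B i \<omega>) + sqrt (real n) * \<bar>U \<omega> - \<theta>\<bar>"
      using L2_set_triangle_ineq[of "\<lambda>i. B i \<omega>" "\<lambda>_. \<theta> - U \<omega>" "{1..n}"]
      by (simp add: L2_set_constant abs_minus_commute)
    have 1: "?L (\<lambda>i. ?A i \<omega> - U \<omega>) \<le> ?L (\<lambda>i. g (Y i \<omega>)) + ?L (\<lambda>i. B i \<omega> + (\<theta> - U \<omega>))"
      unfolding AU by (rule L2_set_triangle_ineq)
    have 2: "?L (\<lambda>i. g (Y i \<omega>)) \<le> ?L (\<lambda>i. ?A i \<omega> - U \<omega>) + ?L (\<lambda>i. B i \<omega> + (\<theta> - U \<omega>))"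
    proof -
      have "?L (\<lambda>i. g (Y i \<omega>)) = ?L (\<lambda>i. (?A i \<omega> - U \<omega>) + - (B i \<omega> + (\<theta> - U \<omega>)))"
        using A by (intro L2_set_cong) auto
      also have "\<dots> \<le> ?L (\<lambda>i. ?A i \<omega> - U \<omega>) + ?L (\<lambda>i. - (B i \<omega> + (\<theta> - U \<omega>)))"
        by (rule L2_set_triangle_ineq)
      also have "?L (\<lambda>i. - (B i \<omega> + (\<theta> - U \<omega>))) = ?L (\<lambda>i. B i \<omega> + (\<theta> - U \<omega>))"
        by (simp only: L2_set_def power2_minus)
      finally show ?thesis .
    qed
    have "\<bar>?L (\<lambda>i. ?A i \<omega> - U \<omega>) - ?L (\<lambda>i. g (Y i \<omega>))\<bar> \<le> ?L (\<lambda>i. B i \<omega>) + sqrt (real n) * \<bar>U \<omega> - \<theta>\<bar>"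
      using 1 2 BU by linarith
    then have "\<bar>?L (\<lambda>i. ?A i \<omega> - U \<omega>) - ?L (\<lambda>i. g (Y i \<omega>))\<bar> / sqrt (real n)
        \<le> (?L (\<lambda>i. B i \<omega>) + sqrt (real n) * \<bar>U \<omega> - \<theta>\<bar>) / sqrt (real n)"
      using s by (intro divide_right_mono) auto
    also have "\<dots> = ?L (\<lambda>i. B i \<omega>) / sqrt (real n) + \<bar>U \<omega> - \<theta>\<bar>" using s by (simp add: add_divide_distrib)
    also have "\<bar>?L (\<lambda>i. ?A i \<omega> - U \<omega>) - ?L (\<lambda>i. g (Y i \<omega>))\<bar> / sqrt (real n)
        = \<bar>?L (\<lambda>i. ?A i \<omega> - U \<omega>) / sqrt (real n) - ?L (\<lambda>i. g (Y i \<omega>)) / sqrt (real n)\<bar>"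
      using s by (simp add: diff_divide_distrib[symmetric] abs_divide)
    finally show "\<bar>?L (\<lambda>i. ?A i \<omega> - ustat h (\<lambda>i. Y i \<omega>) {1..n}) / sqrt (real n) - ?L (\<lambda>i. g (Y i \<omega>)) / sqrt (real n)\<bar>
      \<le> \<bar>?L (\<lambda>i. B i \<omega>) / sqrt (real n) + \<bar>U \<omega> - \<theta>\<bar>\<bar>"
      by (simp add: U_def)
  qed
qed

end

section \<open>Convergence in probability and the triangular array\<close>

text \<open>The limit is always 0. Measurability is asked only for large \<open>n\<close>, since
  about the early rows of the array nothing is known.\<close>

definition conv_prob :: "'a measure \<Rightarrow> (nat \<Rightarrow> 'a \<Rightarrow> real) \<Rightarrow> bool" where
  "conv_prob M X \<longleftrightarrow> (\<forall>\<^sub>F n in sequentially. X n \<in> borel_measurable M) \<and>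
     (\<forall>e>0. (\<lambda>n. measure M {\<omega> \<in> space M. e \<le> \<bar>X n \<omega>\<bar>}) \<longlonglongrightarrow> 0)"

context prob_space
begin

lemma conv_prob_measurable: "conv_prob M X \<Longrightarrow> \<forall>\<^sub>F n in sequentially. X n \<in> borel_measurable M"
  by (simp add: conv_prob_def)

lemma conv_probD:
  "conv_prob M X \<Longrightarrow> 0 < e \<Longrightarrow> (\<lambda>n. prob {\<omega> \<in> space M. e \<le> \<bar>X n \<omega>\<bar>}) \<longlonglongrightarrow> 0"
  by (simp add: conv_prob_def)

lemma conv_prob_dominated:
  assumes X: "conv_prob M X" and c: "0 < c"
    and Y: "\<forall>\<^sub>F n in sequentially. Y n \<in> borel_measurable M \<and> (\<forall>\<omega>\<in>space M. \<bar>Y n \<omega>\<bar> \<le> c * \<bar>X n \<omega>\<bar>)"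
  shows "conv_prob M Y"
  unfolding conv_prob_def
proof (intro conjI allI impI)
  show "\<forall>\<^sub>F n in sequentially. Y n \<in> borel_measurable M" using Y by eventually_elim simp
  fix e :: real assume "e > 0"
  show "(\<lambda>n. prob {\<omega> \<in> space M. e \<le> \<bar>Y n \<omega>\<bar>}) \<longlonglongrightarrow> 0"
  proof (rule tendsto_sandwich[OF _ _ tendsto_const])
    show "(\<lambda>n. prob {\<omega> \<in> space M. e / c \<le> \<bar>X n \<omega>\<bar>}) \<longlonglongrightarrow> 0"
      using X c \<open>e > 0\<close> by (simp add: conv_prob_def)
    show "\<forall>\<^sub>F n in sequentially. prob {\<omega> \<in> space M. e \<le> \<bar>Y n \<omega>\<bar>} \<le> prob {\<omega> \<in> space M. e / c \<le> \<bar>X n \<omega>\<bar>}"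
      using Y conv_prob_measurable[OF X]
    proof eventually_elim
      case (elim n)
      have "{\<omega> \<in> space M. e \<le> \<bar>Y n \<omega>\<bar>} \<subseteq> {\<omega> \<in> space M. e / c \<le> \<bar>X n \<omega>\<bar>}"
        using elim c by (auto simp: divide_le_eq mult.commute intro: order_trans)
      then show ?case using elim by (intro finite_measure_mono) auto
    qed
  qed auto
qed

lemma conv_prob_add:
  assumes X: "conv_prob M X" and Y: "conv_prob M Y"
  shows "conv_prob M (\<lambda>n \<omega>. X n \<omega> + Y n \<omega>)"
  unfolding conv_prob_def
proof (intro conjI allI impI)
  note meas = eventually_conj[OF conv_prob_measurable[OF X] conv_prob_measurable[OF Y]]
  show "\<forall>\<^sub>F n in sequentially. (\<lambda>\<omega>. X n \<omega> + Y n \<omega>) \<in> borel_measurable M"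
    using meas by eventually_elim (auto intro: borel_measurable_add)
  fix e :: real assume "e > 0"
  let ?X = "\<lambda>n. {\<omega> \<in> space M. e / 2 \<le> \<bar>X n \<omega>\<bar>}" and ?Y = "\<lambda>n. {\<omega> \<in> space M. e / 2 \<le> \<bar>Y n \<omega>\<bar>}"
  show "(\<lambda>n. prob {\<omega> \<in> space M. e \<le> \<bar>X n \<omega> + Y n \<omega>\<bar>}) \<longlonglongrightarrow> 0"
  proof (rule tendsto_sandwich[OF _ _ tendsto_const])
    have "(\<lambda>n. prob (?X n) + prob (?Y n)) \<longlonglongrightarrow> 0 + 0"
      using \<open>e > 0\<close> by (intro tendsto_add conv_probD[OF X] conv_probD[OF Y]) simp_all
    then show "(\<lambda>n. prob (?X n) + prob (?Y n)) \<longlonglongrightarrow> 0" by (simp only: add_0_right)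
    show "\<forall>\<^sub>F n in sequentially. prob {\<omega> \<in> space M. e \<le> \<bar>X n \<omega> + Y n \<omega>\<bar>} \<le> prob (?X n) + prob (?Y n)"
      using meas
    proof eventually_elim
      case (elim n)
      then have m: "?X n \<in> events" "?Y n \<in> events" by auto
      have "prob {\<omega> \<in> space M. e \<le> \<bar>X n \<omega> + Y n \<omega>\<bar>} \<le> prob (?X n \<union> ?Y n)"
        using m by (intro finite_measure_mono sets.Un) auto
      also have "\<dots> \<le> prob (?X n) + prob (?Y n)" using m by (intro measure_Un_le)
      finally show ?case .
    qed
  qed auto
qed

lemma conv_prob_sq_bound:
  assumes sq: "\<forall>\<^sub>F n in sequentially. sq_bound M (X n) (B n)" and B: "B \<longlonglongrightarrow> 0"
  shows "conv_prob M X"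
  unfolding conv_prob_def
proof (intro conjI allI impI)
  show "\<forall>\<^sub>F n in sequentially. X n \<in> borel_measurable M" using sq by eventually_elim (simp add: sq_bound_def)
  fix e :: real assume "e > 0"
  show "(\<lambda>n. prob {\<omega> \<in> space M. e \<le> \<bar>X n \<omega>\<bar>}) \<longlonglongrightarrow> 0"
  proof (rule tendsto_sandwich[OF _ _ tendsto_const])
    show "(\<lambda>n. B n / e\<^sup>2) \<longlonglongrightarrow> 0" using B \<open>e > 0\<close> by (intro tendsto_divide_zero) 
    show "\<forall>\<^sub>F n in sequentially. prob {\<omega> \<in> space M. e \<le> \<bar>X n \<omega>\<bar>} \<le> B n / e\<^sup>2"
      using sq by eventually_elim (rule sq_bound_prob[OF _ \<open>e > 0\<close>])
  qed auto
qed

lemma conv_prob_const: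
  assumes "a \<longlonglongrightarrow> 0" shows "conv_prob M (\<lambda>n _. a n)"
proof (rule conv_prob_sq_bound)
  show "\<forall>\<^sub>F n in sequentially. sq_bound M (\<lambda>_. a n) ((a n)\<^sup>2)" by (simp add: sq_bound_const)
  show "(\<lambda>n. (a n)\<^sup>2) \<longlonglongrightarrow> 0" using tendsto_power[OF assms, of 2] by simp
qed

lemma conv_prob_mult:
  assumes X: "conv_prob M X" and a: "a \<longlonglongrightarrow> L"
  shows "conv_prob M (\<lambda>n \<omega>. a n * X n \<omega>)"
proof (rule conv_prob_dominated[OF X, of "\<bar>L\<bar> + 1"])
  have "\<forall>\<^sub>F n in sequentially. \<bar>a n\<bar> < \<bar>L\<bar> + 1" using tendsto_rabs[OF a] by (rule order_tendstoD) simp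
  with conv_prob_measurable[OF X]
  show "\<forall>\<^sub>F n in sequentially. (\<lambda>\<omega>. a n * X n \<omega>) \<in> borel_measurable M \<and>
      (\<forall>\<omega>\<in>space M. \<bar>a n * X n \<omega>\<bar> \<le> (\<bar>L\<bar> + 1) * \<bar>X n \<omega>\<bar>)"
    by eventually_elim (auto simp: abs_mult intro!: mult_right_mono)
qed simp

lemma conv_prob_cong:
  assumes X: "conv_prob M X" and eq: "\<forall>\<^sub>F n in sequentially. \<forall>\<omega>\<in>space M. X n \<omega> = Y n \<omega>"
  shows "conv_prob M Y"
proof (rule conv_prob_dominated[OF X, of 1])
  show "\<forall>\<^sub>F n in sequentially. Y n \<in> borel_measurable M \<and> (\<forall>\<omega>\<in>space M. \<bar>Y n \<omega>\<bar> \<le> 1 * \<bar>X n \<omega>\<bar>)"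
    using eq conv_prob_measurable[OF X]
  proof eventually_elim
    case (elim n)
    then have "Y n \<in> borel_measurable M" using measurable_cong[of M "X n" "Y n" borel] by blast
    with elim show ?case by simp
  qed
qed simp

text \<open>Outside the event \<open>d / 2 \<le> \<bar>e n \<omega>\<bar>\<close>, whose probability
  vanishes, \<open>Z n + e n \<le> s\<close> lies between the events that \<open>Z n\<close> is at
  most \<open>s - d / 2\<close> and at most \<open>s + d / 2\<close>. Continuity of \<open>F\<close>
  at \<open>s\<close> closes the gap.\<close>

lemma slutsky:
  assumes Z: "\<And>x. (\<lambda>n. prob {\<omega> \<in> space M. Z n \<omega> \<le> x}) \<longlonglongrightarrow> F x"
    and Zm: "\<forall>\<^sub>F n in sequentially. Z n \<in> borel_measurable M"
    and e: "conv_prob M e" and F: "isCont F s"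
  shows "(\<lambda>n. prob {\<omega> \<in> space M. Z n \<omega> + e n \<omega> \<le> s}) \<longlonglongrightarrow> F s"
proof (rule LIMSEQ_I)
  fix \<epsilon> :: real assume "0 < \<epsilon>"
  then obtain d where d: "0 < d" "\<And>x. \<bar>x - s\<bar> < d \<Longrightarrow> \<bar>F x - F s\<bar> < \<epsilon> / 3"
    using F[unfolded continuous_at_eps_delta dist_real_def, rule_format, of "\<epsilon> / 3"] \<open>0 < \<epsilon>\<close> by auto
  let ?E = "\<lambda>n. {\<omega> \<in> space M. d / 2 \<le> \<bar>e n \<omega>\<bar>}"
  have ev: "\<forall>\<^sub>F n in sequentially. \<bar>prob {\<omega> \<in> space M. Z n \<omega> \<le> x} - F x\<bar> < \<epsilon> / 3" for x
    using tendstoD[OF Z, of "\<epsilon> / 3"] \<open>0 < \<epsilon>\<close> by (simp add: dist_real_def)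
  have evE: "\<forall>\<^sub>F n in sequentially. prob (?E n) < \<epsilon> / 3"
    using d \<open>0 < \<epsilon>\<close> by (intro order_tendstoD(2)[OF conv_probD[OF e]]) auto
  have "\<forall>\<^sub>F n in sequentially. norm (prob {\<omega> \<in> space M. Z n \<omega> + e n \<omega> \<le> s} - F s) < \<epsilon>"
    using ev[of "s + d / 2"] ev[of "s - d / 2"] evE Zm conv_prob_measurable[OF e]
  proof eventually_elim
    case (elim n)
    let ?S = "{\<omega> \<in> space M. Z n \<omega> + e n \<omega> \<le> s}"
    have m: "?S \<in> events" "?E n \<in> events" "{\<omega> \<in> space M. Z n \<omega> \<le> x} \<in> events" for x
      using elim by auto
    have "prob ?S \<le> prob ({\<omega> \<in> space M. Z n \<omega> \<le> s + d / 2} \<union> ?E n)"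
      using m by (intro finite_measure_mono sets.Un) auto
    also have "\<dots> \<le> prob {\<omega> \<in> space M. Z n \<omega> \<le> s + d / 2} + prob (?E n)"
      using m by (intro measure_Un_le)
    finally have u: "prob ?S \<le> prob {\<omega> \<in> space M. Z n \<omega> \<le> s + d / 2} + prob (?E n)" .
    have "prob {\<omega> \<in> space M. Z n \<omega> \<le> s - d / 2} \<le> prob (?S \<union> ?E n)"
      using m by (intro finite_measure_mono sets.Un) auto
    also have "\<dots> \<le> prob ?S + prob (?E n)"
      using m by (intro measure_Un_le)
    finally have l: "prob {\<omega> \<in> space M. Z n \<omega> \<le> s - d / 2} \<le> prob ?S + prob (?E n)" .
    have "\<bar>F (s + d / 2) - F s\<bar> < \<epsilon> / 3" "\<bar>F (s - d / 2) - F s\<bar> < \<epsilon> / 3"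
      using d by auto
    with u l elim show ?case unfolding real_norm_def by linarith
  qed
  then show "\<exists>n0. \<forall>n\<ge>n0. norm (prob {\<omega> \<in> space M. Z n \<omega> + e n \<omega> \<le> s} - F s) < \<epsilon>"
    by (simp add: eventually_sequentially)
qed

end

section \<open>The standard normal law and the exponential limit\<close>

lemma isCont_cdf_std_normal: "isCont (cdf std_normal_distribution) x"
proof -
  interpret real_distribution std_normal_distribution by (rule real_dist_normal_dist)
  have "emeasure std_normal_distribution {x} = (\<integral>\<^sup>+ y. ennreal (std_normal_density y) * indicator {x} y \<partial>lborel)"
    by (rule emeasure_density) auto
  also have "\<dots> = 0"
    by (rule nn_integral_null_set) (simp add: null_sets_def)
  finally show ?thesis by (simp add: isCont_cdf measure_def)
qed

text \<open>Continuity is used twice. The superlevel set is closed, so its infimum belongs to it;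
  and the value \<open>u\<close> is attained, so the infimum does not overshoot.\<close>

lemma cdf_quantile_std_normal:
  assumes "0 < u" "u < 1"
  shows "cdf std_normal_distribution (quantile std_normal_distribution u) = u"
proof -
  interpret real_distribution std_normal_distribution by (rule real_dist_normal_dist)
  let ?F = "cdf std_normal_distribution"
  let ?S = "{x. u \<le> ?F x}"
  have "\<forall>\<^sub>F x in at_top. u < ?F x" using cdf_lim_at_top_prob assms(2) by (rule order_tendstoD)
  then obtain b where b: "u < ?F b" by (auto simp: eventually_at_top_linorder)
  have "\<forall>\<^sub>F x in at_bot. ?F x < u" using cdf_lim_at_bot assms(1) by (rule order_tendstoD)
  then obtain a where a: "?F a < u" by (auto simp: eventually_at_bot_linorder)
  have ab: "a \<le> b" using a b cdf_nondecreasing[of b a] by linarith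
  have bdd: "bdd_below ?S"
  proof (rule bdd_belowI)
    fix x assume "x \<in> ?S"
    then show "a \<le> x" using a cdf_nondecreasing[of x a] by force
  qed
  obtain c where c: "?F c = u"
    using IVT[of ?F a u b] a b ab isCont_cdf_std_normal by auto
  have closed: "closed ?S"
    by (intro closed_Collect_le continuous_intros continuous_at_imp_continuous_on ballI isCont_cdf_std_normal)
  have "Inf ?S \<in> ?S" using c bdd closed by (intro closed_contains_Inf) auto
  moreover have "Inf ?S \<le> c" using bdd c by (intro cInf_lower) auto
  then have "?F (Inf ?S) \<le> u" using cdf_nondecreasing[of "Inf ?S" c] c by simp
  ultimately show ?thesis by (simp add: quantile_def)
qed

text \<open>For numbers in the unit ball, \<open>n\<close>-th powers differ by at most
  \<open>n\<close> times the difference of the bases, which allows comparison with the constant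
  exponent \<open>z\<close>. Nonnegativity and \<open>\<rho> n \<le> n\<close> for large
  \<open>n\<close> keep the base in the unit ball.\<close>

lemma power_tendsto_exp:
  fixes \<rho> :: "nat \<Rightarrow> real" and z :: real
  assumes "\<rho> \<longlonglongrightarrow> z" "0 \<le> z" "\<And>n. 0 \<le> \<rho> n"
  shows "(\<lambda>n. (1 - \<rho> n / real n) ^ n) \<longlonglongrightarrow> exp (- z)"
proof -
  have lim: "(\<lambda>n. (1 + (- z) / real n) ^ n) \<longlonglongrightarrow> exp (- z)" by (rule tendsto_exp_limit_sequentially)
  have small: "\<forall>\<^sub>F n in sequentially. x n \<le> real n" if "x \<longlonglongrightarrow> z" for x :: "nat \<Rightarrow> real"
  proof -
    have "\<forall>\<^sub>F n in sequentially. x n < z + 1" using that by (rule order_tendstoD) simp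
    moreover have "\<forall>\<^sub>F n in sequentially. z + 1 \<le> real n"
      using filterlim_real_sequentially by (simp add: filterlim_at_top)
    ultimately show ?thesis by eventually_elim simp
  qed
  have "(\<lambda>n. (1 - \<rho> n / real n) ^ n - (1 + (- z) / real n) ^ n) \<longlonglongrightarrow> 0"
  proof (rule Lim_null_comparison)
    show "(\<lambda>n. \<bar>\<rho> n - z\<bar>) \<longlonglongrightarrow> 0" using assms(1) by (simp add: LIM_zero tendsto_rabs_zero)
    show "\<forall>\<^sub>F n in sequentially. norm ((1 - \<rho> n / real n) ^ n - (1 + (- z) / real n) ^ n) \<le> \<bar>\<rho> n - z\<bar>"
      using small[OF assms(1)] small[OF tendsto_const] eventually_gt_at_top[of 0]
    proof eventually_elim
      case (elim n)
      have "norm ((1 - \<rho> n / real n) ^ n - (1 + (- z) / real n) ^ n)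
          \<le> real n * norm ((1 - \<rho> n / real n) - (1 + (- z) / real n))"
        using elim assms(2) assms(3)[of n] by (intro norm_power_diff) (auto simp: abs_le_iff divide_le_eq)
      also have "(1 - \<rho> n / real n) - (1 + (- z) / real n) = (z - \<rho> n) / real n"
        by (simp add: diff_divide_distrib)
      also have "real n * norm ((z - \<rho> n) / real n) = \<bar>\<rho> n - z\<bar>"
        using elim by (simp add: abs_divide abs_minus_commute)
      finally show ?case .
    qed
  qed
  from tendsto_add[OF this lim] show ?thesis by simp
qed

section \<open>Characteristic function of the projection\<close>

context ustat_sample
begin

lemma char_hajek_sum:
  "char (distr M borel (\<lambda>\<omega>. \<Sum>i\<in>{1..n}. c * g (Y i \<omega>))) u = char (distr D borel (\<lambda>x. c * g x)) u ^ n"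
proof -
  have "indep_vars (\<lambda>_. borel) (\<lambda>i \<omega>. c * g (Y i \<omega>)) {1..n}"
    by (rule indep_vars_compose2[OF indep_vars_subset[OF indep]]) auto
  then have "char (distr M borel (\<lambda>\<omega>. \<Sum>i\<in>{1..n}. c * g (Y i \<omega>))) u
      = (\<Prod>i\<in>{1..n}. char (distr M borel (\<lambda>\<omega>. c * g (Y i \<omega>))) u)"
    by (rule char_distr_sum)
  also have "\<dots> = (\<Prod>i\<in>{1..n}. char (distr D borel (\<lambda>x. c * g x)) u)"
  proof (intro prod.cong refl)
    fix i assume i: "i \<in> {1..n}"
    have "distr D borel (\<lambda>x. c * g x) = distr M borel ((\<lambda>x. c * g x) \<circ> Y i)"
      using i ident[of i] distr_distr[of "\<lambda>x. c * g x" N borel "Y i" M] Y_meas[of i] by simp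
    then show "char (distr M borel (\<lambda>\<omega>. c * g (Y i \<omega>))) u = char (distr D borel (\<lambda>x. c * g x)) u"
      by (simp add: comp_def)
  qed
  finally show ?thesis by simp
qed

text \<open>Second-order Taylor expansion for a centred variable; in the minimum of the remainder
  the cubic term is kept and the factor \<open>1 / 6\<close> is given away. With \<open>c\<close> of
  order \<open>1 / sqrt n\<close>, the error remains negligible when multiplied by
  \<open>n\<close>.\<close>

lemma char_hajek_approx:
  "cmod (char (distr D borel (\<lambda>x. c * g x)) u - (1 - u\<^sup>2 * (c\<^sup>2 * (\<integral>x. (g x)\<^sup>2 \<partial>D)) / 2)) \<le> K * \<bar>u * c\<bar> ^ 3"
proof -
  let ?X = "\<lambda>x. c * g x"
  have g2': "integrable D (\<lambda>x. (g x)\<^sup>2)" using g2 by (auto simp: sq_bound_def)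
  have mean: "(\<integral>x. ?X x \<partial>D) = 0" using g_mean by simp
  have i3: "integrable D (\<lambda>x. \<bar>u\<bar> * \<bar>c * g x\<bar> ^ 3)" using g3(1) by (simp add: abs_mult power_mult_distrib)
  have im: "integrable D (\<lambda>x. min (6 * (?X x)\<^sup>2) (\<bar>u\<bar> * \<bar>?X x\<bar> ^ 3))"
    by (rule Bochner_Integration.integrable_bound[OF i3]) auto
  have "cmod (char (distr D borel ?X) u - (1 - u\<^sup>2 * (c\<^sup>2 * (\<integral>x. (g x)\<^sup>2 \<partial>D)) / 2))
     \<le> (u\<^sup>2 / 6) * (\<integral>x. min (6 * (?X x)\<^sup>2) (\<bar>u\<bar> * \<bar>?X x\<bar> ^ 3) \<partial>D)"
    using g_int g2' mean
    by (intro D.char_approx3') (simp_all add: power_mult_distrib g_mean)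
  also have "\<dots> \<le> u\<^sup>2 * (\<integral>x. \<bar>u\<bar> * \<bar>c * g x\<bar> ^ 3 \<partial>D)"
  proof (rule mult_mono)
    show "(\<integral>x. min (6 * (?X x)\<^sup>2) (\<bar>u\<bar> * \<bar>?X x\<bar> ^ 3) \<partial>D) \<le> (\<integral>x. \<bar>u\<bar> * \<bar>c * g x\<bar> ^ 3 \<partial>D)"
      by (intro integral_mono im i3) simp
    show "0 \<le> (\<integral>x. min (6 * (?X x)\<^sup>2) (\<bar>u\<bar> * \<bar>?X x\<bar> ^ 3) \<partial>D)"
      by (intro Bochner_Integration.integral_nonneg) simp
  qed auto
  also have "\<dots> = (\<integral>x. \<bar>u * c\<bar> ^ 3 * \<bar>g x\<bar> ^ 3 \<partial>D)"
  proof -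
    have "u\<^sup>2 * (\<bar>u\<bar> * \<bar>c * y\<bar> ^ 3) = \<bar>u * c\<bar> ^ 3 * \<bar>y\<bar> ^ 3" for y
      unfolding power2_abs[symmetric, of u] abs_mult by algebra
    then show ?thesis unfolding integral_mult_right_zero[symmetric] by simp
  qed
  also have "\<dots> = \<bar>u * c\<bar> ^ 3 * (\<integral>x. \<bar>g x\<bar> ^ 3 \<partial>D)" by simp
  also have "\<dots> \<le> K * \<bar>u * c\<bar> ^ 3"
    using mult_left_mono[OF g3(2), of "\<bar>u * c\<bar> ^ 3"] by (simp add: mult.commute)
  finally show ?thesis .
qed

end

text \<open>The joint law of different rows is left open, as all conclusions concern single rows.
  What links the rows is the common constant \<open>C\<close> and the convergence of the
  variances.\<close>

locale ustat_array = prob_space M for M :: "'a measure" +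
  fixes N :: "'y measure" and Y :: "nat \<Rightarrow> nat \<Rightarrow> 'a \<Rightarrow> 'y" and D :: "nat \<Rightarrow> 'y measure"
    and h :: "'y \<Rightarrow> 'y \<Rightarrow> real" and C \<sigma> :: real
  assumes rows: "\<forall>\<^sub>F n in sequentially. ustat_sample M N (Y n) (D n) h C"
    and \<sigma>: "0 < \<sigma>" and var: "(\<lambda>n. 4 * (\<integral>x. (hajek (D n) h x)\<^sup>2 \<partial>D n)) \<longlonglongrightarrow> \<sigma>\<^sup>2"
begin

definition "U n \<omega> = ustat h (\<lambda>i. Y n i \<omega>) {1..n}"
definition "V n \<omega> = sqrt (jackknife_var h (\<lambda>i. Y n i \<omega>) n)"
definition "Z n \<omega> = 2 / sqrt (real n) * (\<Sum>i\<in>{1..n}. hajek (D n) h (Y n i \<omega>))"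

abbreviation "\<theta>' n \<equiv> kernel_mean (D n) h"
abbreviation "\<zeta>' n \<equiv> \<integral>x. (hajek (D n) h x)\<^sup>2 \<partial>D n"
abbreviation "K' \<equiv> 1 + 16 * C"

text \<open>\<open>K\<close> depends on \<open>C\<close> alone, so one constant serves every row;
  three points are the minimum for the jackknife identities.\<close>

lemma rows_K: "\<forall>\<^sub>F n in sequentially. ustat_sample M N (Y n) (D n) h C \<and> ustat_sample.K C = K' \<and> 2 < n"
  using rows eventually_gt_at_top[of 2] by eventually_elim (simp add: ustat_sample.K_def)

lemma over_n: "(\<lambda>n. c / (real n - 1)) \<longlonglongrightarrow> 0" "(\<lambda>n. c / real n) \<longlonglongrightarrow> 0"
  by real_asymp+

lemma U_conv: "conv_prob M (\<lambda>n \<omega>. U n \<omega> - \<theta>' n)"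
proof (rule conv_prob_sq_bound)
  show "\<forall>\<^sub>F n in sequentially. sq_bound M (\<lambda>\<omega>. U n \<omega> - \<theta>' n) (48 * K' / (real n - 1))"
    using rows_K
  proof eventually_elim
    case (elim n)
    then interpret ustat_sample M N "Y n" "D n" h C by blast
    show ?case using ustat_bound[of n] elim by (simp add: U_def)
  qed
qed (rule over_n)

lemma Z_conv: "conv_prob M (\<lambda>n \<omega>. sqrt (real n) * (U n \<omega> - \<theta>' n) - Z n \<omega>)"
proof (rule conv_prob_sq_bound)
  show "\<forall>\<^sub>F n in sequentially. sq_bound M (\<lambda>\<omega>. sqrt (real n) * (U n \<omega> - \<theta>' n) - Z n \<omega>) (20 * K' / (real n - 1))"
    using rows_K
  proof eventually_elim
    case (elim n)
    then interpret ustat_sample M N "Y n" "D n" h C by blast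
    have n: "0 < real n" using elim by simp
    have "sq_bound M (\<lambda>\<omega>. sqrt (real n) * (U n \<omega> - \<theta>' n - 2 / real n * (\<Sum>i\<in>{1..n}. hajek (D n) h (Y n i \<omega>))))
        ((sqrt (real n))\<^sup>2 * (20 * (1 + 16 * C) / (real n * (real n - 1))))"
      using sq_bound_cmult[OF hajek_remainder[of n], of "sqrt (real n)"] elim by (simp add: U_def)
    moreover have "sqrt (real n) * (U n \<omega> - \<theta>' n - 2 / real n * S) = sqrt (real n) * (U n \<omega> - \<theta>' n) - 2 / sqrt (real n) * S"
      for \<omega> S
    proof -
      have "sqrt (real n) * (2 / real n) = 2 / sqrt (real n)"
        using n by (simp add: field_simps)
      then show ?thesis by (simp only: right_diff_distrib mult.assoc[symmetric])
    qed
    moreover have "(sqrt (real n))\<^sup>2 * (20 * (1 + 16 * C) / (real n * (real n - 1))) = 20 * (1 + 16 * C) / (real n - 1)"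
      using n by simp
    ultimately show ?case by (simp add: Z_def)
  qed
qed (rule over_n)

text \<open>\<open>V n\<close> equals \<open>c n * A n\<close>, where \<open>A\<close> is close to
  \<open>G\<close> by the row mean bound and the square of \<open>G\<close> is close to
  \<open>\<sigma>\<^sup>2 / 4\<close> by the law of large numbers. The limit \<open>\<sigma>\<close>
  arises as \<open>2 * (\<sigma> / 2)\<close>.\<close>

lemma V_conv: "conv_prob M (\<lambda>n \<omega>. V n \<omega> - \<sigma>)"
proof -
  define A where "A n \<omega> = L2_set (\<lambda>i. row_mean h (\<lambda>i. Y n i \<omega>) n i - U n \<omega>) {1..n} / sqrt (real n)" for n \<omega>
  define G where "G n \<omega> = L2_set (\<lambda>i. hajek (D n) h (Y n i \<omega>)) {1..n} / sqrt (real n)" for n \<omega>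
  define c where "c n = 2 * sqrt (real n * (real n - 1)) / (real n - 2)" for n
  have c: "c \<longlonglongrightarrow> 2" unfolding c_def by real_asymp
  have AG: "conv_prob M (\<lambda>n \<omega>. A n \<omega> - G n \<omega>)"
  proof (rule conv_prob_sq_bound)
    show "\<forall>\<^sub>F n in sequentially. sq_bound M (\<lambda>\<omega>. A n \<omega> - G n \<omega>) (104 * K' / (real n - 1))"
      using rows_K
    proof eventually_elim
      case (elim n)
      then interpret ustat_sample M N "Y n" "D n" h C by blast
      show ?case using row_mean_bound[of n] elim by (simp add: A_def G_def U_def)
    qed
  qed (rule over_n)
  have sq: "conv_prob M (\<lambda>n \<omega>. (G n \<omega>)\<^sup>2 - \<zeta>' n)"
  proof (rule conv_prob_sq_bound)
    show "\<forall>\<^sub>F n in sequentially. sq_bound M (\<lambda>\<omega>. (G n \<omega>)\<^sup>2 - \<zeta>' n) (K' / real n)"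
      using rows_K
    proof eventually_elim
      case (elim n)
      then interpret ustat_sample M N "Y n" "D n" h C by blast
      have "(G n \<omega>)\<^sup>2 = (\<Sum>i\<in>{1..n}. (hajek (D n) h (Y n i \<omega>))\<^sup>2) / real n" for \<omega>
        by (simp add: G_def power_divide L2_set_def sum_nonneg)
      then show ?case using hajek_square_mean[of n] elim by simp
    qed
  qed (rule over_n)
  have "(\<lambda>n. \<zeta>' n - \<sigma>\<^sup>2 / 4) \<longlonglongrightarrow> 0"
    using tendsto_divide[OF var tendsto_const[of 4]] by (simp add: LIM_zero)
  from conv_prob_add[OF sq conv_prob_const[OF this]]
  have sq': "conv_prob M (\<lambda>n \<omega>. (G n \<omega>)\<^sup>2 - \<sigma>\<^sup>2 / 4)" by simp
  have G: "conv_prob M (\<lambda>n \<omega>. G n \<omega> - \<sigma> / 2)"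
  \<comment> \<open>The difference of squares factors, and
    \<open>G n \<omega> + \<sigma> / 2 \<ge> \<sigma> / 2 > 0\<close>; positivity of
    \<open>\<sigma>\<close> turns closeness of the squares into closeness of the roots.\<close>
  proof (rule conv_prob_dominated[OF sq', of "2 / \<sigma>"])
    show "\<forall>\<^sub>F n in sequentially. (\<lambda>\<omega>. G n \<omega> - \<sigma> / 2) \<in> borel_measurable M \<and>
        (\<forall>\<omega>\<in>space M. \<bar>G n \<omega> - \<sigma> / 2\<bar> \<le> 2 / \<sigma> * \<bar>(G n \<omega>)\<^sup>2 - \<sigma>\<^sup>2 / 4\<bar>)"
      using rows
    proof eventually_elim
      case (elim n)
      then interpret ustat_sample M N "Y n" "D n" h C .
      have m: "(\<lambda>\<omega>. G n \<omega>) \<in> borel_measurable M" unfolding G_def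
        by (intro borel_measurable_divide borel_measurable_L2_set borel_measurable_const
            measurable_compose[OF Y_meas g_meas]) simp
      have "\<bar>G n \<omega> - \<sigma> / 2\<bar> \<le> 2 / \<sigma> * \<bar>(G n \<omega>)\<^sup>2 - \<sigma>\<^sup>2 / 4\<bar>" for \<omega>
      proof -
        have G0: "0 \<le> G n \<omega>" by (simp add: G_def)
        have "(G n \<omega>)\<^sup>2 - \<sigma>\<^sup>2 / 4 = (G n \<omega> - \<sigma> / 2) * (G n \<omega> + \<sigma> / 2)"
          by (simp add: power2_eq_square algebra_simps)
        then have "\<bar>(G n \<omega>)\<^sup>2 - \<sigma>\<^sup>2 / 4\<bar> = \<bar>G n \<omega> - \<sigma> / 2\<bar> * (G n \<omega> + \<sigma> / 2)"
          using G0 \<sigma> by (simp add: abs_mult)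
        moreover have "\<bar>G n \<omega> - \<sigma> / 2\<bar> * (\<sigma> / 2) \<le> \<bar>G n \<omega> - \<sigma> / 2\<bar> * (G n \<omega> + \<sigma> / 2)"
          using G0 by (intro mult_left_mono) auto
        ultimately have "\<bar>G n \<omega> - \<sigma> / 2\<bar> * (\<sigma> / 2) \<le> \<bar>(G n \<omega>)\<^sup>2 - \<sigma>\<^sup>2 / 4\<bar>" by simp
        then show ?thesis using \<sigma> by (simp add: field_simps)
      qed
      with m show ?case by simp
    qed
  qed (use \<sigma> in simp)
  \<comment> \<open>The error made by replacing the factor \<open>c n\<close> by its limit.\<close>
  have "(\<lambda>n. (c n - 2) * (\<sigma> / 2)) \<longlonglongrightarrow> 0"
    using tendsto_mult[OF LIM_zero[OF c] tendsto_const] by simp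
  from conv_prob_add[OF conv_prob_mult[OF conv_prob_add[OF AG G] c] conv_prob_const[OF this]]
  have "conv_prob M (\<lambda>n \<omega>. c n * (A n \<omega> - G n \<omega> + (G n \<omega> - \<sigma> / 2)) + (c n - 2) * (\<sigma> / 2))" .
  then show ?thesis
  proof (rule conv_prob_cong)
    show "\<forall>\<^sub>F n in sequentially. \<forall>\<omega>\<in>space M.
        c n * (A n \<omega> - G n \<omega> + (G n \<omega> - \<sigma> / 2)) + (c n - 2) * (\<sigma> / 2) = V n \<omega> - \<sigma>"
      using rows_K
    proof eventually_elim
      case (elim n)
      then interpret ustat_sample M N "Y n" "D n" h C by blast
      show ?case
      proof
        fix \<omega> assume "\<omega> \<in> space M"
        then have "V n \<omega> = c n * A n \<omega>"
          unfolding V_def c_def A_def U_def using elim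
          by (intro sqrt_jackknife_var h_sym measurable_space[OF Y_meas]) auto
        then show "c n * (A n \<omega> - G n \<omega> + (G n \<omega> - \<sigma> / 2)) + (c n - 2) * (\<sigma> / 2) = V n \<omega> - \<sigma>"
          by (simp add: algebra_simps)
      qed
    qed
  qed
qed

lemma Z_measurable: "\<forall>\<^sub>F n in sequentially. Z n \<in> borel_measurable M"
  using rows
proof eventually_elim
  case (elim n)
  then interpret ustat_sample M N "Y n" "D n" h C .
  show ?case unfolding Z_def[abs_def]
    by (intro borel_measurable_times borel_measurable_const borel_measurable_sum
        measurable_compose[OF Y_meas g_meas]) simp
qed

text \<open>The characteristic function of \<open>Z n / \<sigma>\<close> is an \<open>n\<close>-th
  power. Its base differs from \<open>1 - \<rho> n / n\<close> by the Taylor error, so the powers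
  differ by at most \<open>n\<close> times that, which is of order \<open>1 / sqrt n\<close>;
  \<open>power_tendsto_exp\<close> handles the rest.\<close>

lemma Z_char: "(\<lambda>n. char (distr M borel (\<lambda>\<omega>. Z n \<omega> / \<sigma>)) u) \<longlonglongrightarrow> char std_normal_distribution u"
proof -
  \<comment> \<open>\<open>c n\<close> scales one summand of \<open>Z n / \<sigma>\<close>;
    \<open>\<rho> n / n\<close> is half of \<open>u\<^sup>2\<close> times the variance of that
    summand.\<close>
  define c where "c n = 2 / (\<sigma> * sqrt (real n))" for n
  define \<rho> where "\<rho> n = u\<^sup>2 / 2 * (4 * \<zeta>' n / \<sigma>\<^sup>2)" for n
  have \<rho>: "\<rho> \<longlonglongrightarrow> u\<^sup>2 / 2"
    using tendsto_mult[OF tendsto_const[of "u\<^sup>2 / 2"] tendsto_divide[OF var tendsto_const[of "\<sigma>\<^sup>2"]]] \<sigma>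
    by (simp add: \<rho>_def[abs_def])
  have \<rho>0: "0 \<le> \<rho> n" for n by (simp add: \<rho>_def)
  have lim: "(\<lambda>n. complex_of_real ((1 - \<rho> n / real n) ^ n)) \<longlonglongrightarrow> char std_normal_distribution u"
    unfolding char_std_normal_distribution
    using power_tendsto_exp[OF \<rho> _ \<rho>0] by (intro tendsto_of_real) simp
  have "(\<lambda>n. char (distr M borel (\<lambda>\<omega>. Z n \<omega> / \<sigma>)) u - complex_of_real ((1 - \<rho> n / real n) ^ n)) \<longlonglongrightarrow> 0"
  proof (rule Lim_null_comparison)
    show "(\<lambda>n. K' * (2 * \<bar>u\<bar> / \<sigma>) ^ 3 * (1 / sqrt (real n))) \<longlonglongrightarrow> 0"
      by (rule tendsto_mult_right_zero) real_asymp
    have "\<forall>\<^sub>F n in sequentially. \<rho> n < u\<^sup>2 / 2 + 1" using \<rho> by (rule order_tendstoD) simp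
    moreover have "\<forall>\<^sub>F n in sequentially. u\<^sup>2 / 2 + 1 \<le> real n"
      using filterlim_real_sequentially by (simp add: filterlim_at_top)
    ultimately show "\<forall>\<^sub>F n in sequentially. norm (char (distr M borel (\<lambda>\<omega>. Z n \<omega> / \<sigma>)) u - complex_of_real ((1 - \<rho> n / real n) ^ n))
        \<le> K' * (2 * \<bar>u\<bar> / \<sigma>) ^ 3 * (1 / sqrt (real n))"
      using rows_K
    proof eventually_elim
      case (elim n)
      then interpret ustat_sample M N "Y n" "D n" h C by blast
      interpret E: real_distribution "distr (D n) borel (\<lambda>x. c n * hajek (D n) h x)"
        by (rule D.real_distribution_distr) simp
      have n: "0 < real n" "0 < sqrt (real n)" using elim by auto
      have Z: "Z n \<omega> / \<sigma> = (\<Sum>i\<in>{1..n}. c n * hajek (D n) h (Y n i \<omega>))" for \<omega>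
        by (simp add: Z_def c_def sum_distrib_left sum_divide_distrib mult.commute)
      have c2: "u\<^sup>2 * ((c n)\<^sup>2 * \<zeta>' n) / 2 = \<rho> n / real n"
        using n by (simp add: c_def \<rho>_def power_divide power_mult_distrib)
      have c3: "real n * (K' * \<bar>u * c n\<bar> ^ 3) = K' * (2 * \<bar>u\<bar> / \<sigma>) ^ 3 * (1 / sqrt (real n))"
      proof -
        have eq: "\<bar>u * c n\<bar> = 2 * \<bar>u\<bar> / \<sigma> * (1 / sqrt (real n))"
          using n \<sigma> by (simp add: c_def abs_mult)
        have "real n * (K' * \<bar>u * c n\<bar> ^ 3) = K' * (2 * \<bar>u\<bar> / \<sigma>) ^ 3 * (real n * (1 / sqrt (real n)) ^ 3)"
          unfolding eq power_mult_distrib by (simp only: mult_ac)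
        also have "real n * (1 / sqrt (real n)) ^ 3 = 1 / sqrt (real n)"
          using n by (simp add: power3_eq_cube field_simps)
        finally show ?thesis .
      qed
      have "norm (char (distr M borel (\<lambda>\<omega>. Z n \<omega> / \<sigma>)) u - complex_of_real ((1 - \<rho> n / real n) ^ n))
         = norm (char (distr (D n) borel (\<lambda>x. c n * hajek (D n) h x)) u ^ n - complex_of_real (1 - \<rho> n / real n) ^ n)"
        unfolding Z char_hajek_sum by simp
      also have "\<dots> \<le> real n * norm (char (distr (D n) borel (\<lambda>x. c n * hajek (D n) h x)) u - complex_of_real (1 - \<rho> n / real n))"
      proof (rule norm_power_diff)
        show "norm (char (distr (D n) borel (\<lambda>x. c n * hajek (D n) h x)) u) \<le> 1" by (rule E.cmod_char_le_1)
        have "0 \<le> \<rho> n / real n" "\<rho> n / real n \<le> 1" using elim n \<rho>0[of n] by (auto simp: divide_le_eq)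
        then show "norm (complex_of_real (1 - \<rho> n / real n)) \<le> 1" unfolding norm_of_real by linarith
      qed
      also have "\<dots> \<le> real n * (K' * \<bar>u * c n\<bar> ^ 3)"
        using char_hajek_approx[of "c n" u] elim unfolding c2 by (intro mult_left_mono) auto
      finally show ?case unfolding c3 .
    qed
  qed
  from tendsto_add[OF this lim] show ?thesis by simp
qed

lemma Z_weak: "(\<lambda>n. prob {\<omega> \<in> space M. Z n \<omega> \<le> x}) \<longlonglongrightarrow> cdf std_normal_distribution (x / \<sigma>)"
proof -
  \<comment> \<open>Levy's theorem wants a distribution for every index, while \<open>Z n\<close> is
    known to be measurable only for large \<open>n\<close>; the other terms are filled with the
    limit law.\<close>
  define Q where "Q n = (if Z n \<in> borel_measurable M then distr M borel (\<lambda>\<omega>. Z n \<omega> / \<sigma>) else std_normal_distribution)" for n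
  have Q: "real_distribution (Q n)" for n
    by (auto simp: Q_def real_dist_normal_dist intro!: real_distribution_distr)
  have "weak_conv_m Q std_normal_distribution"
  proof (rule levy_continuity[OF Q real_dist_normal_dist])
    fix u
    show "(\<lambda>n. char (Q n) u) \<longlonglongrightarrow> char std_normal_distribution u"
      using Z_char[of u]
    proof (rule Lim_transform_eventually)
      show "\<forall>\<^sub>F n in sequentially. char (distr M borel (\<lambda>\<omega>. Z n \<omega> / \<sigma>)) u = char (Q n) u"
        using Z_measurable by eventually_elim (simp add: Q_def)
    qed
  qed
  then have "(\<lambda>n. cdf (Q n) (x / \<sigma>)) \<longlonglongrightarrow> cdf std_normal_distribution (x / \<sigma>)"
    using isCont_cdf_std_normal by (simp add: weak_conv_m_def weak_conv_def)
  then show ?thesis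
  proof (rule Lim_transform_eventually)
    show "\<forall>\<^sub>F n in sequentially. cdf (Q n) (x / \<sigma>) = prob {\<omega> \<in> space M. Z n \<omega> \<le> x}"
      using Z_measurable
    proof eventually_elim
      case (elim n)
      have "(\<lambda>\<omega>. Z n \<omega> / \<sigma>) -` {..x / \<sigma>} \<inter> space M = {\<omega> \<in> space M. Z n \<omega> \<le> x}"
        using \<sigma> by (auto simp: divide_le_cancel)
      with elim show ?case by (simp add: Q_def cdf_def measure_distr)
    qed
  qed
qed

end

section \<open>Limits of the rejection probability\<close>

context ustat_array
begin

lemma rejects_iff: "rejects h (\<lambda>i. Y n i \<omega>) n \<tau> \<longleftrightarrow> V n \<omega> / sqrt (real n) * \<tau> < U n \<omega>"
  by (simp add: rejects_def U_def V_def)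

text \<open>Rejection compares \<open>sqrt n * U\<close> with the random threshold
  \<open>V * \<tau>\<close>. Moving the fluctuation of \<open>V\<close> to the other side leaves the
  fixed threshold \<open>\<sigma> * \<tau>\<close>, as Slutsky's theorem requires.\<close>

lemma rejection_boundary:
  assumes "(\<lambda>n. sqrt (real n) * \<theta>' n) \<longlonglongrightarrow> 0"
  shows "(\<lambda>n. prob {\<omega> \<in> space M. rejects h (\<lambda>i. Y n i \<omega>) n \<tau>})
    \<longlonglongrightarrow> 1 - cdf std_normal_distribution \<tau>"
proof -
  \<comment> \<open>Chosen so that \<open>Z n + e n\<close> is exactly
    \<open>sqrt n * U n - V n * \<tau> + \<sigma> * \<tau>\<close>. Its three parts are the
    projection error, the bias, and the fluctuation of \<open>V\<close>.\<close>
  define e where "e n \<omega> = sqrt (real n) * (U n \<omega> - \<theta>' n) - Z n \<omega> + sqrt (real n) * \<theta>' n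
      + (- \<tau>) * (V n \<omega> - \<sigma>)" for n \<omega>
  have e: "conv_prob M e"
    unfolding e_def[abs_def]
    by (intro conv_prob_add Z_conv conv_prob_const[OF assms] conv_prob_mult[OF V_conv tendsto_const])
  have "isCont (\<lambda>x. cdf std_normal_distribution (x / \<sigma>)) (\<sigma> * \<tau>)"
    using \<sigma> by (intro isCont_o2[OF _ isCont_cdf_std_normal] continuous_intros) simp
  from slutsky[OF Z_weak Z_measurable e this] \<sigma>
  have "(\<lambda>n. prob {\<omega> \<in> space M. Z n \<omega> + e n \<omega> \<le> \<sigma> * \<tau>}) \<longlonglongrightarrow> cdf std_normal_distribution \<tau>"
    by simp
  then have "(\<lambda>n. 1 - prob {\<omega> \<in> space M. Z n \<omega> + e n \<omega> \<le> \<sigma> * \<tau>}) \<longlonglongrightarrow> 1 - cdf std_normal_distribution \<tau>"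
    by (intro tendsto_diff tendsto_const)
  then show ?thesis
  proof (rule Lim_transform_eventually)
    show "\<forall>\<^sub>F n in sequentially. 1 - prob {\<omega> \<in> space M. Z n \<omega> + e n \<omega> \<le> \<sigma> * \<tau>}
        = prob {\<omega> \<in> space M. rejects h (\<lambda>i. Y n i \<omega>) n \<tau>}"
      using Z_measurable conv_prob_measurable[OF e] eventually_gt_at_top[of 0]
    proof eventually_elim
      case (elim n)
      have s: "0 < sqrt (real n)" using elim by simp
      have "Z n \<omega> + e n \<omega> \<le> \<sigma> * \<tau> \<longleftrightarrow> \<not> rejects h (\<lambda>i. Y n i \<omega>) n \<tau>" for \<omega>
      proof -
        have "Z n \<omega> + e n \<omega> = sqrt (real n) * U n \<omega> - V n \<omega> * \<tau> + \<sigma> * \<tau>"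
          by (simp add: e_def algebra_simps)
        moreover have "V n \<omega> / sqrt (real n) * \<tau> < U n \<omega> \<longleftrightarrow> V n \<omega> * \<tau> < sqrt (real n) * U n \<omega>"
          using s by (simp add: divide_less_eq mult.commute)
        ultimately show ?thesis unfolding rejects_iff by auto
      qed
      then have "{\<omega> \<in> space M. rejects h (\<lambda>i. Y n i \<omega>) n \<tau>} = space M - {\<omega> \<in> space M. Z n \<omega> + e n \<omega> \<le> \<sigma> * \<tau>}"
        by auto
      moreover have "{\<omega> \<in> space M. Z n \<omega> + e n \<omega> \<le> \<sigma> * \<tau>} \<in> events" using elim by simp
      ultimately show ?case by (simp add: prob_compl)
    qed
  qed
qed

lemma margin_conv:
  assumes "\<theta>' \<longlonglongrightarrow> \<mu>"
  shows "conv_prob M (\<lambda>n \<omega>. U n \<omega> - V n \<omega> / sqrt (real n) * \<tau> - \<mu>)"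
proof -
  have s: "(\<lambda>n. - \<tau> / sqrt (real n)) \<longlonglongrightarrow> 0" by real_asymp
  have "(\<lambda>n. (\<theta>' n - \<mu>) + (- \<tau> / sqrt (real n)) * \<sigma>) \<longlonglongrightarrow> 0"
    using tendsto_add[OF LIM_zero[OF assms] tendsto_mult[OF s tendsto_const[of \<sigma>]]] by simp
  from conv_prob_add[OF conv_prob_add[OF U_conv conv_prob_mult[OF V_conv s]] conv_prob_const[OF this]]
  show ?thesis by (rule conv_prob_cong) (simp add: algebra_simps)
qed

text \<open>Rejection means that \<open>?W\<close> exceeds \<open>- \<mu>\<close>, a fixed positive
  number, whereas \<open>?W\<close> tends to 0 in probability.\<close>

lemma rejection_null:
  assumes "\<theta>' \<longlonglongrightarrow> \<mu>" "\<mu> < 0"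
  shows "(\<lambda>n. prob {\<omega> \<in> space M. rejects h (\<lambda>i. Y n i \<omega>) n \<tau>}) \<longlonglongrightarrow> 0"
proof (rule tendsto_sandwich[OF _ _ tendsto_const])
  let ?W = "\<lambda>n \<omega>. U n \<omega> - V n \<omega> / sqrt (real n) * \<tau> - \<mu>"
  note conv = margin_conv[OF assms(1), of \<tau>]
  show "(\<lambda>n. prob {\<omega> \<in> space M. - \<mu> \<le> \<bar>?W n \<omega>\<bar>}) \<longlonglongrightarrow> 0"
    using conv assms(2) by (intro conv_probD) auto
  show "\<forall>\<^sub>F n in sequentially. prob {\<omega> \<in> space M. rejects h (\<lambda>i. Y n i \<omega>) n \<tau>}
      \<le> prob {\<omega> \<in> space M. - \<mu> \<le> \<bar>?W n \<omega>\<bar>}"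
    using conv_prob_measurable[OF conv]
  proof eventually_elim
    case (elim n)
    then have "{\<omega> \<in> space M. - \<mu> \<le> \<bar>?W n \<omega>\<bar>} \<in> events" by (intro borel_measurable_le borel_measurable_abs) auto
    then show ?case using assms(2) by (intro finite_measure_mono) (auto simp: rejects_iff)
  qed
qed auto

text \<open>Here rejection means \<open>- \<mu> < ?W\<close>, which is implied by
  \<open>\<bar>?W\<bar> < \<mu>\<close>.\<close>

lemma rejection_alternative:
  assumes "\<theta>' \<longlonglongrightarrow> \<mu>" "0 < \<mu>"
  shows "(\<lambda>n. prob {\<omega> \<in> space M. rejects h (\<lambda>i. Y n i \<omega>) n \<tau>}) \<longlonglongrightarrow> 1"
proof -
  let ?W = "\<lambda>n \<omega>. U n \<omega> - V n \<omega> / sqrt (real n) * \<tau> - \<mu>"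
  let ?A = "\<lambda>n. {\<omega> \<in> space M. \<mu> \<le> \<bar>?W n \<omega>\<bar>}"
  note conv = margin_conv[OF assms(1), of \<tau>]
  have "(\<lambda>n. 1 - prob (?A n)) \<longlonglongrightarrow> 1 - 0"
    using conv assms(2) by (intro tendsto_diff tendsto_const conv_probD) auto
  then have lim: "(\<lambda>n. 1 - prob (?A n)) \<longlonglongrightarrow> 1" by (simp only: diff_zero)
  show ?thesis
  proof (rule tendsto_sandwich[OF _ _ lim tendsto_const])
    show "\<forall>\<^sub>F n in sequentially. 1 - prob (?A n) \<le> prob {\<omega> \<in> space M. rejects h (\<lambda>i. Y n i \<omega>) n \<tau>}"
      using conv_prob_measurable[OF conv]
    proof eventually_elim
      case (elim n)
      then have A: "?A n \<in> events" by (intro borel_measurable_le borel_measurable_abs) auto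
      have "{\<omega> \<in> space M. rejects h (\<lambda>i. Y n i \<omega>) n \<tau>} = {\<omega> \<in> space M. - \<mu> < ?W n \<omega>}"
        by (auto simp: rejects_iff)
      also have "\<dots> \<in> events" using elim by (intro borel_measurable_less) auto
      finally have R: "{\<omega> \<in> space M. rejects h (\<lambda>i. Y n i \<omega>) n \<tau>} \<in> events" .
      have "1 - prob (?A n) = prob (space M - ?A n)" using A by (simp only: prob_compl)
      also have "\<dots> \<le> prob {\<omega> \<in> space M. rejects h (\<lambda>i. Y n i \<omega>) n \<tau>}"
      proof (rule finite_measure_mono[OF _ R])
        have "x < y" if "\<bar>y - x - \<mu>\<bar> < \<mu>" for x y :: real
          using that by linarith
        then show "space M - ?A n \<subseteq> {\<omega> \<in> space M. rejects h (\<lambda>i. Y n i \<omega>) n \<tau>}"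
          unfolding rejects_iff by (auto simp only: not_le Diff_iff mem_Collect_eq)
      qed
      finally show ?case .
    qed
  qed auto
qed

end

section \<open>The conditional variance in assumption (c), and the assembly\<close>

context ustat_sample
begin

text \<open>By independence, conditioning on \<open>Y 2\<close> integrates out the other argument.
  The candidate is a function of \<open>Y 2\<close>, and its integrals over events generated by
  \<open>Y 2\<close> are checked by Fubini's theorem.\<close>

lemma real_cond_exp_kernel:
  "AE \<omega> in M. real_cond_exp M (vimage_algebra (space M) (Y 2) N) (\<lambda>\<omega>. h (Y 1 \<omega>) (Y 2 \<omega>)) \<omega> = g (Y 2 \<omega>) + \<theta>"
proof -
  let ?F = "vimage_algebra (space M) (Y 2) N"
  have Y2: "Y 2 \<in> space M \<rightarrow> space N" using measurable_space[OF Y_meas[of 2]] by auto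
  have F: "sets ?F = {Y 2 -` A \<inter> space M | A. A \<in> sets N}" by (rule sets_vimage_algebra2[OF Y2])
  have "subalgebra M ?F"
    unfolding subalgebra_def F using measurable_sets[OF Y_meas[of 2]] by auto
  then interpret finite_measure_subalgebra M ?F
    by unfold_locales
  have gm: "(\<lambda>y. g y + \<theta>) \<in> borel_measurable N" by simp
  show ?thesis
  proof (rule real_cond_exp_charact)
    show "integrable M (\<lambda>\<omega>. h (Y 1 \<omega>) (Y 2 \<omega>))"
      using h_int h_meas by (subst integrable_DD_iff) auto
    show "integrable M (\<lambda>\<omega>. g (Y 2 \<omega>) + \<theta>)"
      using g_int gm by (subst integrable_D_iff[OF _ gm]) auto
    show "(\<lambda>\<omega>. g (Y 2 \<omega>) + \<theta>) \<in> borel_measurable ?F"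
      using measurable_compose[OF measurable_vimage_algebra1[OF Y2] gm] by simp
    fix A assume "A \<in> sets ?F"
    then obtain B where B [measurable]: "B \<in> sets N" and A: "A = Y 2 -` B \<inter> space M" unfolding F by auto
    have BD: "B \<in> sets D" using B sets_D by simp
    have m: "(\<lambda>p. indicator B (fst p) * h (fst p) (snd p)) \<in> borel_measurable (N \<Otimes>\<^sub>M N)"
      using h_meas by measurable
    have i: "integrable (D \<Otimes>\<^sub>M D) (\<lambda>p. indicator B (fst p) * h (fst p) (snd p))"
    proof (rule Bochner_Integration.integrable_bound[OF h_int])
      show "(\<lambda>p. indicator B (fst p) * h (fst p) (snd p)) \<in> borel_measurable (D \<Otimes>\<^sub>M D)"
        using h_meas' BD by measurable
    qed (auto simp: indicator_def)
    \<comment> \<open>Symmetry moves \<open>Y 2\<close> into the first slot, because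
      \<open>hajek\<close> integrates over the second argument.\<close>
    have "(\<integral>\<omega>\<in>A. h (Y 1 \<omega>) (Y 2 \<omega>) \<partial>M) = (\<integral>\<omega>. indicator B (Y 2 \<omega>) * h (Y 2 \<omega>) (Y 1 \<omega>) \<partial>M)"
      unfolding set_lebesgue_integral_def A
      by (intro Bochner_Integration.integral_cong refl)
         (auto simp: indicator_def intro!: h_sym measurable_space[OF Y_meas])
    also have "\<dots> = (\<integral>p. indicator B (fst p) * h (fst p) (snd p) \<partial>(D \<Otimes>\<^sub>M D))"
      using m by (intro integral_DD[where f="\<lambda>x y. indicator B x * h x y"]) auto
    also have "\<dots> = (\<integral>x. (\<integral>y. indicator B x * h x y \<partial>D) \<partial>D)"
      using DD.integral_fst'[OF i] by simp
    also have "\<dots> = (\<integral>x. indicator B x * (g x + \<theta>) \<partial>D)"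
      by (simp add: hajek_def)
    also have "\<dots> = (\<integral>\<omega>. indicator B (Y 2 \<omega>) * (g (Y 2 \<omega>) + \<theta>) \<partial>M)"
      by (rule integral_D[symmetric]) (use gm in measurable)
    also have "\<dots> = (\<integral>\<omega>\<in>A. g (Y 2 \<omega>) + \<theta> \<partial>M)"
      unfolding set_lebesgue_integral_def A
      by (intro Bochner_Integration.integral_cong refl) (auto simp: indicator_def)
    finally show "(\<integral>\<omega>\<in>A. h (Y 1 \<omega>) (Y 2 \<omega>) \<partial>M) = (\<integral>\<omega>\<in>A. g (Y 2 \<omega>) + \<theta> \<partial>M)" .
  qed
qed

lemma variance_cond_exp_kernel:
  "variance (real_cond_exp M (vimage_algebra (space M) (Y 2) N) (\<lambda>\<omega>. h (Y 1 \<omega>) (Y 2 \<omega>))) = (\<integral>x. (g x)\<^sup>2 \<partial>D)"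
proof -
  let ?X = "real_cond_exp M (vimage_algebra (space M) (Y 2) N) (\<lambda>\<omega>. h (Y 1 \<omega>) (Y 2 \<omega>))"
  have [measurable]: "?X \<in> borel_measurable M"
    by simp
  have [measurable]: "(\<lambda>\<omega>. g (Y 2 \<omega>)) \<in> borel_measurable M" by simp
  have "expectation ?X = expectation (\<lambda>\<omega>. g (Y 2 \<omega>) + \<theta>)"
    using real_cond_exp_kernel by (intro integral_cong_AE) auto
  also have "\<dots> = (\<integral>x. g x + \<theta> \<partial>D)"
    by (rule integral_D) auto
  also have "\<dots> = \<theta>" using g_int g_mean by (simp add: D.prob_space)
  finally have e: "expectation ?X = \<theta>" .
  have "expectation (\<lambda>\<omega>. (?X \<omega> - \<theta>)\<^sup>2) = expectation (\<lambda>\<omega>. (g (Y 2 \<omega>))\<^sup>2)"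
    using real_cond_exp_kernel by (intro integral_cong_AE) (auto elim: eventually_mono)
  also have "\<dots> = (\<integral>x. (g x)\<^sup>2 \<partial>D)"
    by (rule integral_D) auto
  finally show ?thesis unfolding e .
qed

end

text \<open>A finite nonnegative integral gives integrability as well as the bound; both then pass
  from the sample to the product law.\<close>

lemma (in iid_sample) ustat_sampleI:
  assumes h: "(\<lambda>p. h (fst p) (snd p)) \<in> borel_measurable (N \<Otimes>\<^sub>M N)"
    and sym: "\<And>x y. x \<in> space N \<Longrightarrow> y \<in> space N \<Longrightarrow> h x y = h y x"
    and le: "(\<integral>\<^sup>+ \<omega>. ennreal (h (Y 1 \<omega>) (Y 2 \<omega>) ^ 4) \<partial>M) \<le> ennreal C" and C: "0 \<le> C"
  shows "ustat_sample M N Y D h C"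
proof
  have h4: "(\<lambda>p. h (fst p) (snd p) ^ 4) \<in> borel_measurable (N \<Otimes>\<^sub>M N)" using h by simp
  have m: "(\<lambda>\<omega>. h (Y 1 \<omega>) (Y 2 \<omega>) ^ 4) \<in> borel_measurable M"
    by (rule measurable_pair_Y[OF h4]) auto
  have i: "integrable M (\<lambda>\<omega>. h (Y 1 \<omega>) (Y 2 \<omega>) ^ 4)"
    using m le by (intro integrableI_bounded) (auto intro: le_less_trans)
  have "(\<integral>\<omega>. h (Y 1 \<omega>) (Y 2 \<omega>) ^ 4 \<partial>M) = enn2real (\<integral>\<^sup>+ \<omega>. ennreal (h (Y 1 \<omega>) (Y 2 \<omega>) ^ 4) \<partial>M)"
    using m by (intro integral_eq_nn_integral) auto
  also have "\<dots> \<le> C" using le C by (rule enn2real_leI[rotated])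
  finally have "(\<integral>\<omega>. h (Y 1 \<omega>) (Y 2 \<omega>) ^ 4 \<partial>M) \<le> C" .
  with i show "integrable (D \<Otimes>\<^sub>M D) (\<lambda>p. h (fst p) (snd p) ^ 4)"
    "(\<integral>p. h (fst p) (snd p) ^ 4 \<partial>(D \<Otimes>\<^sub>M D)) \<le> C"
    using integrable_DD_iff[of 1 2 "\<lambda>x y. h x y ^ 4"] integral_DD[of 1 2 "\<lambda>x y. h x y ^ 4"] h4 by auto
qed (use h sym in auto)

text \<open>The zero field is admissible in the supremum. Nonnegativity lets the order of the
  discrepancies pass to their squares.\<close>

lemma KSD_nonneg:
  fixes fn :: "'h::{real_inner, complete_space} \<Rightarrow> real ^ 'd::finite \<Rightarrow> real"
  shows "0 \<le> KSD X fn P R"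
  unfolding KSD_def by (rule SUP_upper2[of 0]) auto

theorem mainTheorem3:
  fixes X :: obs_space
    and P :: "(real ^ 'd::finite, 'z::polish_space) lvm"
    and Q :: "(real ^ 'd, 'w::polish_space) lvm"
    and R :: "(real ^ 'd) measure"
    and k :: "real ^ 'd \<Rightarrow> real ^ 'd \<Rightarrow> real"
    and fn :: "'h::{real_inner, complete_space} \<Rightarrow> real ^ 'd \<Rightarrow> real"
    and CP :: "(real ^ 'd, 'z) mcmc"
    and CQ :: "(real ^ 'd, 'w) mcmc"
    and m :: nat
    and M :: "'a measure"
    and Y :: "nat \<Rightarrow> nat \<Rightarrow> 'a \<Rightarrow> (real ^ 'd) \<times> (nat \<Rightarrow> 'z) \<times> (nat \<Rightarrow> 'w)"
    and L :: "nat \<Rightarrow> ((real ^ 'd) \<times> (nat \<Rightarrow> 'z) \<times> (nat \<Rightarrow> 'w)) measure"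
    and \<alpha> \<tau> \<mu> sigma2 :: real
    and \<theta> :: "nat \<Rightarrow> real"
    and N :: "((real ^ 'd) \<times> (nat \<Rightarrow> 'z) \<times> (nat \<Rightarrow> 'w)) measure"
    and h :: "(real ^ 'd) \<times> (nat \<Rightarrow> 'z) \<times> (nat \<Rightarrow> 'w) \<Rightarrow>
              (real ^ 'd) \<times> (nat \<Rightarrow> 'z) \<times> (nat \<Rightarrow> 'w) \<Rightarrow> real"
    and t :: "nat \<Rightarrow> nat"
  defines "N \<equiv> base X \<Otimes>\<^sub>M (latent m \<Otimes>\<^sub>M latent m)"
    and "h \<equiv> Hdiff X k m P Q"
    and "\<theta> \<equiv> \<lambda>s. prob_space.expectation M (\<lambda>\<omega>. h (Y s 1 \<omega>) (Y s 2 \<omega>))"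
    and "\<mu> \<equiv> (real_of_ereal (KSD X fn P R))\<^sup>2 - (real_of_ereal (KSD X fn Q R))\<^sup>2"
    and "\<tau> \<equiv> quantile std_normal_distribution (1 - \<alpha>)"
  assumes X: "admissible X"
    and P: "is_lvm X P"
    and Q: "is_lvm X Q"
    and R: "prob_space R" "sets R = sets (base X)"
    and k: "is_kernel X k"
    and rkhs: "is_rkhs (obs X) k fn"
    and stein_P: "stein_regular X fn P R"
    and stein_Q: "stein_regular X fn Q R"
    and CP: "targets_posterior X P CP"
    and CQ: "targets_posterior X Q CQ"
    and m: "m \<ge> 1"
    and L_P: "\<And>s. s \<ge> 1 \<Longrightarrow>
      distr (L s) (base X \<Otimes>\<^sub>M latent m) (\<lambda>(x, z, w). (x, z)) = joint_draw X R CP m s"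
    and L_Q: "\<And>s. s \<ge> 1 \<Longrightarrow>
      distr (L s) (base X \<Otimes>\<^sub>M latent m) (\<lambda>(x, z, w). (x, w)) = joint_draw X R CQ m s"
    and M: "prob_space M"
    and indep: "\<And>s. s \<ge> 1 \<Longrightarrow> prob_space.indep_vars M (\<lambda>_. N) (Y s) {1..}"
    and ident: "\<And>s i. s \<ge> 1 \<Longrightarrow> i \<ge> 1 \<Longrightarrow> distr M N (Y s i) = L s"
    and a: "limsup (\<lambda>s. \<integral>\<^sup>+ \<omega>. ennreal ((h (Y s 1 \<omega>) (Y s 2 \<omega>)) ^ 4) \<partial>M) < \<infinity>"
    and b: "limsup (\<lambda>s. Lr_norm M 3 (\<lambda>\<omega>. h (Y s 1 \<omega>) (Y s 2 \<omega>) - \<theta> s)) < \<infinity>"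
    and c: "(\<lambda>s. 4 * prob_space.variance M
               (real_cond_exp M (vimage_algebra (space M) (Y s 2) N)
                  (\<lambda>\<omega>. h (Y s 1 \<omega>) (Y s 2 \<omega>)))) \<longlonglongrightarrow> sigma2"
      "sigma2 > 0"
    and d: "\<theta> \<longlonglongrightarrow> \<mu>"
    and \<alpha>: "0 < \<alpha>" "\<alpha> < 1"
    and t: "filterlim t at_top sequentially"
      "(\<lambda>n. sqrt (real n) * (\<theta> (t n) - \<mu>)) \<longlonglongrightarrow> 0"
  shows "(KSD X fn P R \<le> KSD X fn Q R \<longrightarrow>
        (\<exists>l. (\<lambda>n. prob_space.prob M {\<omega> \<in> space M. rejects h (\<lambda>i. Y (t n) i \<omega>) n \<tau>}) \<longlonglongrightarrow> l
             \<and> l \<le> \<alpha>)) \<and>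
    (KSD X fn P R > KSD X fn Q R \<longrightarrow>
        (\<lambda>n. prob_space.prob M {\<omega> \<in> space M. rejects h (\<lambda>i. Y (t n) i \<omega>) n \<tau>}) \<longlonglongrightarrow> 1)"
proof -
  interpret M: prob_space M by (rule M)
  have h: "(\<lambda>p. h (fst p) (snd p)) \<in> borel_measurable (N \<Otimes>\<^sub>M N)"
    using Hdiff_measurable[OF P Q X k, of m] unfolding h_def N_def split_beta .
  have sym: "h x y = h y x" if "x \<in> space N" "y \<in> space N" for x y
    using that unfolding h_def N_def by (rule Hdiff_sym[OF X k])
  \<comment> \<open>A number strictly between the limsup and infinity bounds the fourth moments for
    all large \<open>s\<close>.\<close>
  obtain c where c_lim: "limsup (\<lambda>s. \<integral>\<^sup>+ \<omega>. ennreal ((h (Y s 1 \<omega>) (Y s 2 \<omega>)) ^ 4) \<partial>M) < c" "c < \<infinity>"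
    using dense[OF a] by blast
  define C where "C = enn2real c"
  have C: "c = ennreal C" "0 \<le> C" using c_lim by (auto simp: C_def)
  have sample: "\<forall>\<^sub>F s in sequentially. ustat_sample M N (Y s) (L s) h C"
    \<comment> \<open>Independence and the common law are available only from \<open>s = 1\<close>
      on.\<close>
    using Limsup_lessD[OF c_lim(1)] eventually_ge_at_top[of 1]
  proof eventually_elim
    case (elim s)
    interpret iid_sample M N "Y s" "L s"
      using indep ident elim by unfold_locales auto
    show ?case using elim C by (intro ustat_sampleI h sym) auto
  qed
  have mean: "\<forall>\<^sub>F s in sequentially. kernel_mean (L s) h = \<theta> s"
    using sample
  proof eventually_elim
    case (elim s)
    then interpret ustat_sample M N "Y s" "L s" h C .
    show ?case using integral_DD[of 1 2 h] h by (simp add: \<theta>_def kernel_mean_def)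
  qed
  have var: "\<forall>\<^sub>F s in sequentially. 4 * M.variance (real_cond_exp M (vimage_algebra (space M) (Y s 2) N)
       (\<lambda>\<omega>. h (Y s 1 \<omega>) (Y s 2 \<omega>))) = 4 * (\<integral>x. (hajek (L s) h x)\<^sup>2 \<partial>L s)"
    using sample by eventually_elim (simp only: ustat_sample.variance_cond_exp_kernel)
  have "(\<lambda>s. 4 * (\<integral>x. (hajek (L s) h x)\<^sup>2 \<partial>L s)) \<longlonglongrightarrow> sigma2"
    using c(1) var by (rule Lim_transform_eventually)
  from filterlim_compose[OF this t(1)]
  have var_t: "(\<lambda>n. 4 * (\<integral>x. (hajek (L (t n)) h x)\<^sup>2 \<partial>L (t n))) \<longlonglongrightarrow> (sqrt sigma2)\<^sup>2"
    using c(2) by simp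
  interpret A: ustat_array M N "\<lambda>n. Y (t n)" "\<lambda>n. L (t n)" h C "sqrt sigma2"
    using var_t c(2) eventually_compose_filterlim[OF sample t(1)] by unfold_locales auto
  note mean_t = eventually_compose_filterlim[OF mean t(1)]
  have "(\<lambda>n. \<theta> (t n)) \<longlonglongrightarrow> \<mu>" by (rule filterlim_compose[OF d t(1)])
  then have lim: "(\<lambda>n. kernel_mean (L (t n)) h) \<longlonglongrightarrow> \<mu>"
    by (rule Lim_transform_eventually) (use mean_t in eventually_elim, simp)
  have cdf: "cdf std_normal_distribution \<tau> = 1 - \<alpha>"
    unfolding \<tau>_def using \<alpha> by (intro cdf_quantile_std_normal) auto
  \<comment> \<open>The discrepancies are extended reals; finiteness is part of
    \<open>stein_regular\<close>.\<close>
  obtain p q where pq: "KSD X fn P R = ereal p" "KSD X fn Q R = ereal q" "0 \<le> p" "0 \<le> q"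
    using KSD_nonneg[of X fn P R] KSD_nonneg[of X fn Q R] stein_P stein_Q
    unfolding stein_regular_def
    by (cases "KSD X fn P R"; cases "KSD X fn Q R") auto
  have \<mu>: "\<mu> = p\<^sup>2 - q\<^sup>2" by (simp add: \<mu>_def pq)
  show ?thesis
  proof (intro conjI impI)
    assume "KSD X fn P R \<le> KSD X fn Q R"
    then have "p\<^sup>2 \<le> q\<^sup>2" using pq by (intro power_mono) auto
    then consider "\<mu> = 0" | "\<mu> < 0" unfolding \<mu> by linarith
    then show "\<exists>l. (\<lambda>n. M.prob {\<omega> \<in> space M. rejects h (\<lambda>i. Y (t n) i \<omega>) n \<tau>}) \<longlonglongrightarrow> l \<and> l \<le> \<alpha>"
    proof cases
      case 1
      \<comment> \<open>For \<open>\<mu> = 0\<close> the growth condition on \<open>t\<close> says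
        precisely that the bias vanishes after multiplication by \<open>sqrt n\<close>.\<close>
      have "(\<lambda>n. sqrt (real n) * kernel_mean (L (t n)) h) \<longlonglongrightarrow> 0"
        using t(2) by (rule Lim_transform_eventually) (use mean_t in eventually_elim, simp add: 1)
      from A.rejection_boundary[OF this, of \<tau>] show ?thesis unfolding cdf by auto
    next
      case 2
      from A.rejection_null[OF lim this, of \<tau>] show ?thesis using \<alpha> by (intro exI[of _ 0]) simp
    qed
  next
    assume "KSD X fn P R > KSD X fn Q R"
    then have "q\<^sup>2 < p\<^sup>2" using pq by (intro power_strict_mono) auto
    then have "0 < \<mu>" unfolding \<mu> by simp
    from A.rejection_alternative[OF lim this]
    show "(\<lambda>n. M.prob {\<omega> \<in> space M. rejects h (\<lambda>i. Y (t n) i \<omega>) n \<tau>}) \<longlonglongrightarrow> 1" .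
  qed
qed

end
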